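(* The near action of $\mathrm{IET}^{\pm}$ (and hence of $\mathrm{IET}^{\bowtie}$) on $\mathbf{S}$ is not stably realizable. Moreover: \begin{enumerate} \item there exists a finitely generated subgroup of $\mathrm{IET}^{\pm}$ whose near action on $\mathbf{S}$ is not stably realizable; \item for every subgroup $\Lambda$ of $\mathbf{R}/\mathbf{Z}$ that has $\mathbf{Q}$-rank $\ge 2$, or is infinitely generated of $\mathbf{Q}$-rank $1$, the near action of $\mathrm{IET}^{\pm}_{\Lambda}$ (and hence of $\mathrm{IET}^{\bowtie}_{\Lambda}$) on $\mathbf{S}$ is not stably realizable. \end{enumerate}
   Context: Let $\mathbf{S}=\mathbf{R}/\mathbf{Z}$. Let $\widehat{\mathrm{PC}^{\bowtie}}(\mathbf{S})$ be the group of permutations of $\mathbf{S}$ that are continuous outside a finite subset, and $\mathrm{PC}^{\bowtie}(\mathbf{S})$ its quotient by the normal subgroup of finitely supported permutations. $\mathrm{IET}^{\bowtie}$ is the subgroup of $\mathrm{PC}^{\bowtie}(\mathbf{S})$ of piecewise isometric elements; $\mathrm{IET}^{\pm}\subset\mathrm{IET}^{\bowtie}$ is the subgroup of elements that are either orientation-preserving on all pieces or orientation-reversing on all pieces. For a subgroup $\Lambda$ of $\mathbf{R}/\mathbf{Z}$, $\mathrm{IET}^{\bowtie}_{\Lambda}$ is the subgroup of elements of $\mathrm{IET}^{\bowtie}$ with discontinuities in $\Lambda$ and local isometries of the form $x\mapsto\pm x+\lambda$ with $\lambda\in\Lambda$; $\mathrm{IET}^{\pm}_{\Lambda}=\mathrm{IET}^{\bowtie}_{\Lambda}\cap\mathrm{IET}^{\pm}$.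 The $\mathbf{Q}$-rank of an abelian group $A$ is $\dim_{\mathbf{Q}}(A\otimes_{\mathbf{Z}}\mathbf{Q})$. For a set $X$, the near symmetric group $\mathfrak{S}^\star(X)$ is the group of bijections between cofinite subsets of $X$, two of them being identified when they coincide on a cofinite subset; there is a canonical homomorphism $\mathfrak{S}(X)\to\mathfrak{S}^\star(X)$ from the group of all permutations of $X$, whose kernel is the group of finitely supported permutations. A near action of a group $G$ on $X$ is a homomorphism $G\to\mathfrak{S}^\star(X)$. It is realizable if it lifts to a homomorphism $G\to\mathfrak{S}(X)$. It is stably realizable if there is a set $Y$ such that the near action of $G$ on $X\sqcup Y$, given by the original one on $X$ and the trivial near action on $Y$, is realizable. Subgroups of $\mathrm{PC}^{\bowtie}(\mathbf{S})\subset\mathfrak{S}^\star(\mathbf{S})$ have an obvious near action on $\mathbf{S}$. *)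

theory Defs
  imports
    "HOL-Analysis.Analysis"
    "HOL-Algebra.Bij"
    "HOL-Algebra.Free_Abelian_Groups"
    "HOL-Library.Extended_Nat"
begin

section \<open>The circle \<open>R/Z\<close>\<close>

quotient_type circle = real / "\<lambda>x y. x - y \<in> \<int>"
  morphisms rep_circle to_circle
proof (rule equivpI)
  show "reflp (\<lambda>x y::real. x - y \<in> \<int>)"
    by (auto intro: reflpI)
  show "symp (\<lambda>x y::real. x - y \<in> \<int>)"
    by (rule sympI) (metis Ints_minus minus_diff_eq)
  show "transp (\<lambda>x y::real. x - y \<in> \<int>)"
  proof (rule transpI)
    fix x y z :: real
    assume "x - y \<in> \<int>" "y - z \<in> \<int>"
    then have "(x - y) + (y - z) \<in> \<int>"
      by (rule Ints_add)
    then show "x - z \<in> \<int>"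
      by simp
  qed
qed

instantiation circle :: ab_group_add
begin

lift_definition zero_circle :: circle is 0 .

lift_definition plus_circle :: "circle \<Rightarrow> circle \<Rightarrow> circle" is "(+)"
  by (metis Ints_add add_diff_add)

lift_definition uminus_circle :: "circle \<Rightarrow> circle" is uminus
  by (metis Ints_minus minus_diff_minus)

lift_definition minus_circle :: "circle \<Rightarrow> circle \<Rightarrow> circle" is "(-)"
  by (metis Ints_diff diff_diff_eq2 diff_add_eq add_diff_eq diff_diff_add add.commute)

instance
  by standard (transfer; simp)+

end

definition Z_dist :: "real \<Rightarrow> real" where
  "Z_dist x = (INF n::int. \<bar>x - of_int n\<bar>)"

lemma Z_dist_bdd: "bdd_below (range (\<lambda>n::int. \<bar>x - of_int n :: real\<bar>))"
  by (rule bdd_belowI[of _ 0]) auto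

lemma Z_dist_le: "Z_dist x \<le> \<bar>x - of_int n\<bar>"
  unfolding Z_dist_def by (rule cINF_lower[OF Z_dist_bdd]) simp

lemma Z_dist_attained: "\<exists>n::int. Z_dist x = \<bar>x - of_int n\<bar>"
proof -
  have "\<bar>x - of_int (round x)\<bar> \<le> \<bar>x - of_int n\<bar>" for n
    using round_diff_minimal by (metis abs_minus_commute)
  then have "\<bar>x - of_int (round x)\<bar> \<le> Z_dist x"
    unfolding Z_dist_def by (intro cINF_greatest) auto
  then show ?thesis
    using Z_dist_le[of x "round x"] by (intro exI[of _ "round x"]) simp
qed

lemma Z_dist_cong:
  assumes "x - y \<in> \<int>"
  shows "Z_dist x = Z_dist y"
proof -
  have le: "Z_dist a \<le> Z_dist b" if ab: "a - b \<in> \<int>" for a b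
  proof -
    obtain k where k: "a - b = of_int k" using ab by (rule Ints_cases)
    obtain n where n: "Z_dist b = \<bar>b - of_int n\<bar>" using Z_dist_attained by blast
    have "Z_dist a \<le> \<bar>a - of_int (n + k)\<bar>" by (rule Z_dist_le)
    also have "\<dots> = Z_dist b" using k n by simp
    finally show ?thesis .
  qed
  have "y - x \<in> \<int>" using assms by (metis Ints_minus minus_diff_eq)
  then show ?thesis using le assms by (meson order_antisym)
qed

instantiation circle :: metric_space
begin

lift_definition dist_circle :: "circle \<Rightarrow> circle \<Rightarrow> real" is "\<lambda>x y. Z_dist (x - y)"
proof (rule Z_dist_cong)
  fix x x' y y' :: real
  assume "x - x' \<in> \<int>" "y - y' \<in> \<int>"
  then have "(x - x') - (y - y') \<in> \<int>" by (rule Ints_diff)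
  then show "(x - y) - (x' - y') \<in> \<int>" by (simp add: algebra_simps)
qed

definition uniformity_circle :: "(circle \<times> circle) filter" where
  "uniformity_circle = (INF e\<in>{0<..}. principal {(x, y). dist x y < e})"

definition open_circle :: "circle set \<Rightarrow> bool" where
  "open_circle U \<longleftrightarrow> (\<forall>x\<in>U. \<forall>\<^sub>F (x', y) in uniformity. x' = x \<longrightarrow> y \<in> U)"

instance
proof
  fix x y z :: circle
  show "dist x y = 0 \<longleftrightarrow> x = y"
  proof (transfer, standard)
    fix x y :: real
    assume "Z_dist (x - y) = 0"
    then obtain n :: int where "\<bar>(x - y) - of_int n\<bar> = 0"
      using Z_dist_attained[of "x - y"] by auto
    then have "x - y = of_int n" by linarith
    then show "x - y \<in> \<int>" by simp
  next
    fix x y :: real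
    assume "x - y \<in> \<int>"
    then have "Z_dist (x - y) = Z_dist 0" by (intro Z_dist_cong) simp
    moreover have "Z_dist 0 \<le> 0" using Z_dist_le[of 0 0] by simp
    moreover have "Z_dist 0 \<ge> 0" using Z_dist_attained[of 0] by auto
    ultimately show "Z_dist (x - y) = 0" by linarith
  qed
  show "dist x y \<le> dist x z + dist y z"
  proof transfer
    fix x y z :: real
    obtain m n where m: "Z_dist (x - z) = \<bar>x - z - of_int m\<bar>"
      and n: "Z_dist (y - z) = \<bar>y - z - of_int n\<bar>"
      using Z_dist_attained by metis
    have "Z_dist (x - y) \<le> \<bar>x - y - of_int (m - n)\<bar>" by (rule Z_dist_le)
    also have "\<dots> \<le> \<bar>x - z - of_int m\<bar> + \<bar>y - z - of_int n\<bar>" by simp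
    finally show "Z_dist (x - y) \<le> Z_dist (x - z) + Z_dist (y - z)" using m n by simp
  qed
qed (simp_all add: uniformity_circle_def open_circle_def)

end

lemma dist_to_circle: "dist (to_circle x) (to_circle y) = (INF n::int. \<bar>x - y - of_int n\<bar>)"
  by (simp add: dist_circle.abs_eq Z_dist_def)

definition circle_group :: "circle monoid" where
  "circle_group = \<lparr>carrier = UNIV, mult = (+), one = 0\<rparr>"

lemma comm_group_circle_group: "comm_group circle_group"
proof (rule comm_groupI)
  fix x assume "x \<in> carrier circle_group"
  show "\<exists>y\<in>carrier circle_group. y \<otimes>\<^bsub>circle_group\<^esub> x = \<one>\<^bsub>circle_group\<^esub>"
    by (rule bexI[of _ "- x"]) (simp_all add: circle_group_def)
qed (simp_all add: circle_group_def ac_simps)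


section \<open>Near symmetric groups and near actions\<close>

text \<open>
  A bijection between cofinite subsets of \<open>X\<close> is a partial map whose domain and range are those
  subsets.
\<close>

definition near_bij :: "'a set \<Rightarrow> ('a \<rightharpoonup> 'a) set" where
  "near_bij X = {f. dom f \<subseteq> X \<and> finite (X - dom f) \<and> ran f \<subseteq> X \<and> finite (X - ran f) \<and>
     inj_on f (dom f)}"

definition near_eq :: "'a set \<Rightarrow> (('a \<rightharpoonup> 'a) \<times> ('a \<rightharpoonup> 'a)) set" where
  "near_eq X = {(f, g). f \<in> near_bij X \<and> g \<in> near_bij X \<and>
     (\<exists>A. A \<subseteq> dom f \<inter> dom g \<and> finite (X - A) \<and> (\<forall>x\<in>A. f x = g x))}"

definition near_sym :: "'a set \<Rightarrow> ('a \<rightharpoonup> 'a) set monoid" where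
  "near_sym X =
    \<lparr>carrier = near_bij X // near_eq X,
     mult = (\<lambda>C D. \<Union>f\<in>C. \<Union>g\<in>D. near_eq X `` {f \<circ>\<^sub>m g}),
     one = near_eq X `` {Some |` X}\<rparr>"

definition near_class :: "'a set \<Rightarrow> ('a \<Rightarrow> 'a) \<Rightarrow> ('a \<rightharpoonup> 'a) set" where
  "near_class X f = near_eq X `` {(\<lambda>x. Some (f x)) |` X}"

definition near_action :: "('g, 'm) monoid_scheme \<Rightarrow> 'a set \<Rightarrow> ('g \<Rightarrow> ('a \<rightharpoonup> 'a) set) \<Rightarrow> bool" where
  "near_action G X \<alpha> \<longleftrightarrow> \<alpha> \<in> hom G (near_sym X)"

definition realizable :: "('g, 'm) monoid_scheme \<Rightarrow> 'a set \<Rightarrow> ('g \<Rightarrow> ('a \<rightharpoonup> 'a) set) \<Rightarrow> bool" where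
  "realizable G X \<alpha> \<longleftrightarrow>
     (\<exists>\<phi>\<in>hom G (BijGroup X). \<forall>g\<in>carrier G. near_class X (\<phi> g) = \<alpha> g)"

definition extend_by_id :: "'b set \<Rightarrow> ('a \<rightharpoonup> 'a) \<Rightarrow> ('a + 'b \<rightharpoonup> 'a + 'b)" where
  "extend_by_id Y f z =
     (case z of Inl x \<Rightarrow> map_option Inl (f x) | Inr y \<Rightarrow> if y \<in> Y then Some (Inr y) else None)"

definition near_extend ::
    "'a set \<Rightarrow> 'b set \<Rightarrow> ('a \<rightharpoonup> 'a) set \<Rightarrow> ('a + 'b \<rightharpoonup> 'a + 'b) set" where
  "near_extend X Y C = (\<Union>f\<in>C. near_eq (X <+> Y) `` {extend_by_id Y f})"

text \<open>
  The set \<open>Y\<close> is arbitrary. A single formula cannot quantify over the type of its elements, but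
  sets \<open>Y\<close> of type \<open>('g \<times> 'a) set\<close> suffice: in a realization on \<open>X <+> Y\<close> the points of \<open>Y\<close>
  outside the orbits of points of \<open>X\<close> may be discarded. This is the lemma
  \<open>stably_realizable_any_type\<close> below.
\<close>

definition stably_realizable ::
    "('g, 'm) monoid_scheme \<Rightarrow> 'a set \<Rightarrow> ('g \<Rightarrow> ('a \<rightharpoonup> 'a) set) \<Rightarrow> bool" where
  "stably_realizable G X \<alpha> \<longleftrightarrow>
     (\<exists>Y :: ('g \<times> 'a) set. realizable G (X <+> Y) (\<lambda>g. near_extend X Y (\<alpha> g)))"

lemma near_eq_iff:
  "(f, g) \<in> near_eq X \<longleftrightarrow>
     f \<in> near_bij X \<and> g \<in> near_bij X \<and> finite {x\<in>X. f x \<noteq> g x}"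
proof (cases "f \<in> near_bij X \<and> g \<in> near_bij X")
  case True
  show ?thesis
  proof
    assume "(f, g) \<in> near_eq X"
    then obtain A where A: "finite (X - A)" "\<forall>x\<in>A. f x = g x"
      unfolding near_eq_def by blast
    have "{x\<in>X. f x \<noteq> g x} \<subseteq> X - A" using A by blast
    then show "f \<in> near_bij X \<and> g \<in> near_bij X \<and> finite {x\<in>X. f x \<noteq> g x}"
      using True A finite_subset by blast
  next
    assume fin: "f \<in> near_bij X \<and> g \<in> near_bij X \<and> finite {x\<in>X. f x \<noteq> g x}"
    let ?A = "{x\<in>dom f \<inter> dom g. f x = g x}"
    have "X - ?A \<subseteq> (X - dom f) \<union> (X - dom g) \<union> {x\<in>X. f x \<noteq> g x}" by blast
    moreover have "finite ((X - dom f) \<union> (X - dom g) \<union> {x\<in>X. f x \<noteq> g x})"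
      using fin unfolding near_bij_def by simp
    ultimately have "finite (X - ?A)" by (rule finite_subset)
    moreover have "?A \<subseteq> dom f \<inter> dom g" "\<forall>x\<in>?A. f x = g x" by auto
    ultimately have "\<exists>A. A \<subseteq> dom f \<inter> dom g \<and> finite (X - A) \<and> (\<forall>x\<in>A. f x = g x)"
      by (intro exI conjI)
    then show "(f, g) \<in> near_eq X"
      using True by (simp add: near_eq_def)
  qed
next
  case False
  then show ?thesis unfolding near_eq_def by blast
qed

lemma equiv_near_eq: "equiv (near_bij X) (near_eq X)"
proof (rule equivI)
  show "near_eq X \<subseteq> near_bij X \<times> near_bij X" by (auto simp: near_eq_def)
  show "refl_on (near_bij X) (near_eq X)" by (auto simp: refl_on_def near_eq_iff)
  show "sym (near_eq X)" by (rule symI) (auto simp: near_eq_iff eq_commute)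
  show "trans (near_eq X)"
  proof (rule transI)
    fix f g h assume *: "(f, g) \<in> near_eq X" "(g, h) \<in> near_eq X"
    have "{x\<in>X. f x \<noteq> h x} \<subseteq> {x\<in>X. f x \<noteq> g x} \<union> {x\<in>X. g x \<noteq> h x}" by auto
    then have "finite {x\<in>X. f x \<noteq> h x}"
      by (rule finite_subset) (use * in \<open>auto simp: near_eq_iff\<close>)
    with * show "(f, h) \<in> near_eq X" by (simp add: near_eq_iff)
  qed
qed

lemma near_bij_inj:
  assumes "f \<in> near_bij X" "f x = Some z" "f y = Some z"
  shows "x = y"
proof -
  have "inj_on f (dom f)" using assms(1) by (simp add: near_bij_def)
  then show ?thesis using assms(2,3) by (metis domI inj_onD)
qed

lemma near_bij_comp:
  assumes f: "f \<in> near_bij X" and g: "g \<in> near_bij X"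
  shows "f \<circ>\<^sub>m g \<in> near_bij X"
proof -
  have injf: "x = y" if "f x = Some z" "f y = Some z" for x y z
    using near_bij_inj[OF f] that by blast
  have injg: "x = y" if "g x = Some z" "g y = Some z" for x y z
    using near_bij_inj[OF g] that by blast
  have "X - dom (f \<circ>\<^sub>m g) \<subseteq> (X - dom g) \<union> (\<lambda>y. THE x. g x = Some y) ` (X - dom f)"
  proof
    fix x assume x: "x \<in> X - dom (f \<circ>\<^sub>m g)"
    show "x \<in> (X - dom g) \<union> (\<lambda>y. THE x. g x = Some y) ` (X - dom f)"
    proof (cases "g x")
      case (Some y)
      then have "y \<in> X" using g unfolding near_bij_def by (auto simp: ran_def)
      moreover have "y \<notin> dom f" using x Some by (auto simp: map_comp_def dom_def)
      moreover have "x = (THE x. g x = Some y)" by (rule the_equality[symmetric]) (use Some injg in blast)+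
      ultimately show ?thesis by blast
    qed (use x in auto)
  qed
  then have fin_dom: "finite (X - dom (f \<circ>\<^sub>m g))"
    by (rule finite_subset) (use f g in \<open>auto simp: near_bij_def\<close>)
  have "X - ran (f \<circ>\<^sub>m g) \<subseteq> (X - ran f) \<union> (\<lambda>y. the (f y)) ` (X - ran g)"
  proof
    fix z assume z: "z \<in> X - ran (f \<circ>\<^sub>m g)"
    show "z \<in> (X - ran f) \<union> (\<lambda>y. the (f y)) ` (X - ran g)"
    proof (cases "z \<in> ran f")
      case True
      then obtain y where y: "f y = Some z" by (auto simp: ran_def)
      then have "y \<in> X" using f by (auto simp: near_bij_def)
      moreover have "y \<notin> ran g"
      proof
        assume "y \<in> ran g"
        then obtain a where "g a = Some y" by (auto simp: ran_def)
        then have "(f \<circ>\<^sub>m g) a = Some z" using y by simp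
        then show False using z by (auto simp: ran_def)
      qed
      ultimately show ?thesis using y by force
    qed (use z in auto)
  qed
  then have fin_ran: "finite (X - ran (f \<circ>\<^sub>m g))"
    by (rule finite_subset) (use f g in \<open>auto simp: near_bij_def\<close>)
  have "inj_on (f \<circ>\<^sub>m g) (dom (f \<circ>\<^sub>m g))"
  proof (rule inj_onI)
    fix x y assume "x \<in> dom (f \<circ>\<^sub>m g)" "(f \<circ>\<^sub>m g) x = (f \<circ>\<^sub>m g) y"
    then obtain z where "(f \<circ>\<^sub>m g) x = Some z" "(f \<circ>\<^sub>m g) y = Some z" by (metis domD)
    then show "x = y"
      unfolding map_comp_Some_iff using injf injg by blast
  qed
  moreover have "dom (f \<circ>\<^sub>m g) \<subseteq> X"
    using g by (auto simp: near_bij_def dom_def map_comp_Some_iff)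
  moreover have "ran (f \<circ>\<^sub>m g) \<subseteq> X"
    using f by (auto simp: near_bij_def ran_def map_comp_Some_iff)
  ultimately show ?thesis
    using fin_dom fin_ran by (simp add: near_bij_def)
qed

lemma near_eq_comp:
  assumes "(f, f') \<in> near_eq X" "(g, g') \<in> near_eq X"
  shows "(f \<circ>\<^sub>m g, f' \<circ>\<^sub>m g') \<in> near_eq X"
proof -
  have g: "g \<in> near_bij X" using assms by (simp add: near_eq_iff)
  have injg: "x = y" if "g x = Some z" "g y = Some z" for x y z
    using near_bij_inj[OF g] that by blast
  have "{x\<in>X. (f \<circ>\<^sub>m g) x \<noteq> (f' \<circ>\<^sub>m g') x} \<subseteq>
      {x\<in>X. g x \<noteq> g' x} \<union> (\<lambda>y. THE x. g x = Some y) ` {y\<in>X. f y \<noteq> f' y}" (is "_ \<subseteq> ?R")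
  proof
    fix x assume x: "x \<in> {x\<in>X. (f \<circ>\<^sub>m g) x \<noteq> (f' \<circ>\<^sub>m g') x}"
    show "x \<in> ?R"
    proof (cases "g x = g' x")
      case True
      with x obtain y where y: "g x = Some y" "f y \<noteq> f' y"
        by (cases "g' x") (auto simp: map_comp_def)
      then have "y \<in> X" using g unfolding near_bij_def by (auto simp: ran_def)
      moreover have "x = (THE x. g x = Some y)" by (rule the_equality[symmetric]) (use y injg in blast)+
      ultimately show ?thesis using y by blast
    qed (use x in auto)
  qed
  then have "finite {x\<in>X. (f \<circ>\<^sub>m g) x \<noteq> (f' \<circ>\<^sub>m g') x}"
    by (rule finite_subset) (use assms in \<open>auto simp: near_eq_iff\<close>)
  then show ?thesis using assms by (simp add: near_eq_iff near_bij_comp)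
qed

lemma near_sym_mult:
  assumes "f \<in> near_bij X" "g \<in> near_bij X"
  shows "near_eq X `` {f} \<otimes>\<^bsub>near_sym X\<^esub> near_eq X `` {g} = near_eq X `` {f \<circ>\<^sub>m g}"
proof -
  have eq: "near_eq X `` {f' \<circ>\<^sub>m g'} = near_eq X `` {f \<circ>\<^sub>m g}"
    if "f' \<in> near_eq X `` {f}" "g' \<in> near_eq X `` {g}" for f' g'
    using equiv_class_eq[OF equiv_near_eq near_eq_comp[of f f' X g g']] that by simp
  have mem: "f \<in> near_eq X `` {f}" "g \<in> near_eq X `` {g}"
    using assms by (simp_all add: near_eq_iff)
  have "(\<Union>f'\<in>near_eq X `` {f}. \<Union>g'\<in>near_eq X `` {g}. near_eq X `` {f' \<circ>\<^sub>m g'}) =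
      (\<Union>f'\<in>near_eq X `` {f}. \<Union>g'\<in>near_eq X `` {g}. near_eq X `` {f \<circ>\<^sub>m g})"
    by (intro SUP_cong refl eq)
  also have "\<dots> = near_eq X `` {f \<circ>\<^sub>m g}"
    using mem by blast
  finally show ?thesis
    by (simp only: near_sym_def monoid.simps)
qed

lemma near_sym_carrierE:
  assumes "C \<in> carrier (near_sym X)"
  obtains f where "f \<in> near_bij X" "C = near_eq X `` {f}"
proof -
  have "C \<in> near_bij X // near_eq X"
    using assms by (simp only: near_sym_def partial_object.simps)
  then show thesis
    by (rule quotientE) (use that in blast)
qed

lemma near_sym_carrierI: "f \<in> near_bij X \<Longrightarrow> near_eq X `` {f} \<in> carrier (near_sym X)"
  unfolding near_sym_def partial_object.simps by (rule quotientI)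

lemma near_bij_perm:
  assumes "bij_betw f X X"
  shows "(\<lambda>x. Some (f x)) |` X \<in> near_bij X"
proof -
  let ?f = "(\<lambda>x. Some (f x)) |` X"
  have "dom ?f = X" by (auto simp: dom_def restrict_map_def)
  moreover have "ran ?f = f ` X" by (auto simp: ran_def restrict_map_def split: if_splits)
  moreover have "inj_on ?f X"
    using bij_betw_imp_inj_on[OF assms] by (intro inj_onI) (simp add: inj_onD)
  ultimately show ?thesis
    using assms by (simp add: near_bij_def bij_betw_def)
qed

lemma near_bij_id: "Some |` X \<in> near_bij X"
  using near_bij_perm[of id X] by (simp add: id_def bij_betw_def)

theorem group_near_sym: "group (near_sym X)"
proof (rule groupI)
  fix C D assume "C \<in> carrier (near_sym X)" "D \<in> carrier (near_sym X)"
  then show "C \<otimes>\<^bsub>near_sym X\<^esub> D \<in> carrier (near_sym X)"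
    by (elim near_sym_carrierE) (simp add: near_sym_mult near_sym_carrierI near_bij_comp)
next
  show "\<one>\<^bsub>near_sym X\<^esub> \<in> carrier (near_sym X)"
    using near_sym_carrierI[OF near_bij_id] by (simp add: near_sym_def)
next
  fix C D E assume "C \<in> carrier (near_sym X)" "D \<in> carrier (near_sym X)" "E \<in> carrier (near_sym X)"
  moreover have "(f \<circ>\<^sub>m g) \<circ>\<^sub>m h = f \<circ>\<^sub>m (g \<circ>\<^sub>m h)" for f g h :: "'a \<rightharpoonup> 'a"
    by (rule ext) (simp add: map_comp_def split: option.splits)
  ultimately show "C \<otimes>\<^bsub>near_sym X\<^esub> D \<otimes>\<^bsub>near_sym X\<^esub> E = C \<otimes>\<^bsub>near_sym X\<^esub> (D \<otimes>\<^bsub>near_sym X\<^esub> E)"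
    by (elim near_sym_carrierE) (simp add: near_sym_mult near_bij_comp)
next
  fix C assume "C \<in> carrier (near_sym X)"
  then obtain f where f: "f \<in> near_bij X" "C = near_eq X `` {f}" by (rule near_sym_carrierE)
  have "Some |` X \<circ>\<^sub>m f = f"
    using f(1) by (intro ext) (auto simp: near_bij_def map_comp_def restrict_map_def ran_def
        split: option.splits)
  then show "\<one>\<^bsub>near_sym X\<^esub> \<otimes>\<^bsub>near_sym X\<^esub> C = C"
    using near_sym_mult[OF near_bij_id f(1)] f(2) by (simp add: near_sym_def)
next
  fix C assume "C \<in> carrier (near_sym X)"
  then obtain f where f: "f \<in> near_bij X" "C = near_eq X `` {f}" by (rule near_sym_carrierE)
  have injf: "x = y" if "f x = Some z" "f y = Some z" for x y z
    using near_bij_inj[OF f(1)] that by blast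
  define g where "g z = (if z \<in> ran f then Some (THE x. f x = Some z) else None)" for z
  have g: "g z = Some x \<longleftrightarrow> f x = Some z" for x z
  proof
    assume *: "g z = Some x"
    then have "z \<in> ran f" by (auto simp: g_def split: if_splits)
    then obtain x' where x': "f x' = Some z" by (auto simp: ran_def)
    then have "(THE x. f x = Some z) = x'" by (rule the_equality) (use x' injf in blast)
    then show "f x = Some z" using * x' \<open>z \<in> ran f\<close> by (simp add: g_def)
  next
    assume *: "f x = Some z"
    then have "(THE x. f x = Some z) = x" by (rule the_equality) (use * injf in blast)
    moreover have "z \<in> ran f" using * by (auto simp: ran_def)
    ultimately show "g z = Some x" by (simp add: g_def)
  qed
  have dg: "dom g = ran f" "ran g = dom f" using g by (auto simp: dom_def ran_def)
  have "inj_on g (ran f)"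
  proof (rule inj_onI)
    fix y z assume "y \<in> ran f" "z \<in> ran f" "g y = g z"
    then obtain x where "g y = Some x" "g z = Some x" using dg by (metis domD)
    then show "y = z" unfolding g by simp
  qed
  then have "g \<in> near_bij X"
    using f(1) by (simp add: near_bij_def dg)
  have "(g \<circ>\<^sub>m f, Some |` X) \<in> near_eq X"
  proof -
    have "{x\<in>X. (g \<circ>\<^sub>m f) x \<noteq> (Some |` X) x} \<subseteq> X - dom f"
      using g by (auto simp: map_comp_def restrict_map_def)
    then have "finite {x\<in>X. (g \<circ>\<^sub>m f) x \<noteq> (Some |` X) x}"
      by (rule finite_subset) (use f(1) in \<open>simp add: near_bij_def\<close>)
    then show ?thesis
      using near_bij_comp[OF \<open>g \<in> near_bij X\<close> f(1)] near_bij_id by (simp add: near_eq_iff)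
  qed
  then have "near_eq X `` {g \<circ>\<^sub>m f} = near_eq X `` {Some |` X}"
    by (rule equiv_class_eq[OF equiv_near_eq])
  then have "near_eq X `` {g} \<otimes>\<^bsub>near_sym X\<^esub> C = \<one>\<^bsub>near_sym X\<^esub>"
    unfolding f(2) near_sym_mult[OF \<open>g \<in> near_bij X\<close> f(1)] by (simp add: near_sym_def)
  then show "\<exists>D\<in>carrier (near_sym X). D \<otimes>\<^bsub>near_sym X\<^esub> C = \<one>\<^bsub>near_sym X\<^esub>"
    using near_sym_carrierI[OF \<open>g \<in> near_bij X\<close>] by blast
qed

lemma near_class_eq_iff:
  assumes "bij_betw f X X" "bij_betw g X X"
  shows "near_class X f = near_class X g \<longleftrightarrow> finite {x\<in>X. f x \<noteq> g x}"
proof -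
  have "{x\<in>X. ((\<lambda>x. Some (f x)) |` X) x \<noteq> ((\<lambda>x. Some (g x)) |` X) x} = {x\<in>X. f x \<noteq> g x}"
    by auto
  then show ?thesis
    unfolding near_class_def
      eq_equiv_class_iff[OF equiv_near_eq near_bij_perm near_bij_perm, OF assms]
    using near_bij_perm[OF assms(1)] near_bij_perm[OF assms(2)] by (simp add: near_eq_iff)
qed

lemma near_class_hom: "near_class X \<in> hom (BijGroup X) (near_sym X)"
proof (rule homI)
  fix f assume "f \<in> carrier (BijGroup X)"
  then have "bij_betw f X X"
    by (simp add: BijGroup_def Bij_def)
  then show "near_class X f \<in> carrier (near_sym X)"
    unfolding near_class_def by (intro near_sym_carrierI near_bij_perm)
next
  fix f g assume "f \<in> carrier (BijGroup X)" "g \<in> carrier (BijGroup X)"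
  then have fg: "f \<in> Bij X" "g \<in> Bij X" "bij_betw f X X" "bij_betw g X X"
    by (simp_all add: BijGroup_def Bij_def)
  have "(\<lambda>x. Some (f x)) |` X \<circ>\<^sub>m (\<lambda>x. Some (g x)) |` X = (\<lambda>x. Some (compose X f g x)) |` X"
  proof (rule ext)
    fix x
    have "x \<in> X \<Longrightarrow> g x \<in> X" using fg(4) by (auto dest: bij_betwE)
    then show "((\<lambda>x. Some (f x)) |` X \<circ>\<^sub>m (\<lambda>x. Some (g x)) |` X) x =
        ((\<lambda>x. Some (compose X f g x)) |` X) x"
      by (cases "x \<in> X") (simp_all add: map_comp_def compose_def)
  qed
  then show "near_class X (f \<otimes>\<^bsub>BijGroup X\<^esub> g) = near_class X f \<otimes>\<^bsub>near_sym X\<^esub> near_class X g"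
    unfolding near_class_def using fg
    by (simp add: near_sym_mult near_bij_perm BijGroup_def)
qed


lemma extend_by_id_simps [simp]:
  "extend_by_id Y f (Inl x) = map_option Inl (f x)"
  "extend_by_id Y f (Inr y) = (if y \<in> Y then Some (Inr y) else None)"
  by (simp_all add: extend_by_id_def)

lemma near_bij_extend:
  assumes f: "f \<in> near_bij X"
  shows "extend_by_id Y f \<in> near_bij (X <+> Y)"
proof -
  have d: "dom (extend_by_id Y f) = dom f <+> Y"
  proof (rule Set.set_eqI)
    fix z show "z \<in> dom (extend_by_id Y f) \<longleftrightarrow> z \<in> dom f <+> Y"
      by (cases z) (auto simp: dom_def)
  qed
  have r: "ran (extend_by_id Y f) = ran f <+> Y"
  proof (intro Set.set_eqI iffI)
    fix z assume "z \<in> ran (extend_by_id Y f)"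
    then obtain w where "extend_by_id Y f w = Some z" by (auto simp: ran_def)
    then show "z \<in> ran f <+> Y" by (cases w) (auto simp: ran_def split: if_splits)
  next
    fix z assume "z \<in> ran f <+> Y"
    then show "z \<in> ran (extend_by_id Y f)"
    proof (elim PlusE)
      fix x assume "x \<in> ran f" "z = Inl x"
      then obtain a where "extend_by_id Y f (Inl a) = Some z" by (auto simp: ran_def)
      then show ?thesis by (rule ranI)
    next
      fix y assume "y \<in> Y" "z = Inr y"
      then have "extend_by_id Y f (Inr y) = Some z" by simp
      then show ?thesis by (rule ranI)
    qed
  qed
  have fin: "finite (X <+> Y - (A <+> Y))" if "finite (X - A)" for A
  proof (rule finite_subset)
    show "X <+> Y - (A <+> Y) \<subseteq> Inl ` (X - A)" by auto
    show "finite (Inl ` (X - A))" using that by simp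
  qed
  have inj: "inj_on (extend_by_id Y f) (dom f <+> Y)"
  proof (rule inj_onI)
    fix v w
    assume v: "v \<in> dom f <+> Y" and w: "w \<in> dom f <+> Y"
      and eq: "extend_by_id Y f v = extend_by_id Y f w"
    show "v = w"
    proof (cases v; cases w)
      fix a b assume ab: "v = Inl a" "w = Inl b"
      then obtain x y where "f a = Some x" "f b = Some y" using v w by auto
      then show ?thesis using eq ab near_bij_inj[OF f] by simp
    next
      fix a b assume "v = Inl a" "w = Inr b"
      then show ?thesis using v w eq by auto
    next
      fix a b assume "v = Inr a" "w = Inl b"
      then show ?thesis using v w eq by auto
    next
      fix a b assume "v = Inr a" "w = Inr b"
      then show ?thesis using v w eq by auto
    qed
  qed
  have "dom f \<subseteq> X" "ran f \<subseteq> X" "finite (X - dom f)" "finite (X - ran f)"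
    using f by (simp_all add: near_bij_def)
  then have "dom f <+> Y \<subseteq> X <+> Y" "ran f <+> Y \<subseteq> X <+> Y"
      "finite (X <+> Y - (dom f <+> Y))" "finite (X <+> Y - (ran f <+> Y))"
    using fin by auto
  then show ?thesis
    using inj by (simp add: near_bij_def d r)
qed

lemma near_eq_extend:
  assumes "(f, g) \<in> near_eq X"
  shows "(extend_by_id Y f, extend_by_id Y g) \<in> near_eq (X <+> Y)"
proof -
  have "{z\<in>X <+> Y. extend_by_id Y f z \<noteq> extend_by_id Y g z} \<subseteq> Inl ` {x\<in>X. f x \<noteq> g x}"
    by auto
  then have "finite {z\<in>X <+> Y. extend_by_id Y f z \<noteq> extend_by_id Y g z}"
    by (rule finite_subset) (use assms in \<open>simp add: near_eq_iff\<close>)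
  then show ?thesis
    using assms by (simp add: near_eq_iff near_bij_extend)
qed

lemma near_extend_class:
  assumes f: "f \<in> near_bij X"
  shows "near_extend X Y (near_eq X `` {f}) = near_eq (X <+> Y) `` {extend_by_id Y f}"
proof -
  have eq: "near_eq (X <+> Y) `` {extend_by_id Y g} = near_eq (X <+> Y) `` {extend_by_id Y f}"
    if "g \<in> near_eq X `` {f}" for g
    using equiv_class_eq[OF equiv_near_eq near_eq_extend[of f g X Y]] that by simp
  have "f \<in> near_eq X `` {f}" using f by (simp add: near_eq_iff)
  moreover have "near_extend X Y (near_eq X `` {f}) =
      (\<Union>g\<in>near_eq X `` {f}. near_eq (X <+> Y) `` {extend_by_id Y f})"
    unfolding near_extend_def by (intro SUP_cong refl eq)
  ultimately show ?thesis by blast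
qed

lemma near_extend_hom: "near_extend X Y \<in> hom (near_sym X) (near_sym (X <+> Y))"
proof (rule homI)
  fix C assume "C \<in> carrier (near_sym X)"
  then show "near_extend X Y C \<in> carrier (near_sym (X <+> Y))"
    by (elim near_sym_carrierE) (simp add: near_extend_class near_sym_carrierI near_bij_extend)
next
  fix C D assume "C \<in> carrier (near_sym X)" "D \<in> carrier (near_sym X)"
  then obtain f g where fg: "f \<in> near_bij X" "g \<in> near_bij X"
      "C = near_eq X `` {f}" "D = near_eq X `` {g}"
    by (meson near_sym_carrierE)
  have "extend_by_id Y (f \<circ>\<^sub>m g) = extend_by_id Y f \<circ>\<^sub>m extend_by_id Y g"
  proof (rule ext)
    fix z show "extend_by_id Y (f \<circ>\<^sub>m g) z = (extend_by_id Y f \<circ>\<^sub>m extend_by_id Y g) z"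
      by (cases z) (auto simp: map_comp_def split: option.splits)
  qed
  with fg show "near_extend X Y (C \<otimes>\<^bsub>near_sym X\<^esub> D) =
      near_extend X Y C \<otimes>\<^bsub>near_sym (X <+> Y)\<^esub> near_extend X Y D"
    by (simp add: near_sym_mult near_extend_class near_bij_comp near_bij_extend)
qed

lemma near_action_extend:
  "near_action G X \<alpha> \<Longrightarrow> near_action G (X <+> Y) (\<lambda>g. near_extend X Y (\<alpha> g))"
  unfolding near_action_def using hom_compose[OF _ near_extend_hom] by (fastforce simp: o_def)

theorem stably_realizable_any_type:
  fixes G :: "('g, 'm) monoid_scheme" (structure) and X :: "'a set" and Y :: "'b set"
  assumes G: "group G" and \<alpha>: "near_action G X \<alpha>"
    and real: "realizable G (X <+> Y) (\<lambda>g. near_extend X Y (\<alpha> g))"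
  shows "stably_realizable G X \<alpha>"
proof -
  interpret group G by (rule G)
  obtain \<phi> where \<phi>: "\<phi> \<in> hom G (BijGroup (X <+> Y))"
    and cls: "\<And>g. g \<in> carrier G \<Longrightarrow> near_class (X <+> Y) (\<phi> g) = near_extend X Y (\<alpha> g)"
    using real unfolding realizable_def by blast
  have \<phi>_bij: "bij_betw (\<phi> g) (X <+> Y) (X <+> Y)" if "g \<in> carrier G" for g
    using \<phi> that by (auto simp: hom_def BijGroup_def Bij_def)
  have \<phi>_in: "\<phi> g z \<in> X <+> Y" if "g \<in> carrier G" "z \<in> X <+> Y" for g z
    using \<phi>_bij[OF that(1)] that(2) by (auto simp: bij_betw_def)
  have \<phi>_Bij: "\<phi> g \<in> Bij (X <+> Y)" if "g \<in> carrier G" for g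
    using \<phi> that by (auto simp: hom_def BijGroup_def)
  have \<phi>_mult: "\<phi> (g \<otimes> h) z = \<phi> g (\<phi> h z)" if "g \<in> carrier G" "h \<in> carrier G" "z \<in> X <+> Y" for g h z
    using \<phi> that \<phi>_Bij by (simp add: hom_mult[OF \<phi>] BijGroup_def compose_def)
  have "\<phi> \<one> = \<one>\<^bsub>BijGroup (X <+> Y)\<^esub>"
    using hom_one[OF \<phi> G group_BijGroup] .
  then have \<phi>_one: "\<phi> \<one> z = z" if "z \<in> X <+> Y" for z
    using that by (simp add: BijGroup_def)

  define orb where "orb = (\<lambda>(g, x). \<phi> g (Inl x)) ` (carrier G \<times> X)"
  define Y' where "Y' = {y\<in>Y. Inr y \<in> orb}"
  have orb_eq: "orb = X <+> Y'"
  proof -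
    have "orb \<subseteq> X <+> Y" unfolding orb_def using \<phi>_in by auto
    moreover have "Inl x \<in> orb" if "x \<in> X" for x
      unfolding orb_def using \<phi>_one[of "Inl x"] that by (force intro!: image_eqI[of _ _ "(\<one>, x)"])
    ultimately show ?thesis unfolding Y'_def by auto
  qed
  have orb_inv: "\<phi> g z \<in> orb" if gz: "g \<in> carrier G" "z \<in> orb" for g z
  proof -
    obtain h x where h: "h \<in> carrier G" "x \<in> X" "z = \<phi> h (Inl x)"
      using gz(2) unfolding orb_def by auto
    then have "\<phi> g z = \<phi> (g \<otimes> h) (Inl x)" using \<phi>_mult[of g h "Inl x"] gz(1) by (simp add: InlI)
    then show ?thesis unfolding orb_def using h gz(1) by (auto intro!: image_eqI[of _ _ "(g \<otimes> h, x)"])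
  qed
  have Y'_sub: "Y' \<subseteq> Y" by (auto simp: Y'_def)
  then have orb_sub: "orb \<subseteq> X <+> Y" unfolding orb_eq by auto
  have orb_bij: "bij_betw (\<phi> g) orb orb" if g: "g \<in> carrier G" for g
  proof -
    have "inj_on (\<phi> g) orb"
      using \<phi>_bij[OF g] orb_sub by (auto simp: bij_betw_def intro: inj_on_subset)
    moreover have "z \<in> \<phi> g ` orb" if z: "z \<in> orb" for z
    proof -
      have "z = \<phi> g (\<phi> (inv g) z)"
        using \<phi>_mult[of g "inv g" z] \<phi>_one[of z] orb_sub g z by (simp add: subsetD)
      then show ?thesis using orb_inv[of "inv g" z] g z by blast
    qed
    ultimately show ?thesis using orb_inv[OF g] by (auto simp: bij_betw_def)
  qed

  have "\<exists>j :: 'b \<Rightarrow> 'g \<times> 'a. inj_on j Y'"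
  proof -
    have "\<forall>y\<in>Y'. \<exists>p. (case p of (g, x) \<Rightarrow> \<phi> g (Inl x)) = Inr y"
      unfolding Y'_def orb_def by force
    then obtain j where j: "\<forall>y\<in>Y'. (case j y of (g, x) \<Rightarrow> \<phi> g (Inl x)) = Inr y"
      by (rule bchoice[THEN exE])
    have "inj_on j Y'" by (rule inj_onI) (metis j sum.inject(2))
    then show ?thesis by blast
  qed
  then obtain j :: "'b \<Rightarrow> 'g \<times> 'a" where j: "inj_on j Y'" by blast
  define Z where "Z = j ` Y'"
  define s where "s = map_sum (\<lambda>x::'a. x) j"
  have s_bij: "bij_betw s orb (X <+> Z)"
  proof -
    have "inj_on s orb"
      unfolding orb_eq s_def by (rule inj_onI) (auto dest: inj_onD[OF j])
    moreover have "s ` orb = X <+> Z"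
    proof (intro equalityI subsetI)
      fix w assume "w \<in> s ` orb"
      then show "w \<in> X <+> Z" unfolding orb_eq by (auto simp: s_def Z_def)
    next
      fix w assume "w \<in> X <+> Z"
      then show "w \<in> s ` orb"
      proof (elim PlusE)
        fix x assume "x \<in> X" "w = Inl x"
        then show ?thesis unfolding orb_eq by (intro image_eqI[of _ _ "Inl x"]) (auto simp: s_def)
      next
        fix p assume "p \<in> Z" "w = Inr p"
        then obtain y where "y \<in> Y'" "w = Inr (j y)" by (auto simp: Z_def)
        then show ?thesis unfolding orb_eq by (intro image_eqI[of _ _ "Inr y"]) (auto simp: s_def)
      qed
    qed
    ultimately show ?thesis by (simp add: bij_betw_def)
  qed
  define t where "t = inv_into orb s"
  have t_bij: "bij_betw t (X <+> Z) orb"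
    unfolding t_def by (rule bij_betw_inv_into[OF s_bij])
  have ts: "t (s z) = z" if "z \<in> orb" for z
    unfolding t_def using s_bij that by (simp add: bij_betw_inv_into_left)
  have st: "s (t w) = w" if "w \<in> X <+> Z" for w
    unfolding t_def using s_bij that by (simp add: bij_betw_inv_into_right)
  have t_in: "t w \<in> orb" if "w \<in> X <+> Z" for w
    using t_bij that by (auto simp: bij_betw_def)
  have s_in: "s z \<in> X <+> Z" if "z \<in> orb" for z
    using s_bij that by (auto simp: bij_betw_def)
  define \<psi> where "\<psi> g = (\<lambda>w\<in>X <+> Z. s (\<phi> g (t w)))" for g
  have \<psi>_bij: "bij_betw (\<psi> g) (X <+> Z) (X <+> Z)" if g: "g \<in> carrier G" for g
  proof -
    have "bij_betw (s \<circ> (\<phi> g \<circ> t)) (X <+> Z) (X <+> Z)"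
      using t_bij orb_bij[OF g] s_bij by (meson bij_betw_trans)
    then show ?thesis
      by (rule bij_betw_cong[THEN iffD1, rotated]) (simp add: \<psi>_def)
  qed
  have \<psi>_Bij: "\<psi> g \<in> Bij (X <+> Z)" if "g \<in> carrier G" for g
    using \<psi>_bij[OF that] by (simp add: Bij_def \<psi>_def)
  have "\<psi> \<in> hom G (BijGroup (X <+> Z))"
  proof (rule homI)
    fix g assume "g \<in> carrier G"
    then show "\<psi> g \<in> carrier (BijGroup (X <+> Z))" using \<psi>_Bij by (simp add: BijGroup_def)
  next
    fix g h assume gh: "g \<in> carrier G" "h \<in> carrier G"
    have "\<psi> (g \<otimes> h) = compose (X <+> Z) (\<psi> g) (\<psi> h)"
    proof (rule extensionalityI[of _ "X <+> Z"])
      fix w assume w: "w \<in> X <+> Z"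
      have "\<phi> (g \<otimes> h) (t w) = \<phi> g (\<phi> h (t w))"
        using \<phi>_mult gh t_in[OF w] orb_sub by blast
      then show "\<psi> (g \<otimes> h) w = compose (X <+> Z) (\<psi> g) (\<psi> h) w"
        using w gh orb_inv t_in s_in ts by (simp add: \<psi>_def compose_def)
    qed (simp_all add: \<psi>_def compose_def)
    then show "\<psi> (g \<otimes> h) = \<psi> g \<otimes>\<^bsub>BijGroup (X <+> Z)\<^esub> \<psi> h"
      using gh \<psi>_Bij by (simp add: BijGroup_def)
  qed
  moreover have "near_class (X <+> Z) (\<psi> g) = near_extend X Z (\<alpha> g)" if g: "g \<in> carrier G" for g
  proof -
    obtain f where f: "f \<in> near_bij X" "\<alpha> g = near_eq X `` {f}"
      using \<alpha> g unfolding near_action_def by (meson hom_in_carrier near_sym_carrierE)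
    have "near_eq (X <+> Y) `` {(\<lambda>z. Some (\<phi> g z)) |` (X <+> Y)} =
        near_eq (X <+> Y) `` {extend_by_id Y f}"
      using cls[OF g] f by (simp add: near_class_def near_extend_class)
    then have "((\<lambda>z. Some (\<phi> g z)) |` (X <+> Y), extend_by_id Y f) \<in> near_eq (X <+> Y)"
      using eq_equiv_class_iff[OF equiv_near_eq near_bij_perm[OF \<phi>_bij[OF g]] near_bij_extend[OF f(1)]]
      by blast
    then have "finite {z\<in>X <+> Y. ((\<lambda>z. Some (\<phi> g z)) |` (X <+> Y)) z \<noteq> extend_by_id Y f z}"
      by (simp add: near_eq_iff)
    moreover have "{z\<in>X <+> Y. ((\<lambda>z. Some (\<phi> g z)) |` (X <+> Y)) z \<noteq> extend_by_id Y f z} =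
        {z\<in>X <+> Y. Some (\<phi> g z) \<noteq> extend_by_id Y f z}"
      by (rule Collect_cong) (simp add: restrict_map_def cong: conj_cong)
    ultimately have fin: "finite {z\<in>X <+> Y. Some (\<phi> g z) \<noteq> extend_by_id Y f z}" (is "finite ?D")
      by simp
    have "{w\<in>X <+> Z. ((\<lambda>w. Some (\<psi> g w)) |` (X <+> Z)) w \<noteq> extend_by_id Z f w} \<subseteq> s ` ?D"
    proof
      fix w assume "w \<in> {w\<in>X <+> Z. ((\<lambda>w. Some (\<psi> g w)) |` (X <+> Z)) w \<noteq> extend_by_id Z f w}"
      then have w: "w \<in> X <+> Z" "Some (\<psi> g w) \<noteq> extend_by_id Z f w"
        by (simp_all add: restrict_map_def cong: conj_cong)
      have tw: "t w \<in> orb" by (rule t_in[OF w(1)])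
      have "Some (\<phi> g (t w)) \<noteq> extend_by_id Y f (t w)"
      proof
        assume eq: "Some (\<phi> g (t w)) = extend_by_id Y f (t w)"
        have "Some (\<psi> g w) = map_option s (extend_by_id Y f (t w))"
          unfolding eq[symmetric] using w(1) by (simp add: \<psi>_def)
        also have "\<dots> = extend_by_id Z f (s (t w))"
        proof (cases "t w")
          case (Inl a)
          then show ?thesis by (simp add: s_def option.map_comp o_def)
        next
          case (Inr b)
          then have "b \<in> Y'" using tw unfolding orb_eq by auto
          then show ?thesis using Inr Y'_sub by (auto simp: s_def Z_def)
        qed
        finally show False using w st by simp
      qed
      then show "w \<in> s ` ?D"
        using tw orb_sub st[OF w(1)] by (intro image_eqI[of _ _ "t w"]) auto
    qed
    then have "finite {w\<in>X <+> Z. ((\<lambda>w. Some (\<psi> g w)) |` (X <+> Z)) w \<noteq> extend_by_id Z f w}"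
      using fin finite_surj by blast
    then have "((\<lambda>w. Some (\<psi> g w)) |` (X <+> Z), extend_by_id Z f) \<in> near_eq (X <+> Z)"
      using near_bij_perm[OF \<psi>_bij[OF g]] near_bij_extend[OF f(1)] by (simp add: near_eq_iff)
    then show ?thesis
      unfolding near_class_def f(2) near_extend_class[OF f(1)]
      by (rule equiv_class_eq[OF equiv_near_eq])
  qed
  ultimately show ?thesis
    unfolding stably_realizable_def realizable_def by blast
qed


section \<open>Piecewise continuous and interval exchange groups of the circle\<close>

definition PC_hat :: "(circle \<Rightarrow> circle) set" where
  "PC_hat = {f. bij f \<and> (\<exists>F. finite F \<and> continuous_on (- F) f)}"

text \<open>
  Subgroups of the quotient of \<open>PC_hat\<close> by the finitely supported permutations are
  represented by their images in the near symmetric group, see \<open>near_class_eq_iff\<close>.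
\<close>

definition PC_bowtie :: "(circle \<rightharpoonup> circle) set set" where
  "PC_bowtie = near_class UNIV ` PC_hat"

definition isometric_at :: "(circle \<Rightarrow> circle) \<Rightarrow> circle \<Rightarrow> bool" where
  "isometric_at f x \<longleftrightarrow> (\<exists>e>0. \<forall>y\<in>ball x e. \<forall>z\<in>ball x e. dist (f y) (f z) = dist y z)"

text \<open>The pieces are the arcs cut out by the finite set \<open>F\<close>.\<close>

definition piecewise_isometric :: "(circle \<Rightarrow> circle) \<Rightarrow> bool" where
  "piecewise_isometric f \<longleftrightarrow> (\<exists>F. finite F \<and> (\<forall>x\<in>- F. isometric_at f x))"

text \<open>A local orientation is read off from a lift \<open>g\<close> of \<open>f\<close> to the real line.\<close>

definition orientation_preserving_at :: "(circle \<Rightarrow> circle) \<Rightarrow> real \<Rightarrow> bool" where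
  "orientation_preserving_at f t \<longleftrightarrow>
     (\<exists>e>0. \<exists>g. continuous_on {t - e<..<t + e} g \<and> strict_mono_on {t - e<..<t + e} g \<and>
        (\<forall>s\<in>{t - e<..<t + e}. f (to_circle s) = to_circle (g s)))"

definition orientation_reversing_at :: "(circle \<Rightarrow> circle) \<Rightarrow> real \<Rightarrow> bool" where
  "orientation_reversing_at f t \<longleftrightarrow>
     (\<exists>e>0. \<exists>g. continuous_on {t - e<..<t + e} g \<and> strict_antimono_on {t - e<..<t + e} g \<and>
        (\<forall>s\<in>{t - e<..<t + e}. f (to_circle s) = to_circle (g s)))"

definition IET_bowtie :: "(circle \<rightharpoonup> circle) set set" where
  "IET_bowtie = near_class UNIV ` {f\<in>PC_hat. piecewise_isometric f}"

definition IET_pm :: "(circle \<rightharpoonup> circle) set set" where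
  "IET_pm = near_class UNIV ` {f\<in>PC_hat. piecewise_isometric f \<and>
     (\<exists>F. finite F \<and>
        ((\<forall>t. to_circle t \<notin> F \<longrightarrow> orientation_preserving_at f t) \<or>
         (\<forall>t. to_circle t \<notin> F \<longrightarrow> orientation_reversing_at f t)))}"

text \<open>
  An element of the quotient has its discontinuities in \<open>\<Lambda>\<close> if some representing permutation
  does: a permutation may have further removable discontinuities, and these can be
  eliminated by a finitely supported modification.
\<close>

definition IET_bowtie_on :: "circle set \<Rightarrow> (circle \<rightharpoonup> circle) set set" where
  "IET_bowtie_on \<Lambda> = near_class UNIV ` {f\<in>PC_hat. piecewise_isometric f \<and>
     {x. \<not> isCont f x} \<subseteq> \<Lambda> \<and>
     (\<exists>F. finite F \<and>
        (\<forall>x\<in>- F. \<exists>e>0. \<exists>l\<in>\<Lambda>. (\<forall>y\<in>ball x e. f y = y + l) \<or> (\<forall>y\<in>ball x e. f y = - y + l)))}"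

definition IET_pm_on :: "circle set \<Rightarrow> (circle \<rightharpoonup> circle) set set" where
  "IET_pm_on \<Lambda> = IET_bowtie_on \<Lambda> \<inter> IET_pm"

lemma PC_bowtie_subset: "PC_bowtie \<subseteq> carrier (near_sym UNIV)"
  unfolding PC_bowtie_def PC_hat_def near_class_def
  by (auto intro!: near_sym_carrierI near_bij_perm)

lemma IET_subsets:
  "IET_bowtie \<subseteq> PC_bowtie" "IET_pm \<subseteq> IET_bowtie" "IET_bowtie_on \<Lambda> \<subseteq> IET_bowtie"
  unfolding IET_bowtie_def IET_pm_def IET_bowtie_on_def PC_bowtie_def by blast+

text \<open>The near action on the circle is the inclusion into the near symmetric group.\<close>

abbreviation stably_realizable_on_circle :: "(circle \<rightharpoonup> circle) set set \<Rightarrow> bool" where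
  "stably_realizable_on_circle H \<equiv>
     stably_realizable (near_sym UNIV\<lparr>carrier := H\<rparr>) UNIV (\<lambda>g. g)"

lemma near_action_inclusion:
  "H \<subseteq> PC_bowtie \<Longrightarrow> near_action (near_sym UNIV\<lparr>carrier := H\<rparr>) UNIV (\<lambda>g. g)"
  using PC_bowtie_subset by (auto simp: near_action_def hom_def)


section \<open>Finite generation and the rational rank\<close>

definition finitely_generated :: "('a, 'm) monoid_scheme \<Rightarrow> 'a set \<Rightarrow> bool" where
  "finitely_generated G H \<longleftrightarrow> (\<exists>S. finite S \<and> S \<subseteq> carrier G \<and> H = generate G S)"

text \<open>
  The tensor product over the integers of an abelian group \<open>A\<close> (written multiplicatively, as
  always in \<open>HOL-Algebra\<close>) with the additive group of the rationals, by generators and relations;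
  \<open>frag_of (a, q)\<close> represents the tensor of \<open>a\<close> and \<open>q\<close>.
\<close>

definition tensor_rat_rel :: "('a, 'm) monoid_scheme \<Rightarrow> ('a \<times> rat \<Rightarrow>\<^sub>0 int) set" where
  "tensor_rat_rel A = generate (free_Abelian_group (carrier A \<times> UNIV))
     ({frag_of (a \<otimes>\<^bsub>A\<^esub> b, q) - frag_of (a, q) - frag_of (b, q) | a b q.
         a \<in> carrier A \<and> b \<in> carrier A} \<union>
      {frag_of (a, q + r) - frag_of (a, q) - frag_of (a, r) | a q r. a \<in> carrier A})"

definition tensor_rat :: "('a, 'm) monoid_scheme \<Rightarrow> ('a \<times> rat \<Rightarrow>\<^sub>0 int) set monoid" where
  "tensor_rat A = free_Abelian_group (carrier A \<times> UNIV) Mod tensor_rat_rel A"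

text \<open>Scalar multiplication by \<open>q\<close> is induced by \<open>(a, r) \<mapsto> (a, q * r)\<close>.\<close>

definition tensor_rat_scale ::
    "('a, 'm) monoid_scheme \<Rightarrow> rat \<Rightarrow> ('a \<times> rat \<Rightarrow>\<^sub>0 int) set \<Rightarrow> ('a \<times> rat \<Rightarrow>\<^sub>0 int) set" where
  "tensor_rat_scale A q C =
     (\<Union>c\<in>C. tensor_rat_rel A #>\<^bsub>free_Abelian_group (carrier A \<times> UNIV)\<^esub>
        frag_extend (\<lambda>(a, r). frag_of (a, q * r)) c)"

definition rat_independent ::
    "('v, 'm) monoid_scheme \<Rightarrow> (rat \<Rightarrow> 'v \<Rightarrow> 'v) \<Rightarrow> 'v set \<Rightarrow> bool" where
  "rat_independent V smul B \<longleftrightarrow> finite B \<and> B \<subseteq> carrier V \<and>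
     (\<forall>c. finprod V (\<lambda>v. smul (c v) v) B = \<one>\<^bsub>V\<^esub> \<longrightarrow> (\<forall>v\<in>B. c v = 0))"

definition rat_dim :: "('v, 'm) monoid_scheme \<Rightarrow> (rat \<Rightarrow> 'v \<Rightarrow> 'v) \<Rightarrow> enat" where
  "rat_dim V smul = (SUP B\<in>{B. rat_independent V smul B}. enat (card B))"

definition Q_rank :: "('a, 'm) monoid_scheme \<Rightarrow> enat" where
  "Q_rank A = rat_dim (tensor_rat A) (tensor_rat_scale A)"

end

theory Submission
  imports Defs
begin

text \<open>
  Let \<open>A\<close> be a group of reals containing \<open>1\<close> and a small irrational \<open>b\<close> such that \<open>Z + bZ\<close> has infinite
  index in \<open>A\<close>. Then \<open>A\<close> acts freely enough, both by rotations on \<open>R/Z\<close> and by rotations on \<open>R/bZ\<close> (the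
  arc \<open>[0,b)\<close> with its ends glued), that a realization on the circle plus \<open>Y\<close> of either near action
  contains a unique exact copy of it: there are equivariant injections \<open>\<sigma>\<close> of \<open>R/Z\<close> and \<open>\<sigma>'\<close> of
  \<open>R/bZ\<close>, equal to the inclusion off finite sets. By uniqueness both intertwine the flip
  \<open>x \<mapsto> b - x\<close>, which has two fixed points on \<open>R/Z\<close>, namely \<open>b/2\<close> and \<open>(b+1)/2\<close>, and two fixed points
  \<open>0\<close> and \<open>b/2\<close> on \<open>R/bZ\<close>. Rotating the circle moves the image of \<open>\<sigma>'\<close> off itself as soon as it moves the
  arc off itself, since the rotations of disjoint arcs commute. This forces the image of \<open>\<sigma>'\<close> into that
  of \<open>\<sigma>\<close>, so \<open>\<sigma> ((b+1)/2)\<close> belongs to it; but \<open>(b+1)/2\<close> is opposite to the arc, and the rotations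
  bringing it into the arc contradict disjointness.
\<close>

section \<open>Rigidity of free near actions\<close>

text \<open>Orientation-preserving interval exchanges are realized exactly by their right-continuous
  representatives, so the obstruction has to come from an orientation-reversing element, which
  exchanges left and right limits. The flip is chosen because it has two representatives:
  \<open>flip b\<close> and \<open>arc_flip b\<close> differ only at 0 and b, hence define the same
  near permutation. A realization therefore uses one bijection for both, and this bijection must act
  as the first on the copy of R/Z and as the second on the copy of R/bZ. Points of \<open>Y\<close>
  may enter either copy, so the copies are compared inside the realization and not on the circle.
  The numbers 1 and b exchange roles: on R/Z the rotation by 1 is trivial and b has infinite order,
  on R/bZ it is the other way round. This is why one abstract locale, with a distinguished element
  \<open>t0\<close>, serves twice. The bound b <= 1/3 makes room for the last step: the angles that
  bring the point opposite to the arc into the arc fill the interval from (1-b)/2 to (1+b)/2, and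
  they must lie in [b, 1-b] to move the arc off itself.\<close>

locale real_subgroup =
  fixes A :: "real set"
  assumes zero_in: "0 \<in> A"
    and diff_in: "s \<in> A \<Longrightarrow> t \<in> A \<Longrightarrow> s - t \<in> A"
begin

lemma uminus_in: "t \<in> A \<Longrightarrow> - t \<in> A"
  using diff_in[OF zero_in] by simp

lemma add_in: "s \<in> A \<Longrightarrow> t \<in> A \<Longrightarrow> s + t \<in> A"
  using diff_in[of s "- t"] uminus_in by simp

lemma nat_mult_in: "t \<in> A \<Longrightarrow> of_nat n * t \<in> A"
  by (induction n) (simp_all add: algebra_simps add_in zero_in)

lemma int_mult_in:
  assumes "t \<in> A"
  shows "of_int n * t \<in> A"
proof (cases n rule: int_cases2)
  case (nonneg m)
  then show ?thesis using nat_mult_in[OF assms, of m] by simp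
next
  case (nonpos m)
  then show ?thesis using uminus_in[OF nat_mult_in[OF assms, of m]] by simp
qed

end

text \<open>
  Here \<open>\<beta>\<close> is a realization on \<open>Z\<close> of the free action \<open>\<alpha>\<close> on \<open>X\<close>, up to the inclusion \<open>\<iota>\<close>.
  Assumption \<open>far\<close> holds when \<open>A\<close> has only infinite orbits on the set of \<open>t0\<close>-orbits; it fails for a
  cyclic group \<open>A\<close>, for which a realization may reconnect half-orbits.
\<close>

locale near_free_action = real_subgroup A for A :: "real set" +
  fixes t0 :: real
    and X :: "'x set" and \<alpha> :: "real \<Rightarrow> 'x \<Rightarrow> 'x"
    and Z :: "'z set" and \<beta> :: "real \<Rightarrow> 'z \<Rightarrow> 'z"
    and \<iota> :: "'x \<Rightarrow> 'z"
  assumes t0: "t0 \<in> A"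
    and \<alpha>_in: "t \<in> A \<Longrightarrow> x \<in> X \<Longrightarrow> \<alpha> t x \<in> X"
    and \<alpha>_zero: "x \<in> X \<Longrightarrow> \<alpha> 0 x = x"
    and \<alpha>_add: "s \<in> A \<Longrightarrow> t \<in> A \<Longrightarrow> x \<in> X \<Longrightarrow> \<alpha> s (\<alpha> t x) = \<alpha> (s + t) x"
    and \<beta>_in: "t \<in> A \<Longrightarrow> z \<in> Z \<Longrightarrow> \<beta> t z \<in> Z"
    and \<beta>_zero: "z \<in> Z \<Longrightarrow> \<beta> 0 z = z"
    and \<beta>_add: "s \<in> A \<Longrightarrow> t \<in> A \<Longrightarrow> z \<in> Z \<Longrightarrow> \<beta> s (\<beta> t z) = \<beta> (s + t) z"
    and \<iota>_in: "x \<in> X \<Longrightarrow> \<iota> x \<in> Z"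
    and inj_\<iota>: "inj_on \<iota> X"
    and near: "t \<in> A \<Longrightarrow> finite {x\<in>X. \<beta> t (\<iota> x) \<noteq> \<iota> (\<alpha> t x)}"
    and free: "x \<in> X \<Longrightarrow> n \<noteq> 0 \<Longrightarrow> \<alpha> (of_int n * t0) x \<noteq> x"
    and far: "finite F \<Longrightarrow> F \<subseteq> X \<Longrightarrow> \<exists>a\<in>A. \<forall>x\<in>F. \<forall>y\<in>F. \<forall>n::int. \<alpha> a x \<noteq> \<alpha> (of_int n * t0) y"
begin

lemmas nat_mult_t0_in = nat_mult_in[OF t0] and int_mult_t0_in = int_mult_in[OF t0]

lemma \<alpha>_inv: "t \<in> A \<Longrightarrow> x \<in> X \<Longrightarrow> \<alpha> (- t) (\<alpha> t x) = x"
  using \<alpha>_add[OF uminus_in] \<alpha>_zero by simp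

lemma \<beta>_inv: "t \<in> A \<Longrightarrow> z \<in> Z \<Longrightarrow> \<beta> (- t) (\<beta> t z) = z"
  using \<beta>_add[OF uminus_in] \<beta>_zero by simp

lemma inj_\<alpha>: "t \<in> A \<Longrightarrow> inj_on (\<alpha> t) X"
  by (rule inj_on_inverseI[of _ "\<alpha> (- t)"]) (rule \<alpha>_inv)

text \<open>By \<open>free\<close> the forward \<open>t0\<close>-orbit is injective in n, so it
  meets a finite set finitely often. All limits below stabilise for this reason.\<close>

lemma eventually_avoid:
  assumes "finite F" "x \<in> X"
  shows "\<forall>\<^sub>F n::nat in sequentially. \<alpha> (of_nat n * t0) x \<notin> F"
proof -
  have "inj (\<lambda>n::nat. \<alpha> (of_nat n * t0) x)"
  proof (rule injI)
    fix m n :: nat assume eq: "\<alpha> (of_nat m * t0) x = \<alpha> (of_nat n * t0) x"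
    have "\<alpha> (of_int (int n - int m) * t0) x = \<alpha> (- (of_nat m * t0)) (\<alpha> (of_nat n * t0) x)"
      using \<alpha>_add[OF uminus_in[OF nat_mult_t0_in] nat_mult_t0_in assms(2)] by (simp add: algebra_simps)
    also have "\<dots> = x" unfolding eq[symmetric] by (rule \<alpha>_inv[OF nat_mult_t0_in assms(2)])
    finally have "int n - int m = 0" using free[OF assms(2)] by metis
    then show "m = n" by simp
  qed
  then have "finite ((\<lambda>n::nat. \<alpha> (of_nat n * t0) x) -` F)"
    using assms(1) by (simp add: finite_vimageI)
  then show ?thesis
    unfolding cofinite_eq_sequentially[symmetric] eventually_cofinite by (simp add: vimage_def)
qed

text \<open>A discrete wave operator, as in scattering theory: move far along the orbit, where the
  two actions agree, include there, and come back by \<beta>.\<close>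

definition approx :: "nat \<Rightarrow> 'x \<Rightarrow> 'z" where
  "approx n x = \<beta> (- (of_nat n * t0)) (\<iota> (\<alpha> (of_nat n * t0) x))"

text \<open>The eventual value of \<open>approx\<close>; the choice is arbitrary where the sequence
  does not stabilise, which by \<open>eventually_\<sigma>\<close> never happens on
  \<open>X\<close>.\<close>

definition \<sigma> :: "'x \<Rightarrow> 'z" where
  "\<sigma> x = (SOME z. \<forall>\<^sub>F n in sequentially. approx n x = z)"

definition bad :: "'x set" where
  "bad = {x\<in>X. \<beta> t0 (\<iota> x) \<noteq> \<iota> (\<alpha> t0 x)}"

lemma finite_bad: "finite bad" "bad \<subseteq> X"
  using near[OF t0] by (auto simp: bad_def)

lemma approx_in: "x \<in> X \<Longrightarrow> approx n x \<in> Z"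
  unfolding approx_def by (intro \<beta>_in uminus_in \<iota>_in \<alpha>_in nat_mult_t0_in)

lemma approx_Suc:
  assumes "x \<in> X" "\<alpha> (of_nat n * t0) x \<notin> bad"
  shows "approx (Suc n) x = approx n x"
proof -
  let ?y = "\<alpha> (of_nat n * t0) x"
  have y: "?y \<in> X" by (rule \<alpha>_in[OF nat_mult_t0_in assms(1)])
  have "\<alpha> (of_nat (Suc n) * t0) x = \<alpha> t0 ?y"
    using \<alpha>_add[OF t0 nat_mult_t0_in assms(1)] by (simp add: algebra_simps)
  then have "approx (Suc n) x = \<beta> (- (of_nat (Suc n) * t0)) (\<beta> t0 (\<iota> ?y))"
    using assms(2) y by (simp add: approx_def bad_def)
  also have "\<dots> = \<beta> (- (of_nat (Suc n) * t0) + t0) (\<iota> ?y)"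
    by (rule \<beta>_add[OF uminus_in[OF nat_mult_t0_in] t0 \<iota>_in[OF y]])
  finally show ?thesis by (simp add: approx_def algebra_simps)
qed

lemma eventually_\<sigma>:
  assumes "x \<in> X"
  shows "\<forall>\<^sub>F n in sequentially. approx n x = \<sigma> x"
proof -
  obtain N where N: "\<And>n. n \<ge> N \<Longrightarrow> \<alpha> (of_nat n * t0) x \<notin> bad"
    using eventually_avoid[OF finite_bad(1) assms] unfolding eventually_sequentially by blast
  have "approx n x = approx N x" if "n \<ge> N" for n
    using that
  proof (induction rule: dec_induct)
    case (step n)
    then show ?case using approx_Suc[OF assms N[OF step(1)]] by simp
  qed (rule refl)
  then have "\<forall>\<^sub>F n in sequentially. approx n x = approx N x"
    unfolding eventually_sequentially by blast
  then show ?thesis unfolding \<sigma>_def by (rule someI)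
qed

lemma \<sigma>_in: "x \<in> X \<Longrightarrow> \<sigma> x \<in> Z"
  using eventually_happens'[OF sequentially_bot eventually_\<sigma>[of x]] approx_in[of x] by metis

text \<open>The limit is taken along \<open>t0\<close> alone, but \<open>t\<close> commutes with it:
  for large n the point has left the finite discrepancy of \<open>t\<close>, which then passes
  through \<iota>.\<close>

lemma \<sigma>_equivariant:
  assumes t: "t \<in> A" and x: "x \<in> X"
  shows "\<beta> t (\<sigma> x) = \<sigma> (\<alpha> t x)"
proof -
  have tx: "\<alpha> t x \<in> X" by (rule \<alpha>_in[OF t x])
  have "\<forall>\<^sub>F n in sequentially. approx n x = \<sigma> x \<and> approx n (\<alpha> t x) = \<sigma> (\<alpha> t x) \<and>
      \<alpha> (of_nat n * t0) x \<notin> {x\<in>X. \<beta> t (\<iota> x) \<noteq> \<iota> (\<alpha> t x)}"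
    by (intro eventually_conj eventually_\<sigma> eventually_avoid near x tx t)
  from eventually_happens'[OF sequentially_bot this]
  obtain n where n: "approx n x = \<sigma> x" "approx n (\<alpha> t x) = \<sigma> (\<alpha> t x)"
      "\<alpha> (of_nat n * t0) x \<notin> {x\<in>X. \<beta> t (\<iota> x) \<noteq> \<iota> (\<alpha> t x)}"
    by (elim exE conjE)
  let ?y = "\<alpha> (of_nat n * t0) x"
  have y: "?y \<in> X" by (rule \<alpha>_in[OF nat_mult_t0_in x])
  have "\<beta> t (\<sigma> x) = \<beta> (- (of_nat n * t0)) (\<beta> t (\<iota> ?y))"
    unfolding n(1)[symmetric] approx_def
    using \<beta>_add[OF t uminus_in[OF nat_mult_t0_in] \<iota>_in[OF y]] \<beta>_add[OF uminus_in[OF nat_mult_t0_in] t \<iota>_in[OF y]]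
    by (simp add: add.commute)
  also have "\<beta> t (\<iota> ?y) = \<iota> (\<alpha> t ?y)" using n(3) y by simp
  also have "\<alpha> t ?y = \<alpha> (of_nat n * t0) (\<alpha> t x)"
    using \<alpha>_add[OF t nat_mult_t0_in x] \<alpha>_add[OF nat_mult_t0_in t x] by (simp add: add.commute)
  finally show ?thesis using n(2) by (simp add: approx_def)
qed

lemma \<sigma>_eq_\<iota>I:
  assumes x: "x \<in> X" and avoid: "\<And>n::nat. \<alpha> (of_nat n * t0) x \<notin> bad"
  shows "\<sigma> x = \<iota> x"
proof -
  have "approx n x = \<iota> x" for n
  proof (induction n)
    case 0
    then show ?case by (simp add: approx_def \<alpha>_zero \<beta>_zero \<iota>_in x)
  qed (simp add: approx_Suc[OF x avoid])
  then show ?thesis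
    using eventually_happens'[OF sequentially_bot eventually_\<sigma>[OF x]] by auto
qed

text \<open>
  The backward \<open>t0\<close>-orbit of a bad point could a priori lie in the discrepancy of \<open>\<sigma>\<close> and \<open>\<iota>\<close>;
  an element \<open>a\<close> which moves all these orbits off the bad ones rules this out.
\<close>

lemma \<sigma>_near: "finite {x\<in>X. \<sigma> x \<noteq> \<iota> x}"
proof -
  obtain a where a: "a \<in> A"
    and far_a: "\<And>x y n. x \<in> bad \<Longrightarrow> y \<in> bad \<Longrightarrow> \<alpha> a x \<noteq> \<alpha> (of_int n * t0) y"
    using far[OF finite_bad] by blast
  \<comment> \<open>The discrepancy of \<sigma> is contained in that of the single element
    \<open>a\<close>, which is finite by \<open>near\<close>.\<close>
  have "\<beta> a (\<iota> x) \<noteq> \<iota> (\<alpha> a x)" if x: "x \<in> X" and ne: "\<sigma> x \<noteq> \<iota> x" for x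
  proof
    assume good: "\<beta> a (\<iota> x) = \<iota> (\<alpha> a x)"
    obtain k :: nat where k: "\<alpha> (of_nat k * t0) x \<in> bad"
      using ne \<sigma>_eq_\<iota>I[OF x] by blast
    have ax: "\<alpha> a x \<in> X" by (rule \<alpha>_in[OF a x])
    have "\<sigma> (\<alpha> a x) = \<iota> (\<alpha> a x)"
    proof (rule \<sigma>_eq_\<iota>I[OF ax])
      fix n :: nat
      show "\<alpha> (of_nat n * t0) (\<alpha> a x) \<notin> bad"
      proof
        let ?w = "\<alpha> (of_nat k * t0) x"
        assume n: "\<alpha> (of_nat n * t0) (\<alpha> a x) \<in> bad"
        \<comment> \<open>If the forward orbits of \<open>x\<close> and of its translate by
          \<open>a\<close> both met \<open>bad\<close>, then \<open>a\<close> would carry one bad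
          point into the \<open>t0\<close>-orbit of another.\<close>
        have "\<alpha> (of_int (int k - int n) * t0) (\<alpha> (of_nat n * t0) (\<alpha> a x)) =
            \<alpha> (of_int (int k - int n) * t0 + (of_nat n * t0 + a)) x"
          by (simp only: \<alpha>_add nat_mult_t0_in int_mult_t0_in a x add_in)
        also have "\<dots> = \<alpha> (a + of_nat k * t0) x"
          by (rule arg_cong[of _ _ "\<lambda>t. \<alpha> t x"]) (simp add: algebra_simps)
        also have "\<dots> = \<alpha> a ?w"
          by (simp only: \<alpha>_add nat_mult_t0_in a x)
        finally show False using far_a[OF k n, of "int k - int n"] by (elim notE) (rule sym)
      qed
    qed
    then have "\<beta> a (\<sigma> x) = \<beta> a (\<iota> x)"
      using \<sigma>_equivariant[OF a x] good by simp
    then have "\<beta> (- a) (\<beta> a (\<sigma> x)) = \<beta> (- a) (\<beta> a (\<iota> x))" by (rule arg_cong)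
    then show False
      unfolding \<beta>_inv[OF a \<sigma>_in[OF x]] \<beta>_inv[OF a \<iota>_in[OF x]] using ne by contradiction
  qed
  then have "{x\<in>X. \<sigma> x \<noteq> \<iota> x} \<subseteq> {x\<in>X. \<beta> a (\<iota> x) \<noteq> \<iota> (\<alpha> a x)}" by blast
  then show ?thesis by (rule finite_subset) (rule near[OF a])
qed

lemma inj_\<sigma>: "inj_on \<sigma> X"
proof (rule inj_onI)
  fix x y assume x: "x \<in> X" and y: "y \<in> X" and eq: "\<sigma> x = \<sigma> y"
  have "\<forall>\<^sub>F n in sequentially. approx n x = \<sigma> x \<and> approx n y = \<sigma> y"
    by (intro eventually_conj eventually_\<sigma> x y)
  from eventually_happens'[OF sequentially_bot this] obtain n where "approx n x = approx n y"
    using eq by metis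
  then have "\<beta> (of_nat n * t0) (approx n x) = \<beta> (of_nat n * t0) (approx n y)" by simp
  then have "\<iota> (\<alpha> (of_nat n * t0) x) = \<iota> (\<alpha> (of_nat n * t0) y)"
    unfolding approx_def
    by (simp add: \<beta>_add nat_mult_t0_in uminus_in \<iota>_in \<alpha>_in x y \<beta>_zero)
  then have "\<alpha> (of_nat n * t0) x = \<alpha> (of_nat n * t0) y"
    by (rule inj_onD[OF inj_\<iota>]) (intro \<alpha>_in nat_mult_t0_in x y)+
  then show "x = y"
    by (rule inj_onD[OF inj_\<alpha>[OF nat_mult_t0_in]]) (fact x y)+
qed

text \<open>This is the uniqueness of the exact copy: far out on the orbit \<sigma> agrees with
  \<iota> at y and at g y, so the identity holds there, and equivariance brings it back to x. The
  sign \<open>e\<close> treats maps commuting with the action (\<open>e = 1\<close>) together with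
  flips inverting it (\<open>e = - 1\<close>).\<close>

lemma \<sigma>_normalizer:
  assumes g_in: "\<And>x. x \<in> X \<Longrightarrow> g x \<in> X" and g_inj: "inj_on g X"
    and g_near: "finite {x\<in>X. h (\<iota> x) \<noteq> \<iota> (g x)}"
    and e: "e \<in> {1, - 1}"
    and g_\<alpha>: "\<And>t x. t \<in> A \<Longrightarrow> x \<in> X \<Longrightarrow> g (\<alpha> t x) = \<alpha> (e * t) (g x)"
    and h_\<beta>: "\<And>t z. t \<in> A \<Longrightarrow> z \<in> Z \<Longrightarrow> h (\<beta> t z) = \<beta> (e * t) (h z)"
    and x: "x \<in> X"
  shows "h (\<sigma> x) = \<sigma> (g x)"
proof -
  let ?D = "{x\<in>X. \<sigma> x \<noteq> \<iota> x}"
  have "finite (g -` ?D \<inter> X)"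
    by (rule finite_vimage_IntI[OF \<sigma>_near g_inj])
  then have "finite (?D \<union> (g -` ?D \<inter> X) \<union> {x\<in>X. h (\<iota> x) \<noteq> \<iota> (g x)})"
    by (intro finite_UnI \<sigma>_near g_near)
  from eventually_happens'[OF sequentially_bot eventually_avoid[OF this x]] obtain n :: nat where
    n: "\<alpha> (of_nat n * t0) x \<notin> ?D \<union> (g -` ?D \<inter> X) \<union> {x\<in>X. h (\<iota> x) \<noteq> \<iota> (g x)}"
    by (rule exE)
  define t y where "t = of_nat n * t0" and "y = \<alpha> t x"
  have t: "t \<in> A" "e * t \<in> A" using e nat_mult_t0_in uminus_in by (auto simp: t_def)
  have y: "y \<in> X" unfolding y_def by (rule \<alpha>_in[OF t(1) x])
  have good: "\<sigma> y = \<iota> y" "\<sigma> (g y) = \<iota> (g y)" "h (\<iota> y) = \<iota> (g y)"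
    using n y g_in[OF y] unfolding y_def t_def by auto
  have "x = \<alpha> (- t) y" unfolding y_def using \<alpha>_inv[OF t(1) x] by simp
  then have "h (\<sigma> x) = h (\<beta> (- t) (\<sigma> y))" "\<sigma> (g x) = \<beta> (e * (- t)) (\<sigma> (g y))"
    using \<sigma>_equivariant[OF uminus_in[OF t(1)] y] g_\<alpha>[OF uminus_in[OF t(1)] y]
      \<sigma>_equivariant[OF uminus_in[OF t(2)] g_in[OF y]] by simp_all
  then show ?thesis
    using h_\<beta>[OF uminus_in[OF t(1)] \<sigma>_in[OF y]] good by simp
qed

end

section \<open>Rotations and flips of the circle\<close>

lemma to_circle_eq_iff: "to_circle x = to_circle y \<longleftrightarrow> x - y \<in> \<int>"
  using Quotient3_rel[OF Quotient3_circle, of x y] by simp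

lemma to_circle_simps [simp]:
  "to_circle x + to_circle y = to_circle (x + y)"
  "to_circle x - to_circle y = to_circle (x - y)"
  "- to_circle x = to_circle (- x)"
  by (simp_all add: plus_circle.abs_eq minus_circle.abs_eq uminus_circle.abs_eq)

lemma to_circle_0 [simp]: "to_circle 0 = 0"
  by (simp add: zero_circle.abs_eq)

lemma to_circle_of_int [simp]: "to_circle (of_int n) = 0"
  unfolding to_circle_0[symmetric] to_circle_eq_iff by simp

lemma to_circle_add_of_int [simp]: "to_circle (x + of_int n) = to_circle x"
  unfolding to_circle_eq_iff by simp

text \<open>\<open>rep_circle\<close> chooses an unspecified real representative; its fractional
  part is the one in [0,1).\<close>

definition coord :: "circle \<Rightarrow> real" where
  "coord x = frac (rep_circle x)"

lemma to_circle_frac [simp]: "to_circle (frac t) = to_circle t"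
  unfolding to_circle_eq_iff by (simp add: frac_def)

lemma to_circle_coord [simp]: "to_circle (coord x) = x"
  unfolding coord_def to_circle_frac by (rule Quotient3_abs_rep[OF Quotient3_circle])

lemma coord_to_circle: "coord (to_circle t) = frac t"
proof -
  have "to_circle (coord (to_circle t)) = to_circle t" by simp
  then show ?thesis
    unfolding to_circle_eq_iff unfolding coord_def frac_unique_iff
    by (metis Ints_minus coord_def frac_ge_0 frac_lt_1 frac_unique_iff minus_diff_eq)
qed

lemma coord_ge_0 [simp]: "0 \<le> coord x" and coord_lt_1 [simp]: "coord x < 1"
  by (simp_all add: coord_def frac_lt_1)

lemma coord_to_circle_eq: "0 \<le> t \<Longrightarrow> t < 1 \<Longrightarrow> coord (to_circle t) = t"
  by (simp add: coord_to_circle frac_eq)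

lemma circle_cases: obtains t where "x = to_circle t" "0 \<le> t" "t < 1"
  using to_circle_coord coord_ge_0 coord_lt_1 by metis

lemma dist_circle_minus: "dist (- x) (- y) = dist x (y :: circle)"
proof (cases x rule: circle_cases, cases y rule: circle_cases)
  fix s t assume "x = to_circle s" "y = to_circle t"
  then have "dist (- x) (- y) = dist y x" by (simp add: dist_circle.abs_eq)
  then show ?thesis by (simp add: dist_commute)
qed

lemma dist_circle_add: "dist (x + z) (y + z) = dist x (y :: circle)"
proof (cases x rule: circle_cases, cases y rule: circle_cases, cases z rule: circle_cases)
  fix r s t assume "x = to_circle r" "y = to_circle s" "z = to_circle t"
  then show ?thesis by (simp add: dist_circle.abs_eq)
qed

lemma ball_to_circle: "ball (to_circle t) e \<subseteq> to_circle ` {t - e<..<t + e}"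
proof
  fix y assume y: "y \<in> ball (to_circle t) e"
  obtain s where s: "y = to_circle s" by (rule circle_cases)
  obtain n :: int where "Z_dist (t - s) = \<bar>t - s - of_int n\<bar>" using Z_dist_attained by blast
  then have "\<bar>t - (s + of_int n)\<bar> < e" using y s by (simp add: dist_circle.abs_eq algebra_simps)
  then have "s + of_int n \<in> {t - e<..<t + e}" by auto
  moreover have "y = to_circle (s + of_int n)" using s by simp
  ultimately show "y \<in> to_circle ` {t - e<..<t + e}" by blast
qed

lemma exists_frac_between:
  fixes b :: real
  assumes b: "b \<notin> \<rat>" and uv: "0 \<le> u" "u < v" "v \<le> 1"
  shows "\<exists>n::nat. n > 0 \<and> frac (of_nat n * b) \<in> {u<..<v}"
proof -
  obtain k where "k > 0" "\<bar>frac (real k * b) - (u + v) / 2\<bar> < (v - u) / 2"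
    using Kronecker_approx_1_explicit[OF b, of "(u + v) / 2" "(v - u) / 2"] uv by auto
  then show ?thesis by (intro exI[of _ k]) (auto simp: field_simps abs_if split: if_splits)
qed

text \<open>Were there finitely many values, density would yield another one between the largest and
  v. Inserting u keeps the maximum defined when there are none.\<close>

lemma infinite_frac_between:
  fixes b :: real
  assumes b: "b \<notin> \<rat>" and uv: "0 \<le> u" "u < v" "v \<le> 1"
  shows "infinite ((\<lambda>n::nat. frac (of_nat n * b)) ` UNIV \<inter> {u<..<v})"
proof
  let ?S = "(\<lambda>n::nat. frac (of_nat n * b)) ` UNIV \<inter> {u<..<v}"
  assume fin: "finite ?S"
  then have "finite (insert u ?S)" by simp
  define w where "w = Max (insert u ?S)"
  have "w < v" "u \<le> w" unfolding w_def using fin uv by auto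
  then obtain n :: nat where n: "frac (of_nat n * b) \<in> {w<..<v}"
    using exists_frac_between[OF b, of w v] uv by auto
  then have "frac (of_nat n * b) \<in> insert u ?S" using \<open>u \<le> w\<close> by auto
  then have "frac (of_nat n * b) \<le> w" unfolding w_def using fin by (intro Max_ge) auto
  then show False using n by auto
qed

definition rot :: "real \<Rightarrow> circle \<Rightarrow> circle" where
  "rot t x = x + to_circle t"

definition init_arc :: "real \<Rightarrow> circle set" where
  "init_arc b = {x. coord x < b}"

text \<open>The rotation by \<open>t\<close> of the circle \<open>R/bZ\<close> obtained by closing up the arc \<open>[0,b)\<close>.\<close>

definition arc_rot :: "real \<Rightarrow> real \<Rightarrow> circle \<Rightarrow> circle" where
  "arc_rot b t x = (if x \<in> init_arc b then to_circle (b * frac ((coord x + t) / b)) else x)"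

definition flip :: "real \<Rightarrow> circle \<Rightarrow> circle" where
  "flip b x = to_circle b - x"

text \<open>
  Near equal to \<open>flip b\<close>, but respecting the arcs \<open>[0,b)\<close> and \<open>[b,1)\<close> exactly; it fixes four
  points, whereas \<open>flip b\<close> fixes two.
\<close>

definition arc_flip :: "real \<Rightarrow> circle \<Rightarrow> circle" where
  "arc_flip b x = (if x = 0 \<or> x = to_circle b then x else flip b x)"

lemma rot_rot: "rot s (rot t x) = rot (s + t) x"
  by (simp add: rot_def add.assoc add.commute)

lemma rot_0 [simp]: "rot 0 x = x"
  by (simp add: rot_def)

lemma flip_flip [simp]: "flip b (flip b x) = x"
  by (simp add: flip_def)

lemma flip_rot: "flip b (rot t x) = rot (- t) (flip b x)"
  by (simp add: flip_def rot_def flip: to_circle_simps(3))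

lemma inj_rot: "inj (rot t)"
  by (rule injI) (simp add: rot_def)

lemma bij_rot: "bij (rot t)"
  by (rule o_bij[of "rot (- t)"]) (simp_all add: fun_eq_iff rot_rot)

lemma bij_flip: "bij (flip b)"
  by (rule o_bij[of "flip b"]) (simp_all add: fun_eq_iff)

locale arc_length =
  fixes b :: real
  assumes b_pos: "0 < b" and b_lt_1: "b < 1"
begin

lemma b_frac: "0 \<le> b * frac v" "b * frac v < b" "b * frac v < 1"
proof -
  show 1: "b * frac v < b" using mult_strict_left_mono[OF frac_lt_1 b_pos] by simp
  show "0 \<le> b * frac v" using b_pos by simp
  show "b * frac v < 1" using 1 b_lt_1 by linarith
qed

lemma arc_rot_in: "arc_rot b t x \<in> init_arc b \<longleftrightarrow> x \<in> init_arc b"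
  by (auto simp: arc_rot_def init_arc_def coord_to_circle_eq b_frac)

lemma coord_arc_rot: "x \<in> init_arc b \<Longrightarrow> coord (arc_rot b t x) = b * frac ((coord x + t) / b)"
  by (simp add: arc_rot_def coord_to_circle_eq b_frac)

lemma arc_rot_outside: "x \<notin> init_arc b \<Longrightarrow> arc_rot b t x = x"
  by (simp add: arc_rot_def)

lemma arc_rot_arc_rot: "arc_rot b s (arc_rot b t x) = arc_rot b (s + t) x"
proof (cases "x \<in> init_arc b")
  case True
  have "(b * frac ((coord x + t) / b) + s) / b = frac ((coord x + t) / b) + s / b"
    using b_pos by (simp add: field_simps)
  then have "frac ((coord (arc_rot b t x) + s) / b) = frac ((coord x + t) / b + s / b)"
    using True by (simp add: coord_arc_rot)
  also have "(coord x + t) / b + s / b = (coord x + (s + t)) / b"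
    using b_pos by (simp add: field_simps)
  finally show ?thesis
    using True arc_rot_in[of t x] by (simp add: arc_rot_def)
qed (simp add: arc_rot_outside)

lemma arc_rot_period: "arc_rot b (of_int n * b) x = x"
proof (cases "x \<in> init_arc b")
  case True
  have "frac ((coord x + of_int n * b) / b) = frac (coord x / b)"
    using b_pos by (simp add: add_divide_distrib)
  also have "\<dots> = coord x / b"
    using True b_pos by (simp add: init_arc_def frac_eq)
  finally show ?thesis using True b_pos by (simp add: arc_rot_def)
qed (simp add: arc_rot_outside)

lemma arc_rot_0 [simp]: "arc_rot b 0 x = x"
  using arc_rot_period[of 0 x] by simp

lemma inj_arc_rot: "inj (arc_rot b t)"
  by (rule inj_on_inverseI[of _ "arc_rot b (- t)"]) (simp add: arc_rot_arc_rot)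

lemma bij_arc_rot: "bij (arc_rot b t)"
  by (rule o_bij[of "arc_rot b (- t)"]) (simp_all add: fun_eq_iff arc_rot_arc_rot)

lemma arc_rot_eqD:
  assumes "arc_rot b s x = arc_rot b t y" "x \<in> init_arc b" "y \<in> init_arc b"
  shows "\<exists>m::int. coord x + s = coord y + t + of_int m * b"
proof -
  have "b * frac ((coord x + s) / b) = b * frac ((coord y + t) / b)"
    using assms by (metis coord_arc_rot)
  then have "frac ((coord x + s) / b) = frac ((coord y + t) / b)"
    using b_pos by simp
  then obtain m :: int where "(coord x + s) / b = (coord y + t) / b + of_int m"
    by (rule frac_eqE)
  then have "b * ((coord x + s) / b) = b * ((coord y + t) / b) + b * of_int m"
    by (metis distrib_left)
  then show ?thesis using b_pos by (intro exI[of _ m]) (simp add: mult.commute)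
qed

lemma arc_flip_to_circle:
  assumes "0 < v" "v < b"
  shows "arc_flip b (to_circle v) = to_circle (b - v)"
proof -
  have "coord (to_circle v) = v" "coord (to_circle b) = b" "coord 0 = 0"
    using assms b_lt_1 coord_to_circle_eq[of 0] by (simp_all add: coord_to_circle_eq)
  then have "to_circle v \<noteq> 0" "to_circle v \<noteq> to_circle b" using assms by auto
  then show ?thesis by (simp add: arc_flip_def flip_def)
qed

lemma zero_in_arc: "0 \<in> init_arc b" and coord_0: "coord 0 = 0"
  using coord_to_circle_eq[of 0] b_pos by (simp_all add: init_arc_def)

lemma arc_flip_0 [simp]: "arc_flip b 0 = 0" by (simp add: arc_flip_def)

text \<open>In the parameter of R/bZ the arc flip is inversion. At 0 inversion gives 0, whereas
  \<open>flip b\<close> gives \<open>to_circle b\<close>, which is outside the arc; this explains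
  the exceptional values of \<open>arc_flip\<close>.\<close>

lemma coord_arc_flip:
  assumes "x \<in> init_arc b"
  shows "coord (arc_flip b x) = b * frac (- coord x / b)"
proof (cases "x = 0")
  case False
  define v where "v = coord x"
  have x: "x = to_circle v" by (simp add: v_def)
  have "v \<noteq> 0" using False x by auto
  then have v: "0 < v" "v < b" using assms less_le[of 0 v] by (simp_all add: v_def init_arc_def)
  have "frac (- v / b) = 1 - v / b"
    using v by (simp add: frac_unique_iff)
  then have "b * frac (- v / b) = b - v" using b_pos by (simp add: field_simps)
  moreover have "coord (arc_flip b x) = b - v"
    unfolding x arc_flip_to_circle[OF v] using v b_lt_1 by (simp add: coord_to_circle_eq)
  ultimately show ?thesis by (simp add: v_def)
qed (simp add: coord_0)

lemma arc_flip_in_arc: "x \<in> init_arc b \<Longrightarrow> arc_flip b x \<in> init_arc b"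
  using coord_arc_flip b_frac by (simp add: init_arc_def)

lemma arc_flip_arc_flip [simp]: "arc_flip b (arc_flip b x) = x"
proof -
  have "flip b x = 0 \<longleftrightarrow> x = to_circle b" "flip b x = to_circle b \<longleftrightarrow> x = 0"
    by (auto simp: flip_def)
  then show ?thesis by (simp add: arc_flip_def)
qed

lemma arc_flip_in_arc_iff: "arc_flip b x \<in> init_arc b \<longleftrightarrow> x \<in> init_arc b"
  using arc_flip_in_arc arc_flip_arc_flip by metis

lemma arc_flip_arc_rot: "arc_flip b (arc_rot b t x) = arc_rot b (- t) (arc_flip b x)"
proof (cases "x \<in> init_arc b")
  case True
  have "coord (arc_flip b (arc_rot b t x)) = b * frac (- frac ((coord x + t) / b))"
    using True coord_arc_flip[of "arc_rot b t x"] b_pos by (simp add: arc_rot_in coord_arc_rot)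
  also have "frac (- frac ((coord x + t) / b)) = frac (- ((coord x + t) / b))"
    by (rule frac_neg_frac)
  also have "- ((coord x + t) / b) = - coord x / b + (- t / b)"
    using b_pos by (simp add: field_simps)
  also have "frac (- coord x / b + (- t / b)) = frac (frac (- coord x / b) + (- t / b))"
    by (rule frac_add_simps(1)[symmetric])
  also have "frac (- coord x / b) + (- t / b) = (b * frac (- coord x / b) + - t) / b"
    using b_pos by (simp add: field_simps)
  also have "b * frac ((b * frac (- coord x / b) + - t) / b) = coord (arc_rot b (- t) (arc_flip b x))"
    using True by (simp add: arc_flip_in_arc coord_arc_rot coord_arc_flip)
  finally show ?thesis by (metis to_circle_coord)
qed (simp add: arc_rot_outside arc_flip_in_arc_iff)

lemma inj_arc_flip: "inj (arc_flip b)"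
  by (rule inj_on_inverseI[of _ "arc_flip b"]) simp

lemma bij_arc_flip: "bij (arc_flip b)"
  by (rule o_bij[of "arc_flip b"]) (simp_all add: fun_eq_iff)

lemma arc_flip_near: "finite {x. arc_flip b x \<noteq> flip b x}"
  by (rule finite_subset[of _ "{0, to_circle b}"]) (auto simp: arc_flip_def)

lemma rot_avoids_arc:
  assumes "frac u \<in> {b..1 - b}" "x \<in> init_arc b"
  shows "rot (- u) x \<notin> init_arc b"
proof -
  \<comment> \<open>As \<open>coord x < b\<close> and \<open>b \<le> frac u\<close>, the difference
    is negative, and adding 1 gives the representative in [b,1).\<close>
  let ?v = "coord x - frac u + 1"
  have v: "b \<le> ?v" "?v < 1"
  proof -
    have "coord x < b" "b \<le> frac u" "frac u \<le> 1 - b" using assms by (simp_all add: init_arc_def)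
    then show "b \<le> ?v" "?v < 1" using coord_ge_0[of x] by linarith+
  qed
  have "rot (- u) x = to_circle (coord x) - to_circle (frac u)"
    by (simp only: rot_def to_circle_coord to_circle_frac) (simp flip: to_circle_simps(3))
  also have "\<dots> = to_circle (coord x - frac u)"
    by (rule to_circle_simps(2))
  also have "\<dots> = to_circle ?v"
    using to_circle_add_of_int[of "coord x - frac u" 1] by simp
  finally have "rot (- u) x = to_circle ?v" .
  then show ?thesis using v b_pos coord_to_circle_eq[of ?v] by (simp add: init_arc_def)
qed

end

section \<open>The obstruction to realizability\<close>

locale real_lattice = real_subgroup +
  assumes one_in: "1 \<in> A"

text \<open>Assumption \<open>infinite_index\<close> says that \<open>Z + bZ\<close> has infinite index in \<open>A\<close>.\<close>

locale rotation_group = real_lattice +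
  fixes b :: real
  assumes b_in: "b \<in> A"
    and b_irrational: "b \<notin> \<rat>" and b_pos: "0 < b" and b_le: "b \<le> 1 / 3"
    and infinite_index: "finite E \<Longrightarrow> \<exists>a\<in>A. \<forall>e\<in>E. \<forall>m n::int. a \<noteq> e + of_int m + of_int n * b"
begin

sublocale arc_length b
  using b_pos b_le by unfold_locales auto

lemma int_combination_eq_0:
  fixes m n :: int
  assumes "of_int m + of_int n * b = 0"
  shows "n = 0"
proof (rule ccontr)
  assume "n \<noteq> 0"
  then have "b = - of_int m / of_int n" using assms by (simp add: field_simps)
  then show False using b_irrational by simp
qed

lemma rot_free:
  assumes "n \<noteq> 0"
  shows "rot (of_int n * b) x \<noteq> x"
proof
  assume "rot (of_int n * b) x = x"
  then have "to_circle (of_int n * b) = to_circle 0" by (simp add: rot_def)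
  then obtain m :: int where "of_int n * b = of_int m"
    unfolding to_circle_eq_iff by (auto elim: Ints_cases)
  then show False using int_combination_eq_0[of "- m" n] assms by simp
qed

text \<open>A coincidence places \<open>a\<close> in the coset of \<open>coord y - coord x\<close>
  modulo Z + bZ, and a finite \<open>F\<close> gives only finitely many such cosets.\<close>

lemma rot_far:
  assumes "finite F"
  shows "\<exists>a\<in>A. \<forall>x\<in>F. \<forall>y\<in>F. \<forall>n::int. rot a x \<noteq> rot (of_int n * b) y"
proof -
  have "finite ((\<lambda>(x, y). coord y - coord x) ` (F \<times> F))" using assms by simp
  from infinite_index[OF this] obtain a where a: "a \<in> A"
    "\<And>x y m n. x \<in> F \<Longrightarrow> y \<in> F \<Longrightarrow> a \<noteq> coord y - coord x + of_int m + of_int n * b"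
    by force
  have "rot a x \<noteq> rot (of_int n * b) y" if "x \<in> F" "y \<in> F" for x y n
  proof
    assume "rot a x = rot (of_int n * b) y"
    then have "to_circle (coord x + a) = to_circle (coord y + of_int n * b)"
      by (simp add: rot_def flip: to_circle_simps(1))
    then obtain m :: int where "coord x + a - (coord y + of_int n * b) = of_int m"
      unfolding to_circle_eq_iff by (auto elim: Ints_cases)
    then show False using a(2)[OF that, of m n] by simp
  qed
  then show ?thesis using a(1) by blast
qed

text \<open>On R/bZ the multiples of b act trivially, so now the integers provide the free cyclic
  group.\<close>

lemma arc_rot_free:
  assumes "n \<noteq> 0" "x \<in> init_arc b"
  shows "arc_rot b (of_int n) x \<noteq> x"
proof
  assume "arc_rot b (of_int n) x = x"
  then have "arc_rot b (of_int n) x = arc_rot b 0 x" by simp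
  then obtain m :: int where "coord x + of_int n = coord x + 0 + of_int m * b"
    using arc_rot_eqD assms(2) by blast
  then show False using int_combination_eq_0[of "- n" m] assms(1) by simp
qed

lemma arc_rot_far:
  assumes "finite F" "F \<subseteq> init_arc b"
  shows "\<exists>a\<in>A. \<forall>x\<in>F. \<forall>y\<in>F. \<forall>n::int. arc_rot b a x \<noteq> arc_rot b (of_int n) y"
proof -
  have "finite ((\<lambda>(x, y). coord y - coord x) ` (F \<times> F))" using assms by simp
  from infinite_index[OF this] obtain a where a: "a \<in> A"
    "\<And>x y m n. x \<in> F \<Longrightarrow> y \<in> F \<Longrightarrow> a \<noteq> coord y - coord x + of_int m + of_int n * b"
    by force
  have "arc_rot b a x \<noteq> arc_rot b (of_int n) y" if xy: "x \<in> F" "y \<in> F" for x y n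
  proof
    assume "arc_rot b a x = arc_rot b (of_int n) y"
    then obtain m :: int where "coord x + a = coord y + of_int n + of_int m * b"
      using arc_rot_eqD[of a x "of_int n" y] assms(2) xy by blast
    then show False using a(2)[OF xy, of n m] by simp
  qed
  then show ?thesis using a(1) by blast
qed

end

text \<open>A realization read on permutations instead of near classes: \<open>K\<close> collects
  permutations whose classes lie in the group. Since \<psi> factors through the class
  (\<open>\<psi>_cong\<close>), it cannot distinguish \<open>flip b\<close> from
  \<open>arc_flip b\<close>; \<open>near_rest\<close> expresses the near triviality on the added
  points.\<close>

locale near_realization = rotation_group +
  fixes K :: "(circle \<Rightarrow> circle) set"
    and Z :: "'z set" and \<iota> :: "circle \<Rightarrow> 'z" and \<psi> :: "(circle \<Rightarrow> circle) \<Rightarrow> 'z \<Rightarrow> 'z"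
  assumes rot_K: "t \<in> A \<Longrightarrow> rot t \<in> K" and arc_rot_K: "t \<in> A \<Longrightarrow> arc_rot b t \<in> K"
    and flip_K: "flip b \<in> K" and arc_flip_K: "arc_flip b \<in> K"
    and comp_K: "f \<in> K \<Longrightarrow> g \<in> K \<Longrightarrow> f \<circ> g \<in> K"
    and inj_\<iota>: "inj \<iota>" and \<iota>_in: "\<iota> x \<in> Z"
    and \<psi>_in: "f \<in> K \<Longrightarrow> z \<in> Z \<Longrightarrow> \<psi> f z \<in> Z"
    and \<psi>_id: "z \<in> Z \<Longrightarrow> \<psi> id z = z"
    and \<psi>_comp: "f \<in> K \<Longrightarrow> g \<in> K \<Longrightarrow> z \<in> Z \<Longrightarrow> \<psi> (f \<circ> g) z = \<psi> f (\<psi> g z)"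
    and \<psi>_cong: "f \<in> K \<Longrightarrow> g \<in> K \<Longrightarrow> finite {x. f x \<noteq> g x} \<Longrightarrow> z \<in> Z \<Longrightarrow> \<psi> f z = \<psi> g z"
    and near_\<iota>: "f \<in> K \<Longrightarrow> finite {x. \<psi> f (\<iota> x) \<noteq> \<iota> (f x)}"
    and near_rest: "f \<in> K \<Longrightarrow> finite {z\<in>Z. z \<notin> range \<iota> \<and> \<psi> f z \<noteq> z}"
begin

lemma \<psi>_compI:
  assumes "f \<in> K" "g \<in> K" "z \<in> Z" "\<And>x. f (g x) = h x"
  shows "\<psi> f (\<psi> g z) = \<psi> h z"
proof -
  have "f \<circ> g = h" by (rule ext) (simp add: assms(4))
  then show ?thesis using \<psi>_comp[OF assms(1-3)] by simp
qed

lemma near_\<iota>_on: "f \<in> K \<Longrightarrow> finite {x\<in>X. \<psi> f (\<iota> x) \<noteq> \<iota> (f x)}"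
  by (rule finite_subset[OF _ near_\<iota>]) auto

lemma \<psi>_rot_0: "z \<in> Z \<Longrightarrow> \<psi> (rot 0) z = z"
  and \<psi>_arc_rot_0: "z \<in> Z \<Longrightarrow> \<psi> (arc_rot b 0) z = z"
proof -
  have "rot 0 = id" "arc_rot b 0 = id" by (rule ext, simp)+
  then show "z \<in> Z \<Longrightarrow> \<psi> (rot 0) z = z" "z \<in> Z \<Longrightarrow> \<psi> (arc_rot b 0) z = z"
    by (simp_all add: \<psi>_id)
qed

sublocale S: near_free_action A b UNIV rot Z "\<lambda>t. \<psi> (rot t)" \<iota>
proof (unfold_locales; (intro b_in diff_in UNIV_I rot_0 rot_rot \<psi>_in rot_K \<iota>_in inj_\<iota>
      near_\<iota>_on rot_free \<psi>_rot_0 rot_far; assumption)?)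
  fix s t z assume "s \<in> A" "t \<in> A" "z \<in> Z"
  then show "\<psi> (rot s) (\<psi> (rot t) z) = \<psi> (rot (s + t)) z"
    by (intro \<psi>_compI rot_K rot_rot)
qed

sublocale I: near_free_action A 1 "init_arc b" "arc_rot b" Z "\<lambda>t. \<psi> (arc_rot b t)" \<iota>
proof (unfold_locales; (intro one_in diff_in arc_rot_in[THEN iffD2] arc_rot_0 arc_rot_arc_rot \<psi>_in
      arc_rot_K \<iota>_in near_\<iota>_on \<psi>_arc_rot_0; assumption)?)
  fix s t z assume "s \<in> A" "t \<in> A" "z \<in> Z"
  then show "\<psi> (arc_rot b s) (\<psi> (arc_rot b t) z) = \<psi> (arc_rot b (s + t)) z"
    by (intro \<psi>_compI arc_rot_K arc_rot_arc_rot)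
next
  show "inj_on \<iota> (init_arc b)" using inj_\<iota> by (rule inj_on_subset) simp
next
  fix x n assume "x \<in> init_arc b" "(n::int) \<noteq> 0"
  then show "arc_rot b (of_int n * 1) x \<noteq> x" using arc_rot_free by simp
next
  fix F assume "finite F" "F \<subseteq> init_arc b"
  then show "\<exists>a\<in>A. \<forall>x\<in>F. \<forall>y\<in>F. \<forall>n::int. arc_rot b a x \<noteq> arc_rot b (of_int n * 1) y"
    using arc_rot_far by simp
qed

abbreviation \<sigma> where "\<sigma> \<equiv> S.\<sigma>"
abbreviation \<sigma>' where "\<sigma>' \<equiv> I.\<sigma>"

lemma \<sigma>_flip: "\<psi> (flip b) (\<sigma> x) = \<sigma> (flip b x)"
proof (rule S.\<sigma>_normalizer[where e = "- 1" and g = "flip b" and h = "\<psi> (flip b)"])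
  fix t z assume t: "t \<in> A" and z: "z \<in> Z"
  have "\<psi> (flip b) (\<psi> (rot t) z) = \<psi> (flip b \<circ> rot t) z"
    by (rule \<psi>_compI[OF flip_K rot_K[OF t] z]) simp
  also have "\<dots> = \<psi> (rot (- t)) (\<psi> (flip b) z)"
    by (rule \<psi>_compI[OF rot_K[OF uminus_in[OF t]] flip_K z, symmetric]) (simp add: flip_rot)
  finally show "\<psi> (flip b) (\<psi> (rot t) z) = \<psi> (rot (- 1 * t)) (\<psi> (flip b) z)" by simp
qed (auto simp: flip_rot inj_on_def near_\<iota>[OF flip_K] dest: arg_cong[of _ _ "flip b"])

text \<open>Only \<open>arc_flip b\<close> preserves the arc and inverts the arc rotations without
  exception, so the normalizer argument is run for it; near equality then transfers the result to
  \<open>flip b\<close>.\<close>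

lemma \<sigma>'_flip:
  assumes "x \<in> init_arc b"
  shows "\<psi> (flip b) (\<sigma>' x) = \<sigma>' (arc_flip b x)"
proof -
  have "\<psi> (arc_flip b) (\<sigma>' x) = \<sigma>' (arc_flip b x)"
  proof (rule I.\<sigma>_normalizer[where e = "- 1" and g = "arc_flip b" and h = "\<psi> (arc_flip b)"])
    fix t z assume t: "t \<in> A" and z: "z \<in> Z"
    have "\<psi> (arc_flip b) (\<psi> (arc_rot b t) z) = \<psi> (arc_flip b \<circ> arc_rot b t) z"
      by (rule \<psi>_compI[OF arc_flip_K arc_rot_K[OF t] z]) simp
    also have "\<dots> = \<psi> (arc_rot b (- t)) (\<psi> (arc_flip b) z)"
      by (rule \<psi>_compI[OF arc_rot_K[OF uminus_in[OF t]] arc_flip_K z, symmetric]) (simp add: arc_flip_arc_rot)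
    finally show "\<psi> (arc_flip b) (\<psi> (arc_rot b t) z) = \<psi> (arc_rot b (- 1 * t)) (\<psi> (arc_flip b) z)"
      by simp
  next
    show "inj_on (arc_flip b) (init_arc b)" using inj_arc_flip by (rule inj_on_subset) simp
  qed (simp_all add: arc_flip_arc_rot arc_flip_in_arc near_\<iota>_on[OF arc_flip_K] assms)
  then show ?thesis
    using \<psi>_cong[OF arc_flip_K flip_K arc_flip_near I.\<sigma>_in[OF assms]] by simp
qed

text \<open>
  The conjugate \<open>g\<close> of \<open>arc_rot b 1\<close> by \<open>rot u\<close> is supported away from the arc, so it fixes
  \<open>\<sigma>'\<close> pointwise, but it moves every point of the translate.
\<close>

lemma translate_disjoint:
  assumes u: "u \<in> A" "frac u \<in> {b..1 - b}" and x: "x \<in> init_arc b" and y: "y \<in> init_arc b"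
  shows "\<psi> (rot u) (\<sigma>' y) \<noteq> \<sigma>' x"
proof
  assume eq: "\<psi> (rot u) (\<sigma>' y) = \<sigma>' x"
  define g where "g = rot u \<circ> arc_rot b 1 \<circ> rot (- u)"
  have K: "rot u \<in> K" "arc_rot b 1 \<in> K" "rot (- u) \<in> K" "g \<in> K"
    unfolding g_def by (intro comp_K rot_K arc_rot_K u uminus_in one_in)+
  have g_arc: "g w = w" if "w \<in> init_arc b" for w
    using rot_avoids_arc[OF u(2) that] by (simp add: g_def arc_rot_outside rot_rot)
  have "inj g" unfolding g_def by (intro inj_compose inj_rot inj_arc_rot)
  then have g_in: "g w \<in> init_arc b \<longleftrightarrow> w \<in> init_arc b" for w
    using g_arc by (metis injD)
  have comm: "g (arc_rot b t w) = arc_rot b t (g w)" for t w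
    by (cases "w \<in> init_arc b") (simp_all add: g_arc arc_rot_in g_in arc_rot_outside)
  have "\<psi> g (\<sigma>' x) = \<sigma>' (g x)"
  proof (rule I.\<sigma>_normalizer[where e = 1 and g = g and h = "\<psi> g"])
    fix t z assume t: "t \<in> A" and z: "z \<in> Z"
    have "\<psi> g (\<psi> (arc_rot b t) z) = \<psi> (g \<circ> arc_rot b t) z"
      by (rule \<psi>_compI[OF K(4) arc_rot_K[OF t] z]) simp
    also have "\<dots> = \<psi> (arc_rot b t) (\<psi> g z)"
      by (rule \<psi>_compI[OF arc_rot_K[OF t] K(4) z, symmetric]) (simp add: comm)
    finally show "\<psi> g (\<psi> (arc_rot b t) z) = \<psi> (arc_rot b (1 * t)) (\<psi> g z)"
      by simp
  next
    show "inj_on g (init_arc b)" using \<open>inj g\<close> by (rule inj_on_subset) simp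
  qed (simp_all add: comm g_in near_\<iota>_on[OF K(4)] x)
  then have fixed: "\<psi> g (\<sigma>' x) = \<sigma>' x" using g_arc[OF x] by simp
  have y_in: "\<sigma>' y \<in> Z" "\<psi> (rot u) (\<sigma>' y) \<in> Z"
    using I.\<sigma>_in[OF y] \<psi>_in[OF K(1)] by blast+
  \<comment> \<open>On the translated copy \<open>g\<close> acts as \<open>arc_rot b 1\<close> does
    on the original one. As \<psi> g fixes the common point, \<open>arc_rot b 1\<close> would have
    to fix \<open>y\<close>.\<close>
  have "\<psi> g (\<psi> (rot u) (\<sigma>' y)) = \<psi> (rot u \<circ> arc_rot b 1) (\<sigma>' y)"
    by (rule \<psi>_compI[OF K(4,1) y_in(1)]) (simp add: g_def rot_rot)
  also have "\<dots> = \<psi> (rot u) (\<psi> (arc_rot b 1) (\<sigma>' y))"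
    by (rule \<psi>_comp[OF K(1,2) y_in(1)])
  also have "\<psi> (arc_rot b 1) (\<sigma>' y) = \<sigma>' (arc_rot b 1 y)"
    by (rule I.\<sigma>_equivariant[OF one_in y])
  finally have "\<psi> (rot u) (\<sigma>' (arc_rot b 1 y)) = \<psi> (rot u) (\<sigma>' y)"
    using fixed eq by simp
  then have "\<psi> (rot (- u)) (\<psi> (rot u) (\<sigma>' (arc_rot b 1 y))) = \<psi> (rot (- u)) (\<psi> (rot u) (\<sigma>' y))"
    by (rule arg_cong)
  then have "\<sigma>' (arc_rot b 1 y) = \<sigma>' y"
    using y y_in(1) I.\<sigma>_in[of "arc_rot b 1 y"] by (simp add: S.\<beta>_inv[OF u(1)] arc_rot_in)
  then have "arc_rot b 1 y = y"
    using inj_onD[OF I.inj_\<sigma>] y arc_rot_in by blast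
  then show False using arc_rot_free[OF _ y, of 1] by simp
qed

text \<open>
  Off the image of \<open>\<sigma>\<close> the rotation by \<open>b\<close> moves only finitely many points, hence has finite
  orbits there, so some power of it which translates the arc off itself has a fixed point.
\<close>

lemma \<sigma>'_in_range:
  assumes x: "x \<in> init_arc b"
  shows "\<sigma>' x \<in> range \<sigma>"
proof (rule ccontr)
  assume notin: "\<sigma>' x \<notin> range \<sigma>"
  define W where "W = {z\<in>Z. z \<notin> range \<sigma>}"
  define T where "T = \<psi> (rot b)"
  have T_inv: "\<psi> (rot (- b)) (T z) = z" if "z \<in> Z" for z
    unfolding T_def by (rule S.\<beta>_inv[OF b_in that])
  have T_W: "T z \<in> W" if "z \<in> W" for z
  proof -
    have "T z \<notin> range \<sigma>"
    proof
      assume "T z \<in> range \<sigma>"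
      then obtain w where "T z = \<sigma> w" by blast
      then have "z = \<sigma> (rot (- b) w)"
        using T_inv[of z] that S.\<sigma>_equivariant[OF uminus_in[OF b_in], of w] by (simp add: W_def)
      then show False using that by (simp add: W_def)
    qed
    then show ?thesis using that \<psi>_in[OF rot_K[OF b_in]] by (simp add: W_def T_def)
  qed
  define M where "M = {z\<in>W. T z \<noteq> z}"
  \<comment> \<open>A moved point outside the range of \<iota> is covered by
    \<open>near_rest\<close>; a point \<open>\<iota> y\<close> missed by \<sigma> has
    \<open>\<sigma> y \<noteq> \<iota> y\<close>.\<close>
  have "M \<subseteq> {z\<in>Z. z \<notin> range \<iota> \<and> T z \<noteq> z} \<union> \<iota> ` {x\<in>UNIV. \<sigma> x \<noteq> \<iota> x}"
  proof
    fix w assume w: "w \<in> M"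
    have "w \<in> \<iota> ` {x\<in>UNIV. \<sigma> x \<noteq> \<iota> x}" if "w = \<iota> y" for y
    proof -
      have "w \<noteq> \<sigma> y" using w by (auto simp: M_def W_def)
      then show ?thesis using that by simp
    qed
    then show "w \<in> {z\<in>Z. z \<notin> range \<iota> \<and> T z \<noteq> z} \<union> \<iota> ` {x\<in>UNIV. \<sigma> x \<noteq> \<iota> x}"
      using w by (auto simp: M_def W_def)
  qed
  then have "finite M"
    by (rule finite_subset) (simp add: S.\<sigma>_near[simplified] near_rest[OF rot_K[OF b_in], folded T_def])
  define z where "z = \<sigma>' x"
  have z: "z \<in> Z" "z \<in> W" using I.\<sigma>_in[OF x] notin by (simp_all add: z_def W_def)
  define c where "c n = \<psi> (rot (of_nat n * b)) z" for n :: nat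
  have c_0: "c 0 = z" using z \<psi>_rot_0 by (simp add: c_def)
  have c_Suc: "c (Suc n) = T (c n)" for n
    using S.\<beta>_add[OF b_in nat_mult_in[OF b_in] z(1), of n] by (simp add: c_def T_def algebra_simps)
  \<comment> \<open>If \<open>T\<close> moves a point, it also moves the image, by injectivity; so
    each new point of the orbit lies in \<open>M\<close>, and the orbit stays put once
    \<open>T\<close> fixes it.\<close>
  have "c n \<in> insert z M" for n
  proof (induction n)
    case (Suc n)
    have "c n \<in> W" using Suc z by (auto simp: M_def)
    show ?case
    proof (cases "T (c n) = c n")
      case False
      have "T (T (c n)) \<noteq> T (c n)"
      proof
        assume "T (T (c n)) = T (c n)"
        then have "\<psi> (rot (- b)) (T (T (c n))) = \<psi> (rot (- b)) (T (c n))" by (rule arg_cong)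
        then show False
          using T_inv False T_W[OF \<open>c n \<in> W\<close>] \<open>c n \<in> W\<close> by (simp add: W_def)
      qed
      then show ?thesis using T_W[OF \<open>c n \<in> W\<close>] by (simp add: M_def c_Suc)
    qed (use Suc in \<open>simp add: c_Suc\<close>)
  qed (simp add: c_0)
  then have "finite (range c)"
    using \<open>finite M\<close> by (meson finite.insertI finite_subset image_subsetI)
  then have "\<not> inj c" using finite_imageD infinite_UNIV_nat by blast
  then obtain m n where "m < n" "c m = c n"
    by (metis injI linorder_neqE_nat)
  define N where "N = n - m"
  have N: "N > 0" "n = m + N" using \<open>m < n\<close> by (simp_all add: N_def)
  define v where "v = of_nat N * b"
  have v: "v \<in> A" "v \<notin> \<rat>"
  proof -
    show "v \<in> A" unfolding v_def by (rule nat_mult_in[OF b_in])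
    show "v \<notin> \<rat>"
    proof
      assume "v \<in> \<rat>"
      then have "v / of_nat N \<in> \<rat>" by simp
      then show False using b_irrational N(1) by (simp add: v_def)
    qed
  qed
  have fix_v: "\<psi> (rot v) z = z"
  proof -
    have "\<psi> (rot (of_nat m * b)) (\<psi> (rot v) z) = \<psi> (rot (of_nat m * b)) z"
      using \<open>c m = c n\<close> S.\<beta>_add[OF nat_mult_in[OF b_in] v(1) z(1), of m]
      by (simp add: c_def N(2) v_def algebra_simps)
    then have "\<psi> (rot (- (of_nat m * b))) (\<psi> (rot (of_nat m * b)) (\<psi> (rot v) z)) =
        \<psi> (rot (- (of_nat m * b))) (\<psi> (rot (of_nat m * b)) z)" by (rule arg_cong)
    then show ?thesis
      using z(1) \<psi>_in[OF rot_K[OF v(1)] z(1)] by (simp add: S.\<beta>_inv[OF nat_mult_in[OF b_in]])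
  qed
  have fix_multiple: "\<psi> (rot (of_nat k * v)) z = z" for k
  proof (induction k)
    case (Suc k)
    have "\<psi> (rot v) (\<psi> (rot (of_nat k * v)) z) = \<psi> (rot (v + of_nat k * v)) z"
      by (rule S.\<beta>_add[OF v(1) nat_mult_in[OF v(1)] z(1)])
    then show ?case using Suc fix_v by (simp add: algebra_simps)
  qed (use \<psi>_rot_0 z in \<open>simp del: rot_0\<close>)
  \<comment> \<open>\<open>v\<close> itself may move the arc only slightly, but being irrational it
    has multiples modulo 1 in the nonempty interval from b to 1 - b.\<close>
  obtain k :: nat where "frac (of_nat k * v) \<in> {b<..<1 - b}"
    using exists_frac_between[OF v(2), of b "1 - b"] b_pos b_le by auto
  then have "\<psi> (rot (of_nat k * v)) (\<sigma>' x) \<noteq> \<sigma>' x"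
    by (intro translate_disjoint nat_mult_in v x) auto
  then show False using fix_multiple by (simp add: z_def)
qed

lemma flip_fixed_points:
  assumes "flip b x = x"
  shows "x = to_circle (b / 2) \<or> x = to_circle ((b + 1) / 2)"
proof -
  have "to_circle (b - coord x) = to_circle (coord x)"
    using assms by (simp add: flip_def flip: to_circle_simps(2))
  then obtain n :: int where n: "b - coord x - coord x = of_int n"
    unfolding to_circle_eq_iff by (auto elim: Ints_cases)
  then have x: "coord x = (b - of_int n) / 2" by simp
  have "of_int n < (1::real)" "of_int n > (-2::real)"
    using n b_pos b_le coord_ge_0[of x] coord_lt_1[of x] by linarith+
  then have "n = 0 \<or> n = - 1" by linarith
  then have "coord x = b / 2 \<or> coord x = (b + 1) / 2" using x by auto
  then show ?thesis by (metis to_circle_coord)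
qed

lemma no_near_realization: False
proof -
  define h where "h = to_circle (b / 2)"
  define p where "p = to_circle ((b + 1) / 2)"
  have h: "h \<in> init_arc b" "arc_flip b h = h" "h \<noteq> 0"
    using b_pos b_lt_1 arc_flip_to_circle[of "b / 2"] coord_to_circle_eq[of "b / 2"] coord_0
    by (auto simp: h_def init_arc_def)
  have fixed: "\<exists>x. \<sigma>' w = \<sigma> x \<and> (x = h \<or> x = p)" if w: "w \<in> init_arc b" "arc_flip b w = w" for w
  proof -
    obtain x where x: "\<sigma>' w = \<sigma> x" using \<sigma>'_in_range[OF w(1)] by blast
    then have "\<sigma> (flip b x) = \<sigma> x" using \<sigma>_flip[of x] \<sigma>'_flip[OF w(1)] w(2) by simp
    then have "flip b x = x" using injD[OF S.inj_\<sigma>] by blast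
    then show ?thesis using flip_fixed_points x by (auto simp: h_def p_def)
  qed
  have "\<sigma>' 0 \<noteq> \<sigma>' h" using inj_onD[OF I.inj_\<sigma>] h zero_in_arc by blast
  \<comment> \<open>The two fixed points 0 and \<open>h\<close> of the arc flip inject into the two
    fixed points \<open>h\<close> and \<open>p\<close> of the flip, so one of them must reach
    \<open>p\<close>.\<close>
  then obtain w where w: "w \<in> init_arc b" "\<sigma>' w = \<sigma> p"
    using fixed[OF zero_in_arc arc_flip_0] fixed[OF h(1,2)] h(1) zero_in_arc by metis
  \<comment> \<open>These are the angles \<open>u\<close> for which (b+1)/2 - u lies strictly
    between 0 and b; multiples of b are used so that \<open>u\<close> belongs to
    \<open>A\<close>.\<close>
  define U where "U = (\<lambda>n::nat. frac (of_nat n * b)) ` UNIV \<inter> {(1 - b) / 2<..<(1 + b) / 2}"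
  have "infinite U"
    unfolding U_def using b_pos b_le by (intro infinite_frac_between b_irrational) auto
  moreover have "inj_on (\<lambda>u. rot (- u) p) U"
  proof (rule inj_onI)
    fix u v assume uv: "u \<in> U" "v \<in> U" "rot (- u) p = rot (- v) p"
    then have "to_circle (- u) = to_circle (- v)" by (simp add: rot_def)
    then have "to_circle u = to_circle v" by (metis to_circle_simps(3) minus_minus)
    then have "frac u = frac v" by (metis coord_to_circle)
    moreover have "frac u = u" "frac v = v" using uv(1,2) by (auto simp: U_def)
    ultimately show "u = v" by simp
  qed
  ultimately have "infinite ((\<lambda>u. rot (- u) p) ` U)" by (metis finite_imageD)
  \<comment> \<open>At such a \<open>q\<close> both copies cannot agree with \<iota>: otherwise
    \<open>rot u\<close> would send the point \<open>\<sigma>' q\<close> to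
    \<open>\<sigma> p\<close>, which is \<open>\<sigma>' w\<close>, against
    \<open>translate_disjoint\<close>.\<close>
  moreover have "(\<lambda>u. rot (- u) p) ` U \<subseteq> {x\<in>UNIV. \<sigma> x \<noteq> \<iota> x} \<union> {x\<in>init_arc b. \<sigma>' x \<noteq> \<iota> x}"
  proof
    fix q assume "q \<in> (\<lambda>u. rot (- u) p) ` U"
    then obtain u where u: "u \<in> U" and q: "q = rot (- u) p" by blast
    obtain n :: nat where n: "u = frac (of_nat n * b)" using u by (auto simp: U_def)
    have u_bounds: "(1 - b) / 2 < u" "u < (1 + b) / 2" using u by (auto simp: U_def)
    have "u = of_nat n * b - of_int \<lfloor>of_nat n * b\<rfloor> * 1" unfolding n by (simp add: frac_def)
    then have "u \<in> A" using diff_in nat_mult_in[OF b_in] int_mult_in[OF one_in] by metis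
    have "q = to_circle ((b + 1) / 2 - u)" by (simp add: q rot_def p_def)
    moreover have "0 \<le> (b + 1) / 2 - u" "(b + 1) / 2 - u < b"
      using u_bounds by (simp_all add: field_simps)
    ultimately have "q \<in> init_arc b"
      using b_lt_1 by (simp add: init_arc_def coord_to_circle_eq)
    have "\<psi> (rot u) (\<sigma> q) = \<sigma> p"
      using S.\<sigma>_equivariant[OF \<open>u \<in> A\<close>, of q] by (simp add: q rot_rot)
    moreover have "frac u \<in> {b..1 - b}" using u_bounds b_pos b_le n by simp
    ultimately have "\<sigma> q \<noteq> \<sigma>' q"
      using translate_disjoint[OF \<open>u \<in> A\<close> _ w(1) \<open>q \<in> init_arc b\<close>] w(2) by auto
    then show "q \<in> {x\<in>UNIV. \<sigma> x \<noteq> \<iota> x} \<union> {x\<in>init_arc b. \<sigma>' x \<noteq> \<iota> x}"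
      using \<open>q \<in> init_arc b\<close> by auto
  qed
  ultimately show False using S.\<sigma>_near I.\<sigma>_near finite_subset by blast
qed

end

section \<open>From stable realizations of near classes to pointwise data\<close>

lemma Bij_UNIV: "bij f \<Longrightarrow> f \<in> Bij UNIV"
  by (simp add: Bij_def)

lemma near_class_comp:
  assumes "bij f" "bij g"
  shows "near_class UNIV (f \<circ> g) = near_class UNIV f \<otimes>\<^bsub>near_sym UNIV\<^esub> near_class UNIV g"
proof -
  have "f \<in> carrier (BijGroup UNIV)" "g \<in> carrier (BijGroup UNIV)"
    using assms by (simp_all add: BijGroup_def Bij_UNIV)
  then have "near_class UNIV (f \<otimes>\<^bsub>BijGroup UNIV\<^esub> g) =
      near_class UNIV f \<otimes>\<^bsub>near_sym UNIV\<^esub> near_class UNIV g"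
    by (rule hom_mult[OF near_class_hom])
  moreover have "f \<otimes>\<^bsub>BijGroup UNIV\<^esub> g = f \<circ> g"
    using assms by (simp add: BijGroup_def Bij_UNIV compose_def fun_eq_iff)
  ultimately show ?thesis by simp
qed

text \<open>Equality of near classes on the disjoint sum is one finite discrepancy set; its traces
  on the two summands are the two finiteness claims.\<close>

lemma realizable_finite_discrepancy:
  fixes f :: "'a \<Rightarrow> 'a" and h :: "'a + 'b \<Rightarrow> 'a + 'b"
  assumes f: "bij f" and h: "bij_betw h (UNIV <+> Y) (UNIV <+> Y)"
    and eq: "near_class (UNIV <+> Y) h = near_extend UNIV Y (near_class UNIV f)"
  shows "finite {x. h (Inl x) \<noteq> Inl (f x)}" and "finite {y\<in>Y. h (Inr y) \<noteq> Inr y}"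
proof -
  let ?Z = "UNIV <+> Y" and ?F = "(\<lambda>x. Some (f x)) |` UNIV"
  let ?D = "{z\<in>?Z. ((\<lambda>z. Some (h z)) |` ?Z) z \<noteq> extend_by_id Y ?F z}"
  have F: "?F \<in> near_bij UNIV" using near_bij_perm[of f UNIV] f by simp
  have "near_eq ?Z `` {(\<lambda>z. Some (h z)) |` ?Z} = near_eq ?Z `` {extend_by_id Y ?F}"
    using eq by (simp add: near_class_def near_extend_class[OF F])
  then have "((\<lambda>z. Some (h z)) |` ?Z, extend_by_id Y ?F) \<in> near_eq ?Z"
    using eq_equiv_class_iff[OF equiv_near_eq near_bij_perm[OF h] near_bij_extend[OF F]] by blast
  then have D: "finite ?D" by (simp add: near_eq_iff)
  have "Inl ` {x. h (Inl x) \<noteq> Inl (f x)} \<subseteq> ?D" by (auto simp: restrict_map_def)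
  then show "finite {x. h (Inl x) \<noteq> Inl (f x)}"
    using finite_imageD[OF finite_subset[OF _ D] inj_on_subset[OF inj_Inl subset_UNIV]] by blast
  have "Inr ` {y\<in>Y. h (Inr y) \<noteq> Inr y} \<subseteq> ?D" by (auto simp: restrict_map_def)
  then show "finite {y\<in>Y. h (Inr y) \<noteq> Inr y}"
    using finite_imageD[OF finite_subset[OF _ D] inj_on_subset[OF inj_Inr subset_UNIV]] by blast
qed

text \<open>\<open>H\<close> is kept general because two groups are fed into it: the full group of
  interval exchanges over \<open>A\<close>, and a finitely generated group inside such a
  group.\<close>

lemma (in rotation_group) not_stably_realizable:
  assumes mult: "\<And>C D. C \<in> H \<Longrightarrow> D \<in> H \<Longrightarrow> C \<otimes>\<^bsub>near_sym UNIV\<^esub> D \<in> H"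
    and rot_H: "\<And>t. t \<in> A \<Longrightarrow> near_class UNIV (rot t) \<in> H"
    and arc_rot_H: "\<And>t. t \<in> A \<Longrightarrow> near_class UNIV (arc_rot b t) \<in> H"
    and flip_H: "near_class UNIV (flip b) \<in> H"
  shows "\<not> stably_realizable_on_circle H"
proof
  assume "stably_realizable_on_circle H"
  then obtain Y :: "((circle \<rightharpoonup> circle) set \<times> circle) set" and \<phi>
    where \<phi>: "\<phi> \<in> hom (near_sym UNIV\<lparr>carrier := H\<rparr>) (BijGroup (UNIV <+> Y))"
      and cls: "\<And>C. C \<in> H \<Longrightarrow> near_class (UNIV <+> Y) (\<phi> C) = near_extend UNIV Y C"
    unfolding stably_realizable_def realizable_def by auto
  let ?Z = "(UNIV :: circle set) <+> Y"
  have \<phi>_Bij: "\<phi> C \<in> Bij ?Z" if "C \<in> H" for C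
    using hom_in_carrier[OF \<phi>, of C] that by (simp add: BijGroup_def)
  have \<phi>_bij: "bij_betw (\<phi> C) ?Z ?Z" if "C \<in> H" for C
    using \<phi>_Bij[OF that] by (simp add: Bij_def)
  have \<phi>_mult: "\<phi> (C \<otimes>\<^bsub>near_sym UNIV\<^esub> D) z = \<phi> C (\<phi> D z)"
    if "C \<in> H" "D \<in> H" "z \<in> ?Z" for C D z
    using hom_mult[OF \<phi>, of C D] that \<phi>_Bij by (simp add: BijGroup_def compose_def)
  have "near_class UNIV (arc_flip b) = near_class UNIV (flip b)"
    using near_class_eq_iff[of "arc_flip b" UNIV "flip b"] bij_flip bij_arc_flip arc_flip_near by simp
  then have arc_flip_H: "near_class UNIV (arc_flip b) \<in> H" using flip_H by simp
  define K where "K = {f. bij f \<and> near_class UNIV f \<in> H}"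
  define \<psi> where "\<psi> f = \<phi> (near_class UNIV f)" for f
  have \<psi>_comp: "\<psi> (f \<circ> g) z = \<psi> f (\<psi> g z)" if "f \<in> K" "g \<in> K" "z \<in> ?Z" for f g z
    using that \<phi>_mult by (simp add: \<psi>_def K_def near_class_comp)
  have id_K: "id \<in> K"
  proof -
    have "rot 0 = id" by (rule ext) simp
    then show ?thesis using rot_H[OF zero_in] by (simp add: K_def)
  qed
  have \<psi>_in: "\<psi> f z \<in> ?Z" if "f \<in> K" "z \<in> ?Z" for f z
    using bij_betw_apply[OF \<phi>_bij] that by (simp add: \<psi>_def K_def)
  interpret near_realization A b K ?Z Inl \<psi>
  proof
    show "rot t \<in> K" if "t \<in> A" for t using rot_H[OF that] bij_rot by (simp add: K_def)
    show "arc_rot b t \<in> K" if "t \<in> A" for t using arc_rot_H[OF that] bij_arc_rot by (simp add: K_def)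
    show "flip b \<in> K" "arc_flip b \<in> K"
      using flip_H bij_flip arc_flip_H bij_arc_flip by (simp_all add: K_def)
    show "f \<circ> g \<in> K" if "f \<in> K" "g \<in> K" for f g
      using that mult[of "near_class UNIV f" "near_class UNIV g"]
      by (simp add: K_def near_class_comp bij_comp)
    show "inj Inl" by simp
    show "Inl x \<in> ?Z" for x by (rule InlI) simp
    show "\<psi> f z \<in> ?Z" if "f \<in> K" "z \<in> ?Z" for f z by (rule \<psi>_in[OF that])
    show "\<psi> id z = z" if z: "z \<in> ?Z" for z
    proof -
      \<comment> \<open>\<open>\<psi> id\<close> is an idempotent injection, hence the
        identity.\<close>
      have eq: "\<psi> id (\<psi> id z) = \<psi> id z" using \<psi>_comp[OF id_K id_K z] by simp
      have "inj_on (\<psi> id) ?Z"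
        using \<phi>_bij id_K by (simp add: \<psi>_def K_def bij_betw_def)
      from inj_on_eq_iff[OF this \<psi>_in[OF id_K z] z] eq show ?thesis by simp
    qed
    show "\<psi> (f \<circ> g) z = \<psi> f (\<psi> g z)" if "f \<in> K" "g \<in> K" "z \<in> ?Z" for f g z
      by (rule \<psi>_comp[OF that])
    show "\<psi> f z = \<psi> g z" if "f \<in> K" "g \<in> K" "finite {x. f x \<noteq> g x}" "z \<in> ?Z" for f g z
      using that near_class_eq_iff[of f UNIV g] by (simp add: \<psi>_def K_def)
    have fin: "finite {x. \<psi> f (Inl x) \<noteq> Inl (f x)}" "finite {y\<in>Y. \<psi> f (Inr y) \<noteq> Inr y}"
      if "f \<in> K" for f
      using realizable_finite_discrepancy[of f "\<psi> f" Y] that \<phi>_bij cls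
      by (simp_all add: \<psi>_def K_def)
    show "finite {x. \<psi> f (Inl x) \<noteq> Inl (f x)}" if "f \<in> K" for f by (rule fin(1)[OF that])
    show "finite {z\<in>?Z. z \<notin> range Inl \<and> \<psi> f z \<noteq> z}" if "f \<in> K" for f
    proof (rule finite_subset)
      show "{z\<in>?Z. z \<notin> range Inl \<and> \<psi> f z \<noteq> z} \<subseteq> Inr ` {y\<in>Y. \<psi> f (Inr y) \<noteq> Inr y}"
        by auto
    qed (use fin(2)[OF that] in simp)
  qed
  show False by (rule no_near_realization)
qed

text \<open>A realization restricts to fewer near classes with the same \<open>Y\<close>.
  Contrapositively, an obstruction in a small group passes to every larger one.\<close>

lemma stably_realizable_on_circle_mono:
  assumes "stably_realizable_on_circle H" "H' \<subseteq> H"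
  shows "stably_realizable_on_circle H'"
proof -
  obtain Y :: "((circle \<rightharpoonup> circle) set \<times> circle) set" and \<phi> where *: "\<phi> \<in> hom (near_sym UNIV\<lparr>carrier := H\<rparr>) (BijGroup (UNIV <+> Y))"
      "\<forall>C\<in>H. near_class (UNIV <+> Y) (\<phi> C) = near_extend UNIV Y C"
    using assms(1) unfolding stably_realizable_def realizable_def by auto
  then have "\<phi> \<in> hom (near_sym UNIV\<lparr>carrier := H'\<rparr>) (BijGroup (UNIV <+> Y))"
    using assms(2) by (auto simp: hom_def subset_iff Pi_iff)
  with * show ?thesis
    using assms(2) unfolding stably_realizable_def realizable_def
    by (intro exI[of _ Y] bexI[of _ \<phi>]) auto
qed

section \<open>Interval exchanges with parameters in a group of reals\<close>

text \<open>The sign \<open>e\<close> is global, which places the map in \<open>IET_pm\<close>. The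
  affine form is demanded at the points of \<open>F\<close> too, so that the map and its inverse
  preserve the image of \<open>A\<close> on the circle; exceptional sets of composites and inverses
  then stay in that image.\<close>

definition affine_off :: "real set \<Rightarrow> real \<Rightarrow> circle set \<Rightarrow> (circle \<Rightarrow> circle) \<Rightarrow> bool" where
  "affine_off A e F f \<longleftrightarrow> bij f \<and> finite F \<and> F \<subseteq> to_circle ` A \<and>
     (\<forall>t. \<exists>l\<in>A. f (to_circle t) = to_circle (e * t + l)) \<and>
     (\<forall>t. to_circle t \<notin> F \<longrightarrow>
        (\<exists>d>0. \<exists>l\<in>A. \<forall>s. \<bar>s - t\<bar> < d \<longrightarrow> f (to_circle s) = to_circle (e * s + l)))"

definition lattice_iet :: "real set \<Rightarrow> (circle \<Rightarrow> circle) set" where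
  "lattice_iet A = {f. \<exists>e\<in>{1, - 1}. \<exists>F. affine_off A e F f}"

lemma affine_offD:
  assumes "affine_off A e F f"
  shows "bij f" "finite F" "F \<subseteq> to_circle ` A"
    "\<exists>l\<in>A. f (to_circle t) = to_circle (e * t + l)"
    "to_circle t \<notin> F \<Longrightarrow>
       \<exists>d>0. \<exists>l\<in>A. \<forall>s. \<bar>s - t\<bar> < d \<longrightarrow> f (to_circle s) = to_circle (e * s + l)"
  using assms unfolding affine_off_def by blast+

lemma dist_to_circle_reflect:
  assumes "e \<in> {1, - 1}"
  shows "dist (to_circle (e * s + l)) (to_circle (e * t + l)) = dist (to_circle s) (to_circle t)"
proof -
  have "dist (to_circle (e * s + l)) (to_circle (e * t + l)) = dist (to_circle (e * s)) (to_circle (e * t))"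
    using dist_circle_add[of "to_circle (e * s)" "to_circle l" "to_circle (e * t)"] by simp
  also have "\<dots> = dist (to_circle s) (to_circle t)"
    using assms dist_circle_minus[of "to_circle s" "to_circle t"] by auto
  finally show ?thesis .
qed

lemma affine_off_local:
  assumes f: "affine_off A e F f" and e: "e \<in> {1, - 1}" and x: "x \<notin> F"
  shows "\<exists>d>0. \<exists>l\<in>A. \<forall>s. to_circle s \<in> ball x d \<longrightarrow> f (to_circle s) = to_circle (e * s + l)"
proof -
  obtain t where t: "x = to_circle t" by (rule circle_cases)
  obtain d l where d: "d > 0" "l \<in> A" "\<And>s. \<bar>s - t\<bar> < d \<Longrightarrow> f (to_circle s) = to_circle (e * s + l)"
    using affine_offD(5)[OF f, of t] x t by blast
  have "f (to_circle s) = to_circle (e * s + l)" if s: "to_circle s \<in> ball x d" for s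
  proof -
    obtain r where r: "r \<in> {t - d<..<t + d}" "to_circle s = to_circle r"
      using s ball_to_circle[of t d] unfolding t by blast
    then have "f (to_circle s) = to_circle (e * r + l)" using d(3)[of r] by (simp add: abs_less_iff)
    moreover have "e * r + l - (e * s + l) \<in> \<int>"
      using r(2) e Ints_minus[of "s - r"] unfolding to_circle_eq_iff by auto
    ultimately show ?thesis using to_circle_eq_iff by metis
  qed
  then show ?thesis using d(1,2) by blast
qed

lemma affine_off_isometric:
  assumes f: "affine_off A e F f" and e: "e \<in> {1, - 1}" and x: "x \<notin> F"
  shows "isometric_at f x"
proof -
  obtain d l where d: "d > 0"
      "\<And>s. to_circle s \<in> ball x d \<Longrightarrow> f (to_circle s) = to_circle (e * s + l)"
    using affine_off_local[OF assms] by blast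
  have "dist (f y) (f z) = dist y z" if "y \<in> ball x d" "z \<in> ball x d" for y z
  proof -
    obtain s t where "y = to_circle s" "z = to_circle t" by (meson circle_cases)
    then show ?thesis using d(2) that dist_to_circle_reflect[OF e] by simp
  qed
  then show ?thesis using d(1) unfolding isometric_at_def by blast
qed

lemma isometric_at_isCont:
  assumes "isometric_at f x"
  shows "isCont f x"
proof -
  obtain d where d: "d > 0" "\<And>y z. y \<in> ball x d \<Longrightarrow> z \<in> ball x d \<Longrightarrow> dist (f y) (f z) = dist y z"
    using assms unfolding isometric_at_def by blast
  show ?thesis
    unfolding continuous_at_eps_delta
  proof (intro allI impI)
    fix r :: real assume r: "r > 0"
    have "dist (f y) (f x) < r" if "dist y x < min d r" for y
      using d(2)[of y x] d(1) that by (simp add: dist_commute)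
    then show "\<exists>d>0. \<forall>y. dist y x < d \<longrightarrow> dist (f y) (f x) < r"
      using d(1) r by (intro exI[of _ "min d r"]) auto
  qed
qed

lemma affine_off_orientation:
  assumes f: "affine_off A e F f" and t: "to_circle t \<notin> F"
  shows "e = 1 \<Longrightarrow> orientation_preserving_at f t" "e = - 1 \<Longrightarrow> orientation_reversing_at f t"
proof -
  obtain d l where d: "d > 0" "\<And>s. \<bar>s - t\<bar> < d \<Longrightarrow> f (to_circle s) = to_circle (e * s + l)"
    using affine_offD(5)[OF f t] by blast
  then have lift: "\<forall>s\<in>{t - d<..<t + d}. f (to_circle s) = to_circle (e * s + l)"
    by (auto simp: abs_less_iff)
  have cont: "continuous_on {t - d<..<t + d} (\<lambda>s. e * s + l)"
    by (intro continuous_intros)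
  show "orientation_preserving_at f t" if e: "e = 1"
    unfolding orientation_preserving_at_def
    by (intro exI[of _ d] exI[of _ "\<lambda>s. e * s + l"] conjI d(1) lift cont)
      (simp add: e strict_mono_on_def)
  show "orientation_reversing_at f t" if e: "e = - 1"
    unfolding orientation_reversing_at_def
    by (intro exI[of _ d] exI[of _ "\<lambda>s. e * s + l"] conjI d(1) lift cont)
      (simp add: e monotone_on_def)
qed

lemma lattice_iet_subset_IET_pm_on:
  assumes A: "to_circle ` A \<subseteq> \<Lambda>"
  shows "near_class UNIV ` lattice_iet A \<subseteq> IET_pm_on \<Lambda>"
proof (rule image_subsetI)
  fix f assume "f \<in> lattice_iet A"
  then obtain e F where e: "e \<in> {1, - 1}" and f: "affine_off A e F f"
    by (auto simp: lattice_iet_def)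
  note iso = affine_off_isometric[OF f e]
  have cont: "isCont f x" if "x \<notin> F" for x
    by (rule isometric_at_isCont[OF iso[OF that]])
  have "continuous_on (- F) f"
    using cont by (auto intro!: continuous_at_imp_continuous_on)
  then have PC: "f \<in> PC_hat"
    using affine_offD(1,2)[OF f] by (auto simp: PC_hat_def)
  have pw: "piecewise_isometric f"
    using iso affine_offD(2)[OF f] unfolding piecewise_isometric_def by blast
  have disc: "{x. \<not> isCont f x} \<subseteq> \<Lambda>"
    using cont affine_offD(3)[OF f] A by blast
  have loc: "\<exists>d>0. \<exists>l\<in>\<Lambda>. (\<forall>y\<in>ball x d. f y = y + l) \<or> (\<forall>y\<in>ball x d. f y = - y + l)"
    if x: "x \<notin> F" for x
  proof -
    obtain d l where d: "d > 0" "l \<in> A"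
        "\<And>s. to_circle s \<in> ball x d \<Longrightarrow> f (to_circle s) = to_circle (e * s + l)"
      using affine_off_local[OF f e x] by blast
    have "f y = to_circle (e * coord y) + to_circle l" if "y \<in> ball x d" for y
      using d(3)[of "coord y"] that by simp
    moreover have "to_circle (e * coord y) = (if e = 1 then y else - y)" for y
      using e by (auto simp flip: to_circle_simps(3))
    ultimately show ?thesis
      using d(1,2) A by (intro exI[of _ d] conjI bexI[of _ "to_circle l"]) auto
  qed
  have or: "(\<forall>t. to_circle t \<notin> F \<longrightarrow> orientation_preserving_at f t) \<or>
      (\<forall>t. to_circle t \<notin> F \<longrightarrow> orientation_reversing_at f t)"
    using affine_off_orientation[OF f] e by auto
  have "near_class UNIV f \<in> IET_bowtie_on \<Lambda>"
    unfolding IET_bowtie_on_def using PC pw disc loc affine_offD(2)[OF f] by blast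
  moreover have "near_class UNIV f \<in> IET_pm"
    unfolding IET_pm_def using PC pw or affine_offD(2)[OF f] by blast
  ultimately show "near_class UNIV f \<in> IET_pm_on \<Lambda>" by (simp add: IET_pm_on_def)
qed

section \<open>Interval exchanges over a group of reals form a group\<close>

context real_lattice
begin

lemma of_int_in: "of_int n \<in> A"
  using int_mult_in[OF one_in, of n] by simp

text \<open>Since \<open>1 \<in> A\<close>, belonging to \<open>A\<close> modulo integers is
  belonging to \<open>A\<close>. This controls the exceptional set of a composite, which involves a
  preimage.\<close>

lemma affine_off_in:
  assumes "affine_off A e F f" "e \<in> {1, - 1}" "f (to_circle t) \<in> to_circle ` A"
  shows "to_circle t \<in> to_circle ` A"
proof -
  obtain l where l: "l \<in> A" "f (to_circle t) = to_circle (e * t + l)"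
    using affine_offD(4)[OF assms(1)] by blast
  obtain m where m: "m \<in> A" "f (to_circle t) = to_circle m" using assms(3) by blast
  obtain n :: int where "e * t + l - m = of_int n"
    using l m unfolding to_circle_eq_iff by (metis Ints_cases to_circle_eq_iff)
  then have "e * t = of_int n + (m - l)" by simp
  then have "e * t \<in> A" using add_in[OF of_int_in diff_in[OF m(1) l(1)]] by simp
  then have "t \<in> A" using assms(2) uminus_in[of "- t"] by auto
  then show ?thesis by blast
qed

lemma affine_off_comp:
  assumes f: "affine_off A e F f" and e: "e \<in> {1, - 1}"
    and g: "affine_off A e' G g" and e': "e' \<in> {1, - 1}"
  shows "affine_off A (e * e') (G \<union> g -` F) (f \<circ> g)"
proof -
  have e_mult: "e * l \<in> A" if "l \<in> A" for l using e uminus_in that by auto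
  have "g -` F \<subseteq> to_circle ` A"
  proof
    fix x assume "x \<in> g -` F"
    moreover obtain t where "x = to_circle t" by (rule circle_cases)
    ultimately show "x \<in> to_circle ` A"
      using affine_off_in[OF g e', of t] affine_offD(3)[OF f] by auto
  qed
  moreover have "\<exists>l\<in>A. (f \<circ> g) (to_circle t) = to_circle (e * e' * t + l)" for t
  proof -
    obtain l where l: "l \<in> A" "g (to_circle t) = to_circle (e' * t + l)"
      using affine_offD(4)[OF g] by blast
    obtain m where m: "m \<in> A" "f (to_circle (e' * t + l)) = to_circle (e * (e' * t + l) + m)"
      using affine_offD(4)[OF f] by blast
    show ?thesis
      using l m by (intro bexI[of _ "e * l + m"] add_in e_mult) (simp_all add: algebra_simps)
  qed
  moreover have "\<exists>d>0. \<exists>l\<in>A. \<forall>s. \<bar>s - t\<bar> < d \<longrightarrow> (f \<circ> g) (to_circle s) = to_circle (e * e' * s + l)"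
    if t: "to_circle t \<notin> G \<union> g -` F" for t
  proof -
    obtain d l where d: "d > 0" "l \<in> A" "\<And>s. \<bar>s - t\<bar> < d \<Longrightarrow> g (to_circle s) = to_circle (e' * s + l)"
      using affine_offD(5)[OF g, of t] t by blast
    have "to_circle (e' * t + l) \<notin> F" using d(1) d(3)[of t] t by auto
    then obtain d' l' where d': "d' > 0" "l' \<in> A"
      "\<And>s. \<bar>s - (e' * t + l)\<bar> < d' \<Longrightarrow> f (to_circle s) = to_circle (e * s + l')"
      using affine_offD(5)[OF f] by blast
    have "(f \<circ> g) (to_circle s) = to_circle (e * e' * s + (e * l + l'))" if s: "\<bar>s - t\<bar> < min d d'" for s
    proof -
      have "\<bar>e' * s + l - (e' * t + l)\<bar> < d'" using s e' by auto
      then show ?thesis using d(3)[of s] d'(3)[of "e' * s + l"] s by (simp add: algebra_simps)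
    qed
    then show ?thesis
      using d d' by (intro exI[of _ "min d d'"] conjI bexI[of _ "e * l + l'"] add_in e_mult) auto
  qed
  moreover have "bij (f \<circ> g)" "finite (G \<union> g -` F)"
    using affine_offD(1,2)[OF f] affine_offD(1,2)[OF g] by (auto simp: bij_comp bij_is_inj finite_vimageI)
  ultimately show ?thesis
    using affine_offD(3)[OF g] unfolding affine_off_def by blast
qed

text \<open>As \<open>e * e = 1\<close>, the inverse of an affine piece has the same sign and
  translation part \<open>- (e * l)\<close>, corrected by the integer by which the lifts
  differ.\<close>

lemma affine_off_inv:
  assumes f: "affine_off A e F f" and e: "e \<in> {1, - 1}"
  shows "affine_off A e (f ` F) (inv_into UNIV f)"
proof -
  have bij: "bij f" by (rule affine_offD(1)[OF f])
  have inv_f: "inv_into UNIV f (f x) = x" for x using bij by (simp add: bij_is_inj)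
  have e_mult: "e * l \<in> A" if "l \<in> A" for l using e uminus_in that by auto
  have e_e: "e * (e * r) = r" "\<bar>e * r\<bar> = \<bar>r\<bar>" for r using e by auto
  have pre: "\<exists>u. to_circle t = f (to_circle u)" for t
    using bij by (metis bij_pointE circle_cases)
  have "f ` F \<subseteq> to_circle ` A"
  proof
    fix y assume "y \<in> f ` F"
    then obtain a where a: "a \<in> A" "y = f (to_circle a)" using affine_offD(3)[OF f] by blast
    obtain l where "l \<in> A" "f (to_circle a) = to_circle (e * a + l)"
      using affine_offD(4)[OF f] by blast
    then show "y \<in> to_circle ` A" using a e_mult add_in by auto
  qed
  moreover have "\<exists>l\<in>A. inv_into UNIV f (to_circle t) = to_circle (e * t + l)" for t
  proof -
    obtain u where u: "to_circle t = f (to_circle u)" using pre by blast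
    obtain l where l: "l \<in> A" "f (to_circle u) = to_circle (e * u + l)"
      using affine_offD(4)[OF f] by blast
    obtain n :: int where n: "t - (e * u + l) = of_int n"
      using u l(2) to_circle_eq_iff by (metis Ints_cases)
    have "u = e * (t - l - of_int n)" using e_e(1)[of u] n by (simp add: algebra_simps)
    then have "u = e * t + - (e * (l + of_int n))" by (simp add: algebra_simps)
    then show ?thesis
      using u inv_f l(1) by (intro bexI[of _ "- (e * (l + of_int n))"] uminus_in e_mult add_in of_int_in) auto
  qed
  moreover have "\<exists>d>0. \<exists>l\<in>A. \<forall>s. \<bar>s - t\<bar> < d \<longrightarrow> inv_into UNIV f (to_circle s) = to_circle (e * s + l)"
    if t: "to_circle t \<notin> f ` F" for t
  proof -
    obtain u where u: "to_circle t = f (to_circle u)" using pre by blast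
    then have "to_circle u \<notin> F" using t by auto
    then obtain d l where d: "d > 0" "l \<in> A"
      "\<And>s. \<bar>s - u\<bar> < d \<Longrightarrow> f (to_circle s) = to_circle (e * s + l)"
      using affine_offD(5)[OF f] by blast
    then have "to_circle t = to_circle (e * u + l)" using u by simp
    then obtain n :: int where n: "t - (e * u + l) = of_int n"
      unfolding to_circle_eq_iff by (auto elim: Ints_cases)
    have "inv_into UNIV f (to_circle s) = to_circle (e * s + - (e * (l + of_int n)))"
      if s: "\<bar>s - t\<bar> < d" for s
    proof -
      define r where "r = e * (s - l - of_int n)"
      have "e * r = s - l - of_int n" unfolding r_def by (rule e_e(1))
      then have "s = e * r + l + of_int n" by simp
      moreover have "r - u = e * (s - t)"
        using e_e(1)[of u] n by (simp add: r_def algebra_simps)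
      then have "\<bar>r - u\<bar> < d" using s e_e(2) by simp
      then have "f (to_circle r) = to_circle (e * r + l)" by (rule d(3))
      ultimately have "f (to_circle r) = to_circle s" by simp
      then have "inv_into UNIV f (to_circle s) = to_circle r" using inv_f by metis
      then show ?thesis by (simp add: r_def algebra_simps)
    qed
    then show ?thesis
      using d(1,2) by (intro exI[of _ d] conjI bexI[of _ "- (e * (l + of_int n))"] uminus_in e_mult
          add_in of_int_in) auto
  qed
  ultimately show ?thesis
    using affine_offD(2)[OF f] bij_imp_bij_inv[OF bij] unfolding affine_off_def by blast
qed

lemma lattice_iet_subgroup: "subgroup (lattice_iet A) (BijGroup UNIV)"
proof (rule group.subgroupI[OF group_BijGroup])
  show "lattice_iet A \<subseteq> carrier (BijGroup UNIV)"
    by (auto simp: lattice_iet_def affine_off_def BijGroup_def Bij_UNIV)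
  have "affine_off A 1 {} id"
    unfolding affine_off_def using zero_in by (auto intro!: exI[of _ 1] bexI[of _ 0])
  then have "id \<in> lattice_iet A" by (auto simp: lattice_iet_def)
  then show "lattice_iet A \<noteq> {}" by blast
next
  fix f assume f: "f \<in> lattice_iet A"
  then have "bij f" by (auto simp: lattice_iet_def affine_off_def)
  then have "inv\<^bsub>BijGroup UNIV\<^esub> f = inv_into UNIV f"
    using inv_BijGroup[OF Bij_UNIV] by (simp add: fun_eq_iff)
  moreover obtain e F where "e \<in> {1, - 1}" "affine_off A e F f"
    using f by (auto simp: lattice_iet_def)
  then have "inv_into UNIV f \<in> lattice_iet A"
    using affine_off_inv unfolding lattice_iet_def by blast
  ultimately show "inv\<^bsub>BijGroup UNIV\<^esub> f \<in> lattice_iet A" by simp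
next
  fix f g assume f: "f \<in> lattice_iet A" and g: "g \<in> lattice_iet A"
  then have "bij f" "bij g" by (auto simp: lattice_iet_def affine_off_def)
  then have "f \<otimes>\<^bsub>BijGroup UNIV\<^esub> g = f \<circ> g"
    by (simp add: BijGroup_def Bij_UNIV compose_def fun_eq_iff)
  moreover have "f \<circ> g \<in> lattice_iet A"
  proof -
    obtain e F e' G where *: "e \<in> {1, - 1}" "affine_off A e F f" "e' \<in> {1, - 1}" "affine_off A e' G g"
      using f g by (auto simp: lattice_iet_def)
    have "e * e' \<in> {1, - 1}" using * by auto
    then show ?thesis using affine_off_comp[OF *(2,1,4,3)] unfolding lattice_iet_def by blast
  qed
  ultimately show "f \<otimes>\<^bsub>BijGroup UNIV\<^esub> g \<in> lattice_iet A" by simp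
qed

lemma near_lattice_iet_subgroup: "subgroup (near_class UNIV ` lattice_iet A) (near_sym UNIV)"
  by (rule group_hom.subgroup_img_is_subgroup[OF _ lattice_iet_subgroup])
    (simp add: group_hom_def group_hom_axioms_def group_BijGroup group_near_sym near_class_hom)

lemma rot_lattice_iet:
  assumes "t \<in> A"
  shows "rot t \<in> lattice_iet A"
proof -
  have "rot t (to_circle s) = to_circle (1 * s + t)" for s by (simp add: rot_def)
  then have "affine_off A 1 {} (rot t)"
    unfolding affine_off_def using assms bij_rot by (auto intro!: exI[of _ 1] bexI[of _ t])
  then show ?thesis by (auto simp: lattice_iet_def)
qed

lemma flip_lattice_iet:
  assumes "t \<in> A"
  shows "flip t \<in> lattice_iet A"
proof -
  have "flip t (to_circle s) = to_circle (- 1 * s + t)" for s by (simp add: flip_def)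
  then have "affine_off A (- 1) {} (flip t)"
    unfolding affine_off_def using assms bij_flip by (auto intro!: exI[of _ 1] bexI[of _ t])
  then show ?thesis by (auto simp: lattice_iet_def)
qed

end

context rotation_group
begin

lemma arc_rot_to_circle:
  assumes "0 \<le> v" "v < b"
  shows "arc_rot b t (to_circle v) = to_circle (v + t - of_int \<lfloor>(v + t) / b\<rfloor> * b)"
proof -
  have "b * frac ((v + t) / b) = v + t - of_int \<lfloor>(v + t) / b\<rfloor> * b"
    using b_pos by (simp add: frac_def right_diff_distrib mult.commute)
  then show ?thesis
    using assms b_lt_1 by (simp add: arc_rot_def init_arc_def coord_to_circle_eq)
qed

lemma arc_rot_lattice_iet:
  assumes t: "t \<in> A"
  shows "arc_rot b t \<in> lattice_iet A"
proof -
  \<comment> \<open>The breakpoints are the two ends of the arc and the point where the rotation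
    wraps around, that is, where (v + t) / b is an integer.\<close>
  define F where "F = {0, to_circle b, to_circle (b * frac (- t / b))}"
  have "frac (- t / b) = - t / b - of_int \<lfloor>- t / b\<rfloor>" by (simp add: frac_def)
  then have "b * frac (- t / b) = - t - of_int \<lfloor>- t / b\<rfloor> * b"
    using b_pos by (simp add: right_diff_distrib mult.commute)
  then have "b * frac (- t / b) \<in> A"
    by (simp only:) (intro diff_in uminus_in int_mult_in b_in t)
  then have "F \<subseteq> to_circle ` A"
    unfolding F_def using zero_in b_in to_circle_0[symmetric] by blast
  have local: "\<exists>d>0. \<exists>l\<in>A. \<forall>s. \<bar>s - v\<bar> < d \<longrightarrow> arc_rot b t (to_circle s) = to_circle (s + l)"
    if v: "0 < v" "v < 1" "to_circle v \<notin> F" for v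
  proof (cases "v < b")
    case True
    define w where "w = (v + t) / b"
    have "w \<notin> \<int>"
    proof
      assume "w \<in> \<int>"
      moreover have "- t / b - v / b = - w" by (simp add: w_def add_divide_distrib)
      ultimately have "- t / b - v / b \<in> \<int>" by (metis Ints_minus)
      then have "frac (- t / b) = v / b"
        using v True by (simp add: frac_unique_iff)
      then show False using v(3) b_pos by (simp add: F_def)
    qed
    then have fr: "0 < frac w" "frac w < 1" by (simp_all add: frac_lt_1)
    \<comment> \<open>The first two terms keep \<open>s\<close> inside the arc, the last two keep (s
      + t) / b in the unit interval of \<open>w\<close>, so that the floor does not change.\<close>
    define d where "d = Min {v, b - v, b * frac w, b * (1 - frac w)}"
    have d: "d > 0" "d \<le> v" "d \<le> b - v" "d \<le> b * frac w" "d \<le> b * (1 - frac w)"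
      unfolding d_def using v True fr b_pos by simp_all
    have "arc_rot b t (to_circle s) = to_circle (s + (t - of_int \<lfloor>w\<rfloor> * b))" if s: "\<bar>s - v\<bar> < d" for s
    proof -
      have "(s + t) / b = w + (s - v) / b" by (simp add: w_def add_divide_distrib diff_divide_distrib)
      moreover have "\<bar>(s - v) / b\<bar> < frac w" "\<bar>(s - v) / b\<bar> < 1 - frac w"
        using s d b_pos by (simp_all add: field_simps)
      ultimately have "\<lfloor>(s + t) / b\<rfloor> = \<lfloor>w\<rfloor>"
        unfolding frac_def by linarith
      moreover have "0 \<le> s" "s < b" using s d by linarith+
      ultimately show ?thesis by (simp add: arc_rot_to_circle algebra_simps)
    qed
    moreover have "t - of_int \<lfloor>w\<rfloor> * b \<in> A" by (intro diff_in int_mult_in t b_in)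
    ultimately show ?thesis using d(1) by blast
  next
    case False
    then have "b < v" using v(3) by (cases "v = b") (auto simp: F_def)
    define d where "d = min (v - b) (1 - v)"
    have "arc_rot b t (to_circle s) = to_circle (s + 0)" if "\<bar>s - v\<bar> < d" for s
    proof -
      have "b < s" "s < 1" using that unfolding d_def by linarith+
      then have "to_circle s \<notin> init_arc b"
        using b_pos by (simp add: init_arc_def coord_to_circle_eq)
      then show ?thesis by (simp add: arc_rot_outside)
    qed
    moreover have "d > 0" using \<open>b < v\<close> v by (simp add: d_def)
    ultimately show ?thesis using zero_in by blast
  qed
  have "affine_off A 1 F (arc_rot b t)"
    unfolding affine_off_def
  proof (intro conjI allI impI)
    show "bij (arc_rot b t)" by (rule bij_arc_rot)
    show "finite F" by (simp add: F_def)
    show "F \<subseteq> to_circle ` A" by fact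
    fix s
    have s: "to_circle s = to_circle (frac s)" by simp
    show "\<exists>l\<in>A. arc_rot b t (to_circle s) = to_circle (1 * s + l)"
    proof (cases "frac s < b")
      case True
      define l where "l = t - of_int \<lfloor>(frac s + t) / b\<rfloor> * b - of_int \<lfloor>s\<rfloor>"
      have "arc_rot b t (to_circle s) = to_circle (1 * s + l)"
        unfolding s arc_rot_to_circle[OF frac_ge_0 True] by (simp add: l_def frac_def algebra_simps)
      moreover have "l \<in> A" unfolding l_def by (intro diff_in int_mult_in of_int_in t b_in)
      ultimately show ?thesis by blast
    next
      case False
      then have "to_circle s \<notin> init_arc b" by (simp add: init_arc_def coord_to_circle)
      then show ?thesis using zero_in by (intro bexI[of _ 0]) (simp_all add: arc_rot_outside)
    qed
    assume nF: "to_circle s \<notin> F"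
    then have "frac s \<noteq> 0" using s by (metis F_def insertI1 to_circle_0)
    then have "0 < frac s" using frac_ge_0[of s] by linarith
    then obtain d l where d: "d > 0" "l \<in> A"
      "\<And>r. \<bar>r - frac s\<bar> < d \<Longrightarrow> arc_rot b t (to_circle r) = to_circle (r + l)"
      using local[OF _ frac_lt_1, of s] nF by auto
    have "arc_rot b t (to_circle r) = to_circle (1 * r + (l - of_int \<lfloor>s\<rfloor>))" if "\<bar>r - s\<bar> < d" for r
    proof -
      have "\<bar>(r - of_int \<lfloor>s\<rfloor>) - frac s\<bar> < d" using that by (simp add: frac_def)
      moreover have "to_circle r = to_circle (r - of_int \<lfloor>s\<rfloor>)" by (simp add: to_circle_eq_iff)
      ultimately show ?thesis using d(3)[of "r - of_int \<lfloor>s\<rfloor>"] by (simp add: algebra_simps)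
    qed
    then show "\<exists>d>0. \<exists>l\<in>A. \<forall>r. \<bar>r - s\<bar> < d \<longrightarrow> arc_rot b t (to_circle r) = to_circle (1 * r + l)"
      using d(1,2) diff_in[OF d(2) of_int_in] by blast
  qed
  then show ?thesis by (auto simp: lattice_iet_def)
qed

lemma lattice_iet_not_stably_realizable:
  "\<not> stably_realizable_on_circle (near_class UNIV ` lattice_iet A)"
proof (rule not_stably_realizable)
  show "C \<otimes>\<^bsub>near_sym UNIV\<^esub> D \<in> near_class UNIV ` lattice_iet A"
    if "C \<in> near_class UNIV ` lattice_iet A" "D \<in> near_class UNIV ` lattice_iet A" for C D
    using subgroup.m_closed[OF near_lattice_iet_subgroup that] .
qed (intro imageI rot_lattice_iet arc_rot_lattice_iet flip_lattice_iet b_in; assumption)+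

end

section \<open>The rational rank\<close>

context comm_group
begin

text \<open>With explicit representatives, an equation in the tensor product becomes membership of a
  difference in \<open>tensor_rat_rel G\<close>, a plain additive statement about formal
  sums.\<close>

definition tclass :: "('a \<times> rat \<Rightarrow>\<^sub>0 int) \<Rightarrow> ('a \<times> rat \<Rightarrow>\<^sub>0 int) set" where
  "tclass x = tensor_rat_rel G #>\<^bsub>free_Abelian_group (carrier G \<times> (UNIV :: rat set))\<^esub> x"

abbreviation pure :: "'a \<Rightarrow> rat \<Rightarrow> 'a \<times> rat \<Rightarrow>\<^sub>0 int" where
  "pure a q \<equiv> frag_of (a, q)"

definition tensor_gens :: "('a \<times> rat \<Rightarrow>\<^sub>0 int) set" where
  "tensor_gens =
     {pure (a \<otimes> b) q - pure a q - pure b q | a b q. a \<in> carrier G \<and> b \<in> carrier G} \<union>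
     {pure a (q + r) - pure a q - pure a r | a q r. a \<in> carrier G}"

lemma tensor_rat_rel_eq:
  "tensor_rat_rel G = generate (free_Abelian_group (carrier G \<times> UNIV)) tensor_gens"
  by (simp add: tensor_rat_rel_def tensor_gens_def)

lemma keys_frag_diff3:
  assumes "x \<in> X" "y \<in> X" "z \<in> X"
  shows "frag_of x - frag_of y - frag_of z \<in> carrier (free_Abelian_group X)"
proof -
  have "Poly_Mapping.keys (frag_of x - frag_of y - frag_of z) \<subseteq>
      Poly_Mapping.keys (frag_of x - frag_of y) \<union> {z}"
    using keys_diff[of "frag_of x - frag_of y" "frag_of z"] by simp
  moreover have "Poly_Mapping.keys (frag_of x - frag_of y) \<subseteq> {x} \<union> {y}"
    using keys_diff[of "frag_of x" "frag_of y"] by simp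
  ultimately show ?thesis using assms unfolding carrier_free_Abelian_group_iff by blast
qed

lemma tensor_gens_subset: "tensor_gens \<subseteq> carrier (free_Abelian_group (carrier G \<times> UNIV))"
proof
  fix x assume "x \<in> tensor_gens"
  then consider a b q where "x = pure (a \<otimes> b) q - pure a q - pure b q" "a \<in> carrier G" "b \<in> carrier G"
    | a q r where "x = pure a (q + r) - pure a q - pure a r" "a \<in> carrier G"
    unfolding tensor_gens_def by blast
  then show "x \<in> carrier (free_Abelian_group (carrier G \<times> UNIV))"
    by cases (simp_all only: keys_frag_diff3 mem_Times_iff fst_conv snd_conv UNIV_I m_closed simp_thms)
qed

lemma tensor_rat_rel_subgroup: "subgroup (tensor_rat_rel G) (free_Abelian_group (carrier G \<times> UNIV))"
  unfolding tensor_rat_rel_eq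
  by (rule group.generate_is_subgroup[OF group_free_Abelian_group tensor_gens_subset])

lemma tensor_rat_rel_keys: "x \<in> tensor_rat_rel G \<Longrightarrow> Poly_Mapping.keys x \<subseteq> carrier G \<times> UNIV"
  by (rule subsetD[OF subgroup.subset[OF tensor_rat_rel_subgroup], unfolded carrier_free_Abelian_group_iff])

lemma rel_0: "0 \<in> tensor_rat_rel G"
  using subgroup.one_closed[OF tensor_rat_rel_subgroup] by simp

lemma rel_add: "x \<in> tensor_rat_rel G \<Longrightarrow> y \<in> tensor_rat_rel G \<Longrightarrow> x + y \<in> tensor_rat_rel G"
  using subgroup.m_closed[OF tensor_rat_rel_subgroup] by simp

lemma rel_uminus: "x \<in> tensor_rat_rel G \<Longrightarrow> - x \<in> tensor_rat_rel G"
  using subgroup.m_inv_closed[OF tensor_rat_rel_subgroup, of x]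
    inv_free_Abelian_group[OF tensor_rat_rel_keys, of x] by simp

lemma rel_diff: "x \<in> tensor_rat_rel G \<Longrightarrow> y \<in> tensor_rat_rel G \<Longrightarrow> x - y \<in> tensor_rat_rel G"
  using rel_add[OF _ rel_uminus, of x y] by simp

lemma tclass_iff: "y \<in> tclass x \<longleftrightarrow> y - x \<in> tensor_rat_rel G"
proof -
  have "y \<in> tclass x \<longleftrightarrow> (\<exists>h\<in>tensor_rat_rel G. y = h + x)"
    unfolding tclass_def r_coset_def by simp
  also have "\<dots> \<longleftrightarrow> y - x \<in> tensor_rat_rel G"
    by (auto intro!: bexI[of _ "y - x"])
  finally show ?thesis .
qed

lemma tclass_eq_iff: "tclass x = tclass y \<longleftrightarrow> x - y \<in> tensor_rat_rel G"
proof
  assume "tclass x = tclass y"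
  then show "x - y \<in> tensor_rat_rel G" using tclass_iff[of x y] tclass_iff[of x x] rel_0 by simp
next
  assume xy: "x - y \<in> tensor_rat_rel G"
  have "z - x \<in> tensor_rat_rel G \<longleftrightarrow> z - y \<in> tensor_rat_rel G" for z
    using rel_add[OF _ xy, of "z - x"] rel_diff[OF _ xy, of "z - y"] by auto
  then show "tclass x = tclass y" by (auto simp: tclass_iff)
qed

lemma carrier_tensor_rat: "carrier (tensor_rat G) = tclass ` {x. Poly_Mapping.keys x \<subseteq> carrier G \<times> UNIV}"
  unfolding tensor_rat_def FactGroup_def RCOSETS_def tclass_def by auto

lemma one_tensor_rat: "\<one>\<^bsub>tensor_rat G\<^esub> = tclass 0"
  unfolding tensor_rat_def FactGroup_def by (auto simp: tclass_iff)

lemma mult_tensor_rat: "tclass x \<otimes>\<^bsub>tensor_rat G\<^esub> tclass y = tclass (x + y)"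
proof -
  have "tclass x \<otimes>\<^bsub>tensor_rat G\<^esub> tclass y = {u + v | u v. u \<in> tclass x \<and> v \<in> tclass y}"
    unfolding tensor_rat_def FactGroup_def set_mult_def by auto
  also have "\<dots> = tclass (x + y)"
  proof (intro Set.set_eqI iffI)
    fix w assume "w \<in> {u + v | u v. u \<in> tclass x \<and> v \<in> tclass y}"
    then obtain u v where "w = u + v" "u - x \<in> tensor_rat_rel G" "v - y \<in> tensor_rat_rel G"
      by (auto simp: tclass_iff)
    then show "w \<in> tclass (x + y)"
      using rel_add[of "u - x" "v - y"] by (simp add: tclass_iff algebra_simps)
  next
    fix w assume "w \<in> tclass (x + y)"
    then have "w - y \<in> tclass x" "y \<in> tclass y"
      using rel_0 by (simp_all add: tclass_iff algebra_simps)
    moreover have "w = (w - y) + y" by simp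
    ultimately show "w \<in> {u + v | u v. u \<in> tclass x \<and> v \<in> tclass y}" by blast
  qed
  finally show ?thesis .
qed

lemma comm_group_tensor_rat: "comm_group (tensor_rat G)"
proof (rule group.group_comm_groupI)
  show "group (tensor_rat G)"
    unfolding tensor_rat_def
    by (intro normal.factorgroup_is_group comm_group.subgroup_imp_normal
        abelian_free_Abelian_group tensor_rat_rel_subgroup)
  show "x \<otimes>\<^bsub>tensor_rat G\<^esub> y = y \<otimes>\<^bsub>tensor_rat G\<^esub> x"
    if "x \<in> carrier (tensor_rat G)" "y \<in> carrier (tensor_rat G)" for x y
    using that unfolding carrier_tensor_rat by (auto simp: mult_tensor_rat add.commute)
qed

lemma rel_mult: "a \<in> carrier G \<Longrightarrow> b \<in> carrier G \<Longrightarrow> pure (a \<otimes> b) q - pure a q - pure b q \<in> tensor_rat_rel G"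
  and rel_plus: "a \<in> carrier G \<Longrightarrow> pure a (q + r) - pure a q - pure a r \<in> tensor_rat_rel G"
  unfolding tensor_rat_rel_eq tensor_gens_def by (blast intro: generate.incl)+

lemma rel_pure_zero: "a \<in> carrier G \<Longrightarrow> pure a 0 \<in> tensor_rat_rel G"
  using rel_uminus[OF rel_plus[of a 0 0]] by simp

lemma rel_pure_one: "pure \<one> q \<in> tensor_rat_rel G"
  using rel_uminus[OF rel_mult[of \<one> \<one> q]] by simp

text \<open>Integers cross the tensor sign. The difference of two consecutive cases is itself a
  relation, so one step serves the induction in both directions.\<close>

lemma rel_int_pow:
  fixes n :: int
  assumes a: "a \<in> carrier G"
  shows "pure (a [^] n) q - pure a (of_int n * q) \<in> tensor_rat_rel G"
proof -
  have step: "pure (a [^] (n + 1)) q - pure a (of_int (n + 1) * q)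
      - (pure (a [^] n) q - pure a (of_int n * q)) \<in> tensor_rat_rel G" for n :: int
  proof -
    have "a [^] (n + 1) = a [^] n \<otimes> a"
      using int_pow_mult[OF a, of n 1] a by simp
    then show ?thesis
      using rel_diff[OF rel_mult[OF int_pow_closed[OF a] a, of n q] rel_plus[OF a, of "of_int n * q" q]]
      by (simp add: algebra_simps)
  qed
  show ?thesis
  proof (induction n rule: int_induct[of _ 0])
    case base
    then show ?case using rel_diff[OF rel_pure_one rel_pure_zero[OF a]] by simp
  next
    case (step1 i)
    then show ?case using rel_add[OF step[of i] step1(2)] by simp
  next
    case (step2 i)
    then show ?case using rel_diff[OF step2(2) step[of "i - 1"]] by simp
  qed
qed

lemma frag_extend_gens:
  assumes "h \<in> tensor_gens"
  shows "frag_extend (\<lambda>(a, r). pure a (q * r)) h \<in> tensor_rat_rel G"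
proof -
  from assms consider a b r where "h = pure (a \<otimes> b) r - pure a r - pure b r" "a \<in> carrier G" "b \<in> carrier G"
    | a r s where "h = pure a (r + s) - pure a r - pure a s" "a \<in> carrier G"
    unfolding tensor_gens_def by blast
  then show ?thesis
    by cases (simp_all add: frag_extend_diff distrib_left rel_mult rel_plus)
qed

text \<open>Scaling carries each defining relation to a defining relation, so scalar multiplication
  is well defined on classes.\<close>

lemma frag_extend_rel:
  assumes "h \<in> tensor_rat_rel G"
  shows "frag_extend (\<lambda>(a, r). pure a (q * r)) h \<in> tensor_rat_rel G"
  using assms unfolding tensor_rat_rel_eq
proof (induction rule: generate.induct)
  case one
  then show ?case by (simp add: rel_0 flip: tensor_rat_rel_eq)
next
  case (incl h)
  then show ?case using frag_extend_gens by (simp flip: tensor_rat_rel_eq)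
next
  case (inv h)
  have "inv\<^bsub>free_Abelian_group (carrier G \<times> UNIV)\<^esub> h = - h"
    using subsetD[OF tensor_gens_subset inv]
    by (intro inv_free_Abelian_group) (simp only: carrier_free_Abelian_group_iff)
  moreover have "frag_extend (\<lambda>(a, r). pure a (q * r)) h \<in> tensor_rat_rel G"
    using inv by (rule frag_extend_gens)
  ultimately show ?case
    using rel_uminus by (simp add: frag_extend_minus flip: tensor_rat_rel_eq)
next
  case (eng h1 h2)
  then show ?case using rel_add by (simp add: frag_extend_add flip: tensor_rat_rel_eq)
qed

lemma tensor_rat_scale_tclass:
  "tensor_rat_scale G q (tclass x) = tclass (frag_extend (\<lambda>(a, r). pure a (q * r)) x)"
proof -
  let ?S = "frag_extend (\<lambda>(a, r). pure a (q * r))"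
  have "tclass (?S c) = tclass (?S x)" if "c \<in> tclass x" for c
    using frag_extend_rel[of "c - x" q] that by (simp add: tclass_iff tclass_eq_iff frag_extend_diff)
  moreover have "x \<in> tclass x" by (simp add: tclass_iff rel_0)
  ultimately have "(\<Union>c\<in>tclass x. tclass (?S c)) = tclass (?S x)" by blast
  then show ?thesis by (simp add: tensor_rat_scale_def tclass_def)
qed

section \<open>Rank of a group whose elements are all commensurable with one element\<close>

context
  fixes b
  assumes b: "b \<in> carrier G"
    and commensurable: "\<And>a. a \<in> carrier G \<Longrightarrow> \<exists>(k::int) (m::int). k \<noteq> 0 \<and> a [^] k = b [^] m"
begin

text \<open>If the k-th power of a is the m-th power of b, then a tensor q equals b tensor (m q /
  k): split q as k times q / k and move the integers across. Hence b tensor 1 spans.\<close>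

lemma tclass_eq_pure:
  assumes "Poly_Mapping.keys x \<subseteq> carrier G \<times> UNIV"
  shows "\<exists>q. tclass x = tclass (pure b q)"
proof (rule free_Abelian_group_induct[OF assms])
  show "\<exists>q. tclass 0 = tclass (pure b q)"
    using rel_uminus[OF rel_pure_zero[OF b]]
    unfolding tclass_eq_iff by (intro exI[of _ 0]) simp
next
  fix x y assume "\<exists>q. tclass x = tclass (pure b q)" "\<exists>q. tclass y = tclass (pure b q)"
  then obtain q r where qr: "x - pure b q \<in> tensor_rat_rel G" "y - pure b r \<in> tensor_rat_rel G"
    unfolding tclass_eq_iff by (elim exE)
  have "(x - pure b q) - (y - pure b r) + (pure b (q - r + r) - pure b (q - r) - pure b r) \<in> tensor_rat_rel G"
    by (rule rel_add[OF rel_diff[OF qr] rel_plus[OF b]])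
  then have "x - y - pure b (q - r) \<in> tensor_rat_rel G" by simp
  then show "\<exists>q. tclass (x - y) = tclass (pure b q)" unfolding tclass_eq_iff by (rule exI)
next
  fix p :: "'a \<times> rat" assume "p \<in> carrier G \<times> UNIV"
  then obtain a q where p: "p = (a, q)" "a \<in> carrier G" by (elim SigmaE)
  from commensurable[OF p(2)] obtain k :: int and m :: int where km: "k \<noteq> 0" "a [^] k = b [^] m"
    by (elim exE conjE)
  define r where "r = q / of_int k"
  have q: "q = of_int k * r" using km(1) by (simp add: r_def)
  have "(pure (b [^] m) r - pure b (of_int m * r)) - (pure (a [^] k) r - pure a (of_int k * r)) \<in> tensor_rat_rel G"
    by (rule rel_diff[OF rel_int_pow[OF b] rel_int_pow[OF p(2)]])
  then have "pure a q - pure b (of_int m * r) \<in> tensor_rat_rel G"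
    unfolding q km(2) by simp
  then show "\<exists>q. tclass (frag_of p) = tclass (pure b q)" unfolding p(1) tclass_eq_iff by (rule exI)
qed

lemma tensor_rat_carrier_pure:
  assumes "v \<in> carrier (tensor_rat G)"
  shows "\<exists>q. v = tclass (pure b q)"
proof -
  obtain x where x: "v = tclass x" "Poly_Mapping.keys x \<subseteq> carrier G \<times> UNIV"
    using assms unfolding carrier_tensor_rat by (elim imageE CollectE)
  show ?thesis unfolding x(1) by (rule tclass_eq_pure[OF x(2)])
qed

lemma finprod_pure:
  assumes "finite B"
  shows "finprod (tensor_rat G) (\<lambda>v. tclass (pure b (g v))) B = tclass (pure b (sum g B))"
proof -
  interpret V: comm_group "tensor_rat G" by (rule comm_group_tensor_rat)
  have in_V: "tclass (pure b q) \<in> carrier (tensor_rat G)" for q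
    using b by (simp add: carrier_tensor_rat)
  show ?thesis
    using assms
  proof (induction B)
    case empty
    then show ?case using rel_uminus[OF rel_pure_zero[OF b]] by (simp add: one_tensor_rat tclass_eq_iff)
  next
    case (insert v B)
    then show ?case
      using rel_uminus[OF rel_plus[OF b, of "g v" "sum g B"]]
      by (simp add: V.finprod_insert in_V mult_tensor_rat tclass_eq_iff algebra_simps)
  qed
qed

lemma rat_independent_pure:
  "rat_independent (tensor_rat G) (tensor_rat_scale G) B \<Longrightarrow> card B \<le> 1"
  "rat_independent (tensor_rat G) (tensor_rat_scale G) B \<Longrightarrow> b = \<one> \<Longrightarrow> B = {}"
proof -
  assume B: "rat_independent (tensor_rat G) (tensor_rat_scale G) B"
  note B' = B[unfolded rat_independent_def]
  have fin: "finite B" and sub: "B \<subseteq> carrier (tensor_rat G)"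
    using B' by simp_all
  have indep: "c v = 0"
    if "finprod (tensor_rat G) (\<lambda>v. tensor_rat_scale G (c v) v) B = \<one>\<^bsub>tensor_rat G\<^esub>" "v \<in> B" for c v
    using B'[THEN conjunct2, THEN conjunct2, rule_format, OF that] .
  interpret V: comm_group "tensor_rat G" by (rule comm_group_tensor_rat)
  have "\<forall>v\<in>B. \<exists>q. v = tclass (pure b q)"
    by (rule ballI, rule tensor_rat_carrier_pure, rule subsetD[OF sub])
  from bchoice[OF this] obtain g where g: "\<And>v. v \<in> B \<Longrightarrow> v = tclass (pure b (g v))" by blast
  have comb: "finprod (tensor_rat G) (\<lambda>v. tensor_rat_scale G (c v) v) B = tclass (pure b (\<Sum>v\<in>B. c v * g v))" for c
  proof -
    have "tensor_rat_scale G (c v) v = tclass (pure b (c v * g v))" if "v \<in> B" for v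
      using tensor_rat_scale_tclass[of "c v" "pure b (g v)"] by (simp flip: g[OF that])
    then have "finprod (tensor_rat G) (\<lambda>v. tensor_rat_scale G (c v) v) B =
        finprod (tensor_rat G) (\<lambda>v. tclass (pure b (c v * g v))) B"
      using b by (intro V.finprod_cong') (auto simp: carrier_tensor_rat)
    then show ?thesis using finprod_pure[OF fin] by simp
  qed
  have vanish: "tclass (pure b 0) = \<one>\<^bsub>tensor_rat G\<^esub>"
    using rel_pure_zero[OF b] by (simp add: one_tensor_rat tclass_eq_iff)
  show "card B \<le> 1"
  proof (rule ccontr)
    assume "\<not> card B \<le> 1"
    then obtain v w where vw: "v \<in> B" "w \<in> B" "v \<noteq> w"
      using card_le_Suc0_iff_eq[OF fin] by auto
    \<comment> \<open>The cross relation of two vectors on a line. Independence makes both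
      coordinates vanish, and then v and w are both the zero vector.\<close>
    define c where "c = (\<lambda>x. if x = v then g w else if x = w then - g v else 0)"
    have "(\<Sum>x\<in>B. c x * g x) = (\<Sum>x\<in>{v, w}. c x * g x)"
      using fin vw by (intro sum.mono_neutral_right) (auto simp: c_def)
    also have "\<dots> = 0" using vw(3) by (simp add: c_def)
    finally have "finprod (tensor_rat G) (\<lambda>v. tensor_rat_scale G (c v) v) B = \<one>\<^bsub>tensor_rat G\<^esub>"
      using comb vanish by simp
    from indep[OF this vw(1)] indep[OF this vw(2)] have "c v = 0" "c w = 0" .
    then have "g v = 0" "g w = 0" using vw(3) by (simp_all add: c_def)
    then show False using g[OF vw(1)] g[OF vw(2)] vw(3) by metis
  qed
  show "B = {}" if "b = \<one>"
  proof (rule ccontr)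
    assume "B \<noteq> {}"
    have "tclass (pure b q) = \<one>\<^bsub>tensor_rat G\<^esub>" for q
      using rel_pure_one that by (simp add: one_tensor_rat tclass_eq_iff)
    then have "finprod (tensor_rat G) (\<lambda>v. tensor_rat_scale G ((\<lambda>_. 1) v) v) B = \<one>\<^bsub>tensor_rat G\<^esub>"
      by (simp only: comb)
    with \<open>B \<noteq> {}\<close> show False using indep[of "\<lambda>_. 1"] by fastforce
  qed
qed

lemma Q_rank_le_1: "Q_rank G \<le> 1"
  unfolding Q_rank_def rat_dim_def
proof (rule SUP_least)
  fix B assume "B \<in> {B. rat_independent (tensor_rat G) (tensor_rat_scale G) B}"
  then show "enat (card B) \<le> 1" using rat_independent_pure(1) by (simp add: one_enat_def)
qed

lemma Q_rank_eq_0: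
  assumes "b = \<one>"
  shows "Q_rank G = 0"
proof -
  have "Q_rank G \<le> 0"
    unfolding Q_rank_def rat_dim_def
  proof (rule SUP_least)
    fix B assume "B \<in> {B. rat_independent (tensor_rat G) (tensor_rat_scale G) B}"
    then have "B = {}" using rat_independent_pure(2)[OF _ assms] by simp
    then show "enat (card B) \<le> 0" by (simp add: zero_enat_def)
  qed
  then show ?thesis by simp
qed

end

end

section \<open>Existence of suitable rotation groups\<close>

text \<open>Pigeonhole: two multiples of a share one of the finitely many cosets of Z + bZ, and
  their difference is a positive multiple of a inside Z + bZ.\<close>

lemma multiples_collide:
  fixes a b :: real
  assumes "finite E" and cover: "\<And>k::nat. \<exists>e\<in>E. \<exists>m n::int. of_nat k * a = e + of_int m + of_int n * b"
  shows "\<exists>k>0. \<exists>m n::int. of_nat k * a = of_int m + of_int n * b"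
proof -
  obtain e :: "nat \<Rightarrow> real" where e_in: "\<And>k. e k \<in> E"
    and e: "\<And>k. \<exists>m n::int. of_nat k * a = e k + of_int m + of_int n * b"
    using cover by metis
  have "finite (range e)"
    by (rule finite_subset[OF _ assms(1)]) (use e_in in auto)
  then have "\<not> inj e" using finite_imageD infinite_UNIV_nat by blast
  then obtain k l where kl: "k < l" "e k = e l" by (metis injI linorder_neqE_nat)
  obtain m n :: int where mn: "of_nat k * a = e k + of_int m + of_int n * b" using e by blast
  obtain m' n' :: int where mn': "of_nat l * a = e l + of_int m' + of_int n' * b" using e by blast
  have "of_nat (l - k) * a = of_nat l * a - of_nat k * a"
    using kl(1) by (simp add: of_nat_diff left_diff_distrib)
  also have "\<dots> = of_int (m' - m) + of_int (n' - n) * b"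
    using mn mn' kl(2) by (simp add: left_diff_distrib)
  finally have "of_nat (l - k) * a = of_int (m' - m) + of_int (n' - n) * b" .
  moreover have "l - k > 0" using kl(1) by simp
  ultimately show ?thesis by blast
qed

lemma circle_group_simps [simp]:
  "carrier circle_group = UNIV" "x \<otimes>\<^bsub>circle_group\<^esub> y = x + y" "\<one>\<^bsub>circle_group\<^esub> = 0"
  by (simp_all add: circle_group_def)

lemma inv_circle_group [simp]: "inv\<^bsub>circle_group\<^esub> x = - x"
  by (rule group.inv_equality[OF comm_group.axioms(2)[OF comm_group_circle_group]]) simp_all

lemma real_lattice_preimage:
  assumes "subgroup \<Lambda> circle_group"
  shows "real_lattice {t. to_circle t \<in> \<Lambda>}"
proof
  show "0 \<in> {t. to_circle t \<in> \<Lambda>}" "1 \<in> {t. to_circle t \<in> \<Lambda>}"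
    using subgroup.one_closed[OF assms] to_circle_of_int[of 1] by simp_all
  show "s - t \<in> {t. to_circle t \<in> \<Lambda>}" if "s \<in> {t. to_circle t \<in> \<Lambda>}" "t \<in> {t. to_circle t \<in> \<Lambda>}" for s t
    using subgroup.m_closed[OF assms, of "to_circle s" "- to_circle t"]
      subgroup.m_inv_closed[OF assms, of "to_circle t"] that by simp
qed

lemma circle_int_pow:
  fixes n :: int
  assumes "subgroup \<Lambda> circle_group" "to_circle t \<in> \<Lambda>"
  shows "to_circle t [^]\<^bsub>circle_group\<lparr>carrier := \<Lambda>\<rparr>\<^esub> n = to_circle (of_int n * t)"
proof -
  interpret L: group "circle_group\<lparr>carrier := \<Lambda>\<rparr>"
    using subgroup.subgroup_is_group[OF assms(1) comm_group.axioms(2)[OF comm_group_circle_group]] .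
  have step: "to_circle t [^]\<^bsub>circle_group\<lparr>carrier := \<Lambda>\<rparr>\<^esub> (n + 1) =
      to_circle t [^]\<^bsub>circle_group\<lparr>carrier := \<Lambda>\<rparr>\<^esub> n + to_circle t" for n :: int
    using L.int_pow_mult[of "to_circle t" n 1] assms(2) by simp
  show ?thesis
  proof (induction n rule: int_induct[of _ 0])
    case base
    then show ?case by simp
  next
    case (step1 i)
    then show ?case using step[of i] by (simp add: algebra_simps)
  next
    case (step2 i)
    then have "to_circle t [^]\<^bsub>circle_group\<lparr>carrier := \<Lambda>\<rparr>\<^esub> (i - 1) = to_circle (of_int i * t) - to_circle t"
      using step[of "i - 1"] by (simp add: eq_diff_eq)
    then show ?case by (simp add: algebra_simps)
  qed
qed

text \<open>The covering numbers in \<open>E\<close> may project outside \<Lambda>, so each coset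
  that meets the preimage of \<Lambda> receives a representative there. These and b generate, since
  integers vanish on the circle.\<close>

lemma finitely_generated_circle:
  assumes \<Lambda>: "subgroup \<Lambda> circle_group" and b: "to_circle b \<in> \<Lambda>" and E: "finite E"
    and cover: "\<And>a. to_circle a \<in> \<Lambda> \<Longrightarrow> \<exists>e\<in>E. \<exists>m n::int. a = e + of_int m + of_int n * b"
  shows "finitely_generated circle_group \<Lambda>"
proof -
  interpret C: comm_group circle_group by (rule comm_group_circle_group)
  define coset where "coset e = {a. to_circle a \<in> \<Lambda> \<and> (\<exists>m n::int. a = e + of_int m + of_int n * b)}" for e
  define rep where "rep e = (SOME a. a \<in> coset e)" for e
  have rep: "rep e \<in> coset e" if "coset e \<noteq> {}" for e
    using that unfolding rep_def by (auto intro: someI)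
  define S where "S = insert (to_circle b) (to_circle ` rep ` {e\<in>E. coset e \<noteq> {}})"
  have S: "finite S" "S \<subseteq> \<Lambda>" using E b rep by (auto simp: S_def coset_def)
  have gen: "subgroup (generate circle_group S) circle_group"
    by (rule C.generate_is_subgroup) simp
  interpret R: real_lattice "{t. to_circle t \<in> generate circle_group S}"
    by (rule real_lattice_preimage[OF gen])
  have "\<Lambda> \<subseteq> generate circle_group S"
  proof
    fix x assume x: "x \<in> \<Lambda>"
    define a where "a = coord x"
    then obtain e m n where e: "e \<in> E" and a: "a = e + of_int m + of_int n * b"
      using cover[of a] x by auto
    have "to_circle a \<in> \<Lambda>" using x by (simp add: a_def)
    then have "a \<in> coset e" unfolding coset_def using a by blast
    then have ne: "coset e \<noteq> {}" by blast
    obtain m' n' where r: "rep e = e + of_int m' + of_int n' * b"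
      using rep[OF ne] by (auto simp: coset_def)
    have "to_circle (rep e) \<in> S" "to_circle b \<in> S" using e ne by (auto simp: S_def)
    then have "rep e \<in> {t. to_circle t \<in> generate circle_group S}"
      "b \<in> {t. to_circle t \<in> generate circle_group S}"
      by (simp_all add: generate.incl)
    then have "rep e + of_int (m - m') + of_int (n - n') * b \<in> {t. to_circle t \<in> generate circle_group S}"
      by (intro R.add_in R.of_int_in R.int_mult_in)
    moreover have "rep e + of_int (m - m') + of_int (n - n') * b = a"
      unfolding r a by (simp add: algebra_simps)
    ultimately show "x \<in> generate circle_group S" by (simp add: a_def)
  qed
  moreover have "generate circle_group S \<subseteq> \<Lambda>"
    by (rule C.generate_subgroup_incl[OF S(2) \<Lambda>])
  ultimately show ?thesis
    unfolding finitely_generated_def using S(1) by (intro exI[of _ S]) auto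
qed

text \<open>
  If no irrational \<open>\<beta>\<close> worked, then either \<open>\<Lambda>\<close> would be torsion, or every element of \<open>\<Lambda>\<close> would be
  commensurable with a single one, with finite index of the cyclic group it generates.
\<close>

lemma exists_rotation_group:
  assumes \<Lambda>: "subgroup \<Lambda> circle_group"
    and rank: "Q_rank (circle_group\<lparr>carrier := \<Lambda>\<rparr>) \<ge> 2 \<or>
      \<not> finitely_generated circle_group \<Lambda> \<and> Q_rank (circle_group\<lparr>carrier := \<Lambda>\<rparr>) = 1"
  shows "\<exists>b. rotation_group {t. to_circle t \<in> \<Lambda>} b"
proof -
  let ?G = "circle_group\<lparr>carrier := \<Lambda>\<rparr>"
  define A where "A = {t. to_circle t \<in> \<Lambda>}"
  interpret A: real_lattice A
    unfolding A_def by (rule real_lattice_preimage[OF \<Lambda>])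
  interpret G: comm_group ?G
    by (rule group.group_comm_groupI[OF subgroup.subgroup_is_group[OF \<Lambda>
        comm_group.axioms(2)[OF comm_group_circle_group]]]) (simp add: add.commute)
  have pow: "to_circle t [^]\<^bsub>?G\<^esub> n = to_circle (of_int n * t)" if "t \<in> A" for t and n :: int
    using circle_int_pow[OF \<Lambda>] that by (simp add: A_def)
  have coord_A: "coord x \<in> A" if "x \<in> \<Lambda>" for x using that by (simp add: A_def)
  have rank_ne: "Q_rank ?G \<noteq> 0"
  proof
    assume "Q_rank ?G = 0"
    then show False using rank by simp
  qed
  have "\<exists>\<beta>. \<beta> \<in> A \<and> \<beta> \<notin> \<rat>"
  proof (rule ccontr)
    assume "\<nexists>\<beta>. \<beta> \<in> A \<and> \<beta> \<notin> \<rat>"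
    then have rational: "t \<in> \<rat>" if "t \<in> A" for t using that by blast
    \<comment> \<open>Rational lifts make \<Lambda> a torsion group, that is, commensurable with the
      identity element, and the rank would be 0.\<close>
    have "\<exists>(k::int) (m::int). k \<noteq> 0 \<and> x [^]\<^bsub>?G\<^esub> k = \<one>\<^bsub>?G\<^esub> [^]\<^bsub>?G\<^esub> m" if "x \<in> carrier ?G" for x
    proof -
      have x: "coord x \<in> A" using that coord_A by simp
      obtain m n :: int where "n > 0" "coord x = of_int m / of_int n"
        using rational[OF x] by (rule Rats_cases')
      then have "of_int n * coord x = of_int m" by simp
      then have "x [^]\<^bsub>?G\<^esub> n = 0" using pow[OF x, of n] by simp
      then show ?thesis using \<open>n > 0\<close> by (intro exI[of _ n] exI[of _ 0]) simp
    qed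
    then have "Q_rank ?G = 0"
      using G.Q_rank_eq_0[of "\<one>\<^bsub>?G\<^esub>"] G.one_closed by blast
    then show False using rank_ne by contradiction
  qed
  then obtain \<beta> where \<beta>: "\<beta> \<in> A" "\<beta> \<notin> \<rat>" by blast
  have far: "\<exists>a\<in>A. \<forall>e\<in>E. \<forall>m n::int. a \<noteq> e + of_int m + of_int n * \<beta>" if E: "finite E" for E
  proof (rule ccontr)
    assume "\<not> ?thesis"
    then have cover: "\<exists>e\<in>E. \<exists>m n::int. a = e + of_int m + of_int n * \<beta>" if "a \<in> A" for a
      using that by blast
    \<comment> \<open>A finite cover by cosets has two consequences: commensurability with \<beta>,
      so rank at most 1, and finite generation. Together they exclude both alternatives of the
      hypothesis.\<close>
    have "\<exists>(k::int) (m::int). k \<noteq> 0 \<and> x [^]\<^bsub>?G\<^esub> k = to_circle \<beta> [^]\<^bsub>?G\<^esub> m" if "x \<in> carrier ?G" for x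
    proof -
      have x: "coord x \<in> A" using that coord_A by simp
      obtain k :: nat and m n :: int where k: "k > 0" "of_nat k * coord x = of_int m + of_int n * \<beta>"
        using multiples_collide[OF E cover[OF A.nat_mult_in[OF x]]] by blast
      have "x [^]\<^bsub>?G\<^esub> int k = to_circle (of_int n * \<beta> + of_int m)"
        using pow[OF x, of "int k"] k(2) by (simp add: add.commute)
      also have "\<dots> = to_circle \<beta> [^]\<^bsub>?G\<^esub> n"
        using pow[OF \<beta>(1), of n] by simp
      finally show ?thesis using k(1) by (intro exI[of _ "int k"] exI[of _ n]) simp
    qed
    then have "Q_rank ?G \<le> 1"
      using G.Q_rank_le_1[of "to_circle \<beta>"] \<beta>(1) by (simp add: A_def)
    moreover have "\<not> (2::enat) \<le> 1" by (simp add: one_enat_def numeral_eq_enat)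
    ultimately have "\<not> Q_rank ?G \<ge> 2" using order.trans by blast
    moreover have "finitely_generated circle_group \<Lambda>"
      using finitely_generated_circle[OF \<Lambda> _ E] \<beta>(1) cover by (simp add: A_def)
    ultimately show False using rank by blast
  qed
  \<comment> \<open>Replace \<beta> by a small irrational b in Z + \<beta>Z. As Z + bZ is contained
    in Z + \<beta>Z, infinite index is inherited.\<close>
  have "\<exists>k::nat. k > 0 \<and> frac (of_nat k * \<beta>) \<in> {0<..<1/3}"
    by (rule exists_frac_between[OF \<beta>(2)]) simp_all
  then obtain k :: nat where k: "k > 0" "frac (of_nat k * \<beta>) \<in> {0<..<1/3}" by (elim exE conjE)
  define b where "b = frac (of_nat k * \<beta>)"
  have b: "b = of_nat k * \<beta> - of_int \<lfloor>of_nat k * \<beta>\<rfloor>" by (simp add: b_def frac_def)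
  have "rotation_group A b"
  proof
    show "b \<in> A" unfolding b by (intro A.diff_in A.nat_mult_in A.of_int_in \<beta>(1))
    show "b \<notin> \<rat>"
    proof
      assume "b \<in> \<rat>"
      then have "(b + of_int \<lfloor>of_nat k * \<beta>\<rfloor>) / of_nat k \<in> \<rat>" by simp
      moreover have "(b + of_int \<lfloor>of_nat k * \<beta>\<rfloor>) / of_nat k = \<beta>"
        unfolding b using k(1) by simp
      ultimately show False using \<beta>(2) by simp
    qed
    show "0 < b" "b \<le> 1 / 3" using k(2) unfolding b_def by (simp_all only: greaterThanLessThan_iff less_imp_le)
    fix E :: "real set" assume "finite E"
    from far[OF this] obtain a where a: "a \<in> A" "\<And>e m n. e \<in> E \<Longrightarrow> a \<noteq> e + of_int m + of_int n * \<beta>"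
      by (elim bexE) simp
    have "a \<noteq> e + of_int m + of_int n * b" if e: "e \<in> E" for e m n
    proof
      assume "a = e + of_int m + of_int n * b"
      also have "\<dots> = e + of_int (m - n * \<lfloor>of_nat k * \<beta>\<rfloor>) + of_int (n * int k) * \<beta>"
        unfolding b by (simp add: algebra_simps)
      finally have "a = e + of_int (m - n * \<lfloor>of_nat k * \<beta>\<rfloor>) + of_int (n * int k) * \<beta>" .
      from a(2)[OF e] this show False by (rule notE)
    qed
    then show "\<exists>a\<in>A. \<forall>e\<in>E. \<forall>m n. a \<noteq> e + of_int m + of_int n * b" using a(1) by blast
  qed
  then show ?thesis unfolding A_def by blast
qed

lemma IET_on_not_stably_realizable:
  assumes \<Lambda>: "subgroup \<Lambda> circle_group"
    and rank: "Q_rank (circle_group\<lparr>carrier := \<Lambda>\<rparr>) \<ge> 2 \<or>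
      \<not> finitely_generated circle_group \<Lambda> \<and> Q_rank (circle_group\<lparr>carrier := \<Lambda>\<rparr>) = 1"
  shows "\<not> stably_realizable_on_circle (IET_pm_on \<Lambda>)" "\<not> stably_realizable_on_circle (IET_bowtie_on \<Lambda>)"
proof -
  obtain b where b: "rotation_group {t. to_circle t \<in> \<Lambda>} b"
    using exists_rotation_group[OF assms] by blast
  have "near_class UNIV ` lattice_iet {t. to_circle t \<in> \<Lambda>} \<subseteq> IET_pm_on \<Lambda>"
    by (rule lattice_iet_subset_IET_pm_on) auto
  then show pm: "\<not> stably_realizable_on_circle (IET_pm_on \<Lambda>)"
    using rotation_group.lattice_iet_not_stably_realizable[OF b] stably_realizable_on_circle_mono by blast
  have "IET_pm_on \<Lambda> \<subseteq> IET_bowtie_on \<Lambda>" by (simp add: IET_pm_on_def)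
  then show "\<not> stably_realizable_on_circle (IET_bowtie_on \<Lambda>)"
    using pm stably_realizable_on_circle_mono by blast
qed

text \<open>The parameters whose class lies in \<open>H\<close> form a group of reals, so membership
  for all of \<open>A\<close> can be checked on generators of \<open>A\<close>.\<close>

lemma real_subgroup_near_class:
  assumes H: "subgroup H (near_sym UNIV)"
    and bij: "\<And>t. bij (f t)" and f_0: "f 0 = id" and f_add: "\<And>s t. f s \<circ> f t = f (s + t)"
  shows "real_subgroup {t. near_class UNIV (f t) \<in> H}"
proof
  have one: "near_class UNIV (f 0) = \<one>\<^bsub>near_sym UNIV\<^esub>"
    by (simp add: near_class_def near_sym_def f_0)
  then show "0 \<in> {t. near_class UNIV (f t) \<in> H}"
    using subgroup.one_closed[OF H] by simp
  fix s t assume "s \<in> {t. near_class UNIV (f t) \<in> H}" "t \<in> {t. near_class UNIV (f t) \<in> H}"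
  then have st: "near_class UNIV (f s) \<in> H" "near_class UNIV (f t) \<in> H" by simp_all
  have mult: "near_class UNIV (f u) \<otimes>\<^bsub>near_sym UNIV\<^esub> near_class UNIV (f v) = near_class UNIV (f (u + v))" for u v
    using near_class_comp[OF bij bij] f_add by metis
  have carrier: "near_class UNIV (f u) \<in> carrier (near_sym UNIV)" for u
    unfolding near_class_def using bij by (intro near_sym_carrierI near_bij_perm)
  have "inv\<^bsub>near_sym UNIV\<^esub> near_class UNIV (f t) = near_class UNIV (f (- t))"
    using mult[of "- t" t] one by (intro group.inv_equality[OF group_near_sym] carrier) simp_all
  then have "near_class UNIV (f (- t)) \<in> H"
    using subgroup.m_inv_closed[OF H st(2)] by simp
  then show "s - t \<in> {t. near_class UNIV (f t) \<in> H}"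
    using subgroup.m_closed[OF H st(1)] mult[of s "- t"] by force
qed

text \<open>Take A = Z + bZ + cZ with 1, b, c independent over the rationals: it is finitely
  generated, yet Z + bZ has infinite index in it.\<close>

lemma exists_finitely_generated_not_stably_realizable:
  "\<exists>H. subgroup H (near_sym UNIV) \<and> H \<subseteq> IET_pm \<and> finitely_generated (near_sym UNIV) H
     \<and> \<not> stably_realizable_on_circle H"
proof -
  have "uncountable ({0<..<1/3} - (\<rat> :: real set))"
    by (intro uncountable_minus_countable countable_rat) (simp add: uncountable_open_interval)
  then have "{0<..<1/3} - (\<rat> :: real set) \<noteq> {}" by (metis countable_empty)
  then obtain b :: real where b: "0 < b" "b < 1/3" "b \<notin> \<rat>"
    unfolding ex_in_conv[symmetric] Diff_iff greaterThanLessThan_iff by blast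
  \<comment> \<open>This is the rational span of 1 and b with denominators cleared; the value for k
    = 0 is 0 by the convention on division, already in the span.\<close>
  let ?span = "range (\<lambda>(m::int, n::int, k::nat). (of_int m + of_int n * b) / of_nat k)"
  have "uncountable (UNIV - ?span)"
    by (intro uncountable_minus_countable uncountable_UNIV_real countable_image) simp
  then have "UNIV - ?span \<noteq> {}" by (metis countable_empty)
  then obtain c where c': "c \<notin> ?span" by blast
  have c: "c \<noteq> (of_int m + of_int n * b) / of_nat k" for m n :: int and k :: nat
  proof
    assume "c = (of_int m + of_int n * b) / of_nat k"
    then have "c \<in> ?span" by (intro range_eqI[of _ _ "(m, n, k)"]) simp
    then show False using c' by contradiction
  qed
  define A where "A = {t. \<exists>m n k::int. t = of_int m + of_int n * b + of_int k * c}"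
  have A_I: "of_int m + of_int n * b + of_int k * c \<in> A" for m n k
    unfolding A_def by blast
  interpret rotation_group A b
  proof
    show "0 \<in> A" "1 \<in> A" "b \<in> A" using A_I[of 0 0 0] A_I[of 1 0 0] A_I[of 0 1 0] by simp_all
    show "s - t \<in> A" if st: "s \<in> A" "t \<in> A" for s t
    proof -
      obtain m n k m' n' k' where "s = of_int m + of_int n * b + of_int k * c"
        "t = of_int m' + of_int n' * b + of_int k' * c" using st unfolding A_def by blast
      then have "s - t = of_int (m - m') + of_int (n - n') * b + of_int (k - k') * c"
        by (simp add: algebra_simps)
      then show ?thesis using A_I[of "m - m'" "n - n'" "k - k'"] by simp
    qed
    show "b \<notin> \<rat>" "0 < b" "b \<le> 1/3" using b by simp_all
    fix E :: "real set" assume E: "finite E"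
    show "\<exists>a\<in>A. \<forall>e\<in>E. \<forall>m n. a \<noteq> e + of_int m + of_int n * b"
    proof (rule ccontr)
      assume "\<not> ?thesis"
      then have cover: "\<exists>e\<in>E. \<exists>m n::int. a = e + of_int m + of_int n * b" if "a \<in> A" for a
        using that by blast
      have "of_nat k * c \<in> A" for k using A_I[of 0 0 "int k"] by simp
      then obtain k :: nat and m n :: int where "k > 0" "of_nat k * c = of_int m + of_int n * b"
        using multiples_collide[OF E cover] by blast
      then have "c = (of_int m + of_int n * b) / of_nat k" by (simp add: field_simps)
      then show False using c by blast
    qed
  qed
  have c_in: "c \<in> A" using A_I[of 0 0 1] by simp
  \<comment> \<open>\<open>rot 1\<close> and \<open>arc_rot b b\<close> are the identity, so two
    rotations of each kind already account for 1, b and c.\<close>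
  define S where "S = near_class UNIV ` {rot b, rot c, arc_rot b 1, arc_rot b c, flip b}"
  define H where "H = generate (near_sym UNIV) S"
  have "S \<subseteq> near_class UNIV ` lattice_iet A"
    unfolding S_def
    by (intro image_mono) (simp add: rot_lattice_iet arc_rot_lattice_iet flip_lattice_iet b_in c_in one_in)
  then have H_sub: "H \<subseteq> near_class UNIV ` lattice_iet A"
    unfolding H_def by (rule group.generate_subgroup_incl[OF group_near_sym _ near_lattice_iet_subgroup])
  have S_carrier: "S \<subseteq> carrier (near_sym UNIV)"
    using \<open>S \<subseteq> near_class UNIV ` lattice_iet A\<close> subgroup.subset[OF near_lattice_iet_subgroup] by blast
  have H: "subgroup H (near_sym UNIV)"
    unfolding H_def by (rule group.generate_is_subgroup[OF group_near_sym S_carrier])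
  have S_H: "near_class UNIV f \<in> H" if "f \<in> {rot b, rot c, arc_rot b 1, arc_rot b c, flip b}" for f
    unfolding H_def by (rule generate.incl) (use that in \<open>auto simp: S_def\<close>)
  have id_H: "near_class UNIV id \<in> H"
    using subgroup.one_closed[OF H] by (simp add: near_class_def near_sym_def)
  interpret R: real_subgroup "{t. near_class UNIV (rot t) \<in> H}"
    by (rule real_subgroup_near_class[OF H]) (simp_all add: bij_rot fun_eq_iff rot_rot)
  interpret R': real_subgroup "{t. near_class UNIV (arc_rot b t) \<in> H}"
    by (rule real_subgroup_near_class[OF H]) (simp_all add: bij_arc_rot fun_eq_iff arc_rot_arc_rot)
  have "rot 1 = id" using to_circle_of_int[of 1] by (simp add: rot_def fun_eq_iff)
  then have R_gens: "1 \<in> {t. near_class UNIV (rot t) \<in> H}" "b \<in> {t. near_class UNIV (rot t) \<in> H}"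
      "c \<in> {t. near_class UNIV (rot t) \<in> H}"
    using S_H id_H by simp_all
  have "arc_rot b b = id" using arc_rot_period[of 1] by (simp add: fun_eq_iff)
  then have R'_gens: "1 \<in> {t. near_class UNIV (arc_rot b t) \<in> H}" "b \<in> {t. near_class UNIV (arc_rot b t) \<in> H}"
      "c \<in> {t. near_class UNIV (arc_rot b t) \<in> H}"
    using S_H id_H by simp_all
  have A_E: "\<exists>m n k::int. t = of_int m * 1 + of_int n * b + of_int k * c" if "t \<in> A" for t
    using that unfolding A_def by simp
  have "\<not> stably_realizable_on_circle H"
  proof (rule not_stably_realizable)
    show "C \<otimes>\<^bsub>near_sym UNIV\<^esub> D \<in> H" if "C \<in> H" "D \<in> H" for C D
      by (rule subgroup.m_closed[OF H that])
    show "near_class UNIV (rot t) \<in> H" if "t \<in> A" for t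
    proof -
      obtain m n k :: int where t: "t = of_int m * 1 + of_int n * b + of_int k * c"
        using A_E[OF \<open>t \<in> A\<close>] by blast
      have "t \<in> {t. near_class UNIV (rot t) \<in> H}"
        unfolding t by (intro R.add_in R.int_mult_in R_gens)
      then show ?thesis by simp
    qed
    show "near_class UNIV (arc_rot b t) \<in> H" if "t \<in> A" for t
    proof -
      obtain m n k :: int where t: "t = of_int m * 1 + of_int n * b + of_int k * c"
        using A_E[OF \<open>t \<in> A\<close>] by blast
      have "t \<in> {t. near_class UNIV (arc_rot b t) \<in> H}"
        unfolding t by (intro R'.add_in R'.int_mult_in R'_gens)
      then show ?thesis by simp
    qed
    show "near_class UNIV (flip b) \<in> H" by (rule S_H) simp
  qed
  moreover have "H \<subseteq> IET_pm"
    using H_sub lattice_iet_subset_IET_pm_on[OF subset_UNIV, of A] unfolding IET_pm_on_def by blast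
  moreover have "finitely_generated (near_sym UNIV) H"
    unfolding finitely_generated_def using S_carrier by (intro exI[of _ S]) (simp add: H_def S_def)
  ultimately show ?thesis using H by blast
qed

theorem theorem4p18:
  shows "\<not> stably_realizable_on_circle IET_pm
    \<and> \<not> stably_realizable_on_circle IET_bowtie
    \<and> (\<exists>H. subgroup H (near_sym UNIV) \<and> H \<subseteq> IET_pm \<and> finitely_generated (near_sym UNIV) H
          \<and> \<not> stably_realizable_on_circle H)
    \<and> (\<forall>\<Lambda>. subgroup \<Lambda> circle_group \<and>
            (Q_rank (circle_group\<lparr>carrier := \<Lambda>\<rparr>) \<ge> 2 \<or>
             \<not> finitely_generated circle_group \<Lambda> \<and> Q_rank (circle_group\<lparr>carrier := \<Lambda>\<rparr>) = 1)
          \<longrightarrow> \<not> stably_realizable_on_circle (IET_pm_on \<Lambda>)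
            \<and> \<not> stably_realizable_on_circle (IET_bowtie_on \<Lambda>))"
proof (intro conjI allI impI)
  obtain H where H: "H \<subseteq> IET_pm" "\<not> stably_realizable_on_circle H"
    using exists_finitely_generated_not_stably_realizable by blast
  show pm: "\<not> stably_realizable_on_circle IET_pm"
    using stably_realizable_on_circle_mono[OF _ H(1)] H(2) by blast
  show "\<not> stably_realizable_on_circle IET_bowtie"
    using stably_realizable_on_circle_mono[OF _ IET_subsets(2)] pm by blast
qed (use exists_finitely_generated_not_stably_realizable IET_on_not_stably_realizable in simp_all)

end
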